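(* There is a deterministic algorithm that, given a weighted metric space $(V,w,d)$ of size $n$ and an integer $1\le k\le n$, computes a set $S\subseteq V$ with $|S|\le k$ that is an $O(\log^2(n/k))$-approximate solution to the $k$-means problem, in $\tilde O(nk)$ time.
   Context: A weighted metric space $(V,w,d)$ consists of a finite set $V$, weights $w:V\to\mathbb{R}_{\ge0}$ and a metric $d$. For $S\subseteq V$, $d(x,S)=\min_{y\in S}d(x,y)$. The $k$-means problem asks for $S\subseteq V$ with $|S|\le k$ minimizing $\mathrm{cost}(S)=\sum_{x\in V}w(x)\,d(x,S)^2$; an $\alpha$-approximate solution has cost at most $\alpha$ times the minimum. The algorithm accesses the metric via distance queries; $\tilde O(\cdot)$ hides factors polylogarithmic in $n$ and the aspect ratio $\Delta$ (ratio of maximum to minimum non-zero distance). *)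

theory Defs
  imports "HOL-Analysis.Analysis" "HOL-Library.Log_Nat"
begin

section \<open>The weighted \<open>k\<close>-means problem\<close>

locale weighted_metric_space = Metric_space V d
  for V :: "'a set" and w :: "'a \<Rightarrow> real" and d :: "'a \<Rightarrow> 'a \<Rightarrow> real" +
  assumes finite_V: "finite V"
    and weight_nonneg: "x \<in> V \<Longrightarrow> 0 \<le> w x"

definition dist_to_set :: "('a \<Rightarrow> 'a \<Rightarrow> real) \<Rightarrow> 'a \<Rightarrow> 'a set \<Rightarrow> real" where
  "dist_to_set d x S = Min ((\<lambda>y. d x y) ` S)"

definition kmeans_cost ::
    "'a set \<Rightarrow> ('a \<Rightarrow> real) \<Rightarrow> ('a \<Rightarrow> 'a \<Rightarrow> real) \<Rightarrow> 'a set \<Rightarrow> real" where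
  "kmeans_cost V w d S = (\<Sum>x\<in>V. w x * (dist_to_set d x S)\<^sup>2)"

text \<open>The empty set is excluded because \<open>d(x, S)\<close> is a minimum over \<open>S\<close>.\<close>

definition kmeans_feasible :: "'a set \<Rightarrow> nat \<Rightarrow> 'a set \<Rightarrow> bool" where
  "kmeans_feasible V k S \<longleftrightarrow> S \<subseteq> V \<and> S \<noteq> {} \<and> card S \<le> k"

definition kmeans_opt ::
    "'a set \<Rightarrow> ('a \<Rightarrow> real) \<Rightarrow> ('a \<Rightarrow> 'a \<Rightarrow> real) \<Rightarrow> nat \<Rightarrow> real" where
  "kmeans_opt V w d k = Min (kmeans_cost V w d ` {S. kmeans_feasible V k S})"

definition kmeans_approx ::
    "real \<Rightarrow> 'a set \<Rightarrow> ('a \<Rightarrow> real) \<Rightarrow> ('a \<Rightarrow> 'a \<Rightarrow> real) \<Rightarrow> nat \<Rightarrow> 'a set \<Rightarrow> bool" where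
  "kmeans_approx \<alpha> V w d k S \<longleftrightarrow>
     kmeans_feasible V k S \<and> kmeans_cost V w d S \<le> \<alpha> * kmeans_opt V w d k"

text \<open>A one-point space has no non-zero distance; its aspect ratio is set to 1.\<close>

definition aspect_ratio :: "'a set \<Rightarrow> ('a \<Rightarrow> 'a \<Rightarrow> real) \<Rightarrow> real" where
  "aspect_ratio V d =
     (let D = {d x y | x y. x \<in> V \<and> y \<in> V \<and> d x y \<noteq> 0}
      in if D = {} then 1 else Max D / Min D)"


section \<open>Deterministic algorithms with a distance oracle\<close>

text \<open>
  Algorithms are programs of a deterministic while language for a real RAM: natural-number and
  real variables, one-dimensional arrays of either kind, and a distance query \<open>RDist\<close>. A program is
  a finite piece of syntax and cannot depend on the instance. There is no conversion from reals to
  natural numbers (no rounding), and the only constants are natural numbers.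

  Time: each operation on reals, each distance query and each control step costs 1. Operations on
  natural numbers, including array indexing, are charged the bit length of the values involved, so
  that arithmetic on large integers does not come for free; for integers polynomial in \<open>n\<close> this is
  a factor \<open>O(log n)\<close> compared to a word RAM.
\<close>

type_synonym vname = string

datatype iexp =
    INum nat
  | IVar vname
  | IGet vname iexp
  | IAdd iexp iexp
  | ISub iexp iexp
  | IMul iexp iexp
  | IDiv iexp iexp

datatype rexp =
    RNat iexp
  | RVar vname
  | RGet vname iexp
  | RDist iexp iexp
  | RAdd rexp rexp
  | RSub rexp rexp
  | RMul rexp rexp
  | RDiv rexp rexp

datatype bexp =
    ILess iexp iexp
  | RLess rexp rexp
  | BNot bexp
  | BAnd bexp bexp

datatype com =
    Skip
  | ISet vname iexp
  | RSet vname rexp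
  | IPut vname iexp iexp
  | RPut vname iexp rexp
  | Seq com com
  | Cond bexp com com
  | While bexp com

record state =
  ivar :: "vname \<Rightarrow> nat"
  rvar :: "vname \<Rightarrow> real"
  iarr :: "vname \<Rightarrow> nat \<Rightarrow> nat"
  rarr :: "vname \<Rightarrow> nat \<Rightarrow> real"

primrec ival :: "state \<Rightarrow> iexp \<Rightarrow> nat" where
  "ival s (INum m) = m"
| "ival s (IVar x) = ivar s x"
| "ival s (IGet a i) = iarr s a (ival s i)"
| "ival s (IAdd e f) = ival s e + ival s f"
| "ival s (ISub e f) = ival s e - ival s f"
| "ival s (IMul e f) = ival s e * ival s f"
| "ival s (IDiv e f) = ival s e div ival s f"

abbreviation word_cost :: "nat \<Rightarrow> nat" where
  "word_cost m \<equiv> 1 + floorlog 2 m"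

text \<open>Every node of an expression is charged for its own value; the operands are charged as nodes.\<close>

primrec icost :: "state \<Rightarrow> iexp \<Rightarrow> nat" where
  "icost s (INum m) = word_cost m"
| "icost s (IVar x) = word_cost (ivar s x)"
| "icost s (IGet a i) = word_cost (ival s (IGet a i)) + icost s i"
| "icost s (IAdd e f) = word_cost (ival s (IAdd e f)) + icost s e + icost s f"
| "icost s (ISub e f) = word_cost (ival s (ISub e f)) + icost s e + icost s f"
| "icost s (IMul e f) = word_cost (ival s (IMul e f)) + icost s e + icost s f"
| "icost s (IDiv e f) = word_cost (ival s (IDiv e f)) + icost s e + icost s f"

context
  fixes d :: "nat \<Rightarrow> nat \<Rightarrow> real"
begin

primrec rval :: "state \<Rightarrow> rexp \<Rightarrow> real" where
  "rval s (RNat e) = real (ival s e)"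
| "rval s (RVar x) = rvar s x"
| "rval s (RGet a i) = rarr s a (ival s i)"
| "rval s (RDist i j) = d (ival s i) (ival s j)"
| "rval s (RAdd e f) = rval s e + rval s f"
| "rval s (RSub e f) = rval s e - rval s f"
| "rval s (RMul e f) = rval s e * rval s f"
| "rval s (RDiv e f) = rval s e / rval s f"

primrec rcost :: "state \<Rightarrow> rexp \<Rightarrow> nat" where
  "rcost s (RNat e) = 1 + icost s e"
| "rcost s (RVar x) = 1"
| "rcost s (RGet a i) = 1 + icost s i"
| "rcost s (RDist i j) = 1 + icost s i + icost s j"
| "rcost s (RAdd e f) = 1 + rcost s e + rcost s f"
| "rcost s (RSub e f) = 1 + rcost s e + rcost s f"
| "rcost s (RMul e f) = 1 + rcost s e + rcost s f"
| "rcost s (RDiv e f) = 1 + rcost s e + rcost s f"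

primrec bval :: "state \<Rightarrow> bexp \<Rightarrow> bool" where
  "bval s (ILess e f) \<longleftrightarrow> ival s e < ival s f"
| "bval s (RLess e f) \<longleftrightarrow> rval s e < rval s f"
| "bval s (BNot b) \<longleftrightarrow> \<not> bval s b"
| "bval s (BAnd b c) \<longleftrightarrow> bval s b \<and> bval s c"

primrec bcost :: "state \<Rightarrow> bexp \<Rightarrow> nat" where
  "bcost s (ILess e f) = 1 + icost s e + icost s f"
| "bcost s (RLess e f) = 1 + rcost s e + rcost s f"
| "bcost s (BNot b) = 1 + bcost s b"
| "bcost s (BAnd b c) = 1 + bcost s b + bcost s c"

text \<open>\<open>exec c s t s'\<close>: started in \<open>s\<close>, the program \<open>c\<close> halts after time \<open>t\<close> in \<open>s'\<close>.\<close>

inductive exec :: "com \<Rightarrow> state \<Rightarrow> nat \<Rightarrow> state \<Rightarrow> bool" where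
  Skip: "exec Skip s 1 s"
| ISet: "exec (ISet x e) s (1 + icost s e) (s\<lparr>ivar := (ivar s)(x := ival s e)\<rparr>)"
| RSet: "exec (RSet x e) s (1 + rcost s e) (s\<lparr>rvar := (rvar s)(x := rval s e)\<rparr>)"
| IPut: "exec (IPut a i e) s (1 + icost s i + icost s e)
           (s\<lparr>iarr := (iarr s)(a := (iarr s a)(ival s i := ival s e))\<rparr>)"
| RPut: "exec (RPut a i e) s (1 + icost s i + rcost s e)
           (s\<lparr>rarr := (rarr s)(a := (rarr s a)(ival s i := rval s e))\<rparr>)"
| Seq: "exec c\<^sub>1 s\<^sub>1 t\<^sub>1 s\<^sub>2 \<Longrightarrow> exec c\<^sub>2 s\<^sub>2 t\<^sub>2 s\<^sub>3 \<Longrightarrow> exec (Seq c\<^sub>1 c\<^sub>2) s\<^sub>1 (t\<^sub>1 + t\<^sub>2) s\<^sub>3"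
| CondTrue: "bval s b \<Longrightarrow> exec c\<^sub>1 s t s' \<Longrightarrow> exec (Cond b c\<^sub>1 c\<^sub>2) s (1 + bcost s b + t) s'"
| CondFalse: "\<not> bval s b \<Longrightarrow> exec c\<^sub>2 s t s' \<Longrightarrow> exec (Cond b c\<^sub>1 c\<^sub>2) s (1 + bcost s b + t) s'"
| WhileFalse: "\<not> bval s b \<Longrightarrow> exec (While b c) s (1 + bcost s b) s"
| WhileTrue: "bval s\<^sub>1 b \<Longrightarrow> exec c s\<^sub>1 t\<^sub>1 s\<^sub>2 \<Longrightarrow> exec (While b c) s\<^sub>2 t\<^sub>2 s\<^sub>3 \<Longrightarrow>
    exec (While b c) s\<^sub>1 (1 + bcost s\<^sub>1 b + t\<^sub>1 + t\<^sub>2) s\<^sub>3"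

inductive_cases Skip_E: "exec Skip s t s'"
inductive_cases ISet_E: "exec (ISet x e) s t s'"
inductive_cases RSet_E: "exec (RSet x e) s t s'"
inductive_cases IPut_E: "exec (IPut a i e) s t s'"
inductive_cases RPut_E: "exec (RPut a i e) s t s'"
inductive_cases Seq_E: "exec (Seq c\<^sub>1 c\<^sub>2) s t s'"
inductive_cases Cond_E: "exec (Cond b c\<^sub>1 c\<^sub>2) s t s'"
inductive_cases While_E: "exec (While b c) s t s'"

lemma exec_deterministic:
  "exec c s t s' \<Longrightarrow> exec c s u s'' \<Longrightarrow> u = t \<and> s'' = s'"
proof (induction arbitrary: u s'' rule: exec.induct)
  case (Skip s)
  then show ?case by (auto elim: Skip_E)
next
  case (ISet x e s)
  then show ?case by (auto elim: ISet_E)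
next
  case (RSet x e s)
  then show ?case by (auto elim: RSet_E)
next
  case (IPut a i e s)
  then show ?case by (auto elim: IPut_E)
next
  case (RPut a i e s)
  then show ?case by (auto elim: RPut_E)
next
  case (Seq c\<^sub>1 s\<^sub>1 t\<^sub>1 s\<^sub>2 c\<^sub>2 t\<^sub>2 s\<^sub>3)
  from Seq.prems show ?case by (rule Seq_E) (auto dest!: Seq.IH)
next
  case (CondTrue s b c\<^sub>1 t s' c\<^sub>2)
  from CondTrue.prems show ?case by (rule Cond_E) (use CondTrue.hyps(1) in \<open>auto dest!: CondTrue.IH\<close>)
next
  case (CondFalse s b c\<^sub>2 t s' c\<^sub>1)
  from CondFalse.prems show ?case by (rule Cond_E) (use CondFalse.hyps(1) in \<open>auto dest!: CondFalse.IH\<close>)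
next
  case (WhileFalse s b c)
  from WhileFalse.prems show ?case by (rule While_E) (use WhileFalse.hyps in auto)
next
  case (WhileTrue s\<^sub>1 b c t\<^sub>1 s\<^sub>2 t\<^sub>2 s\<^sub>3)
  from WhileTrue.prems show ?case by (rule While_E) (use WhileTrue.hyps(1) in \<open>auto dest!: WhileTrue.IH\<close>)
qed

end

text \<open>
  Input and output conventions. The points of a space of size \<open>n\<close> are numbered \<open>0, \<dots>, n - 1\<close>.
  Initially the variables \<open>n\<close> and \<open>k\<close> and the array \<open>w\<close> hold the input, and all other memory is 0;
  the metric is accessible only through \<open>RDist\<close>. On termination the solution is listed in the first
  \<open>m\<close> cells of the array \<open>S\<close>, where \<open>m\<close> is the value of the variable \<open>m\<close>.
\<close>

definition input_state :: "nat \<Rightarrow> (nat \<Rightarrow> real) \<Rightarrow> nat \<Rightarrow> state" where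
  "input_state n w k =
     \<lparr> ivar = (\<lambda>_. 0)(''n'' := n, ''k'' := k),
       rvar = (\<lambda>_. 0),
       iarr = (\<lambda>_ _. 0),
       rarr = (\<lambda>_ _. 0)(''w'' := (\<lambda>i. if i < n then w i else 0)) \<rparr>"

definition output_set :: "state \<Rightarrow> nat set" where
  "output_set s = iarr s ''S'' ` {..<ivar s ''m''}"

end

theory Submission
  imports Defs
begin

text \<open>
  The points are merged along a binary tree of blocks, starting from blocks of size \<open>k\<close>. Each block
  keeps a set of \<open>k\<close> times polylogarithmically many candidates; the candidates of two siblings are
  reduced by forward greedy, each step adding the candidate that saves most with respect to all
  \<^emph>\<open>original\<close> points of the block. If \<open>S\<close> is the old candidate set and \<open>Q\<close> an optimal solution, the
  nearest candidates \<open>P\<close> of \<open>Q\<close> satisfy \<open>d(x, P) \<le> 2 d(x, Q) + d(x, S)\<close>, and greedy comes within a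
  factor \<open>1 + O(1 / log n)\<close> of \<open>P\<close>. Hence the square root of the cost grows only by an additive
  \<open>O(sqrt OPT)\<close> in each of the \<open>O(log (n / k))\<close> levels. Greedy needs a start within a factor of the
  squared aspect ratio of the optimum, for any weights; the \<open>k\<close> heaviest points provide it. A
  point changes its recorded distance only when this distance drops by the factor \<open>q = 1 + 1 / lev\<close>, so the
  savings are updated only polylogarithmically often per point.

  The final candidates, weighted by the points they represent, are reduced to \<open>k\<close> centres within a
  constant factor by the hierarchical greedy algorithm of Mettu and Plaxton: choose the isolated ball
  of largest value, descend to ever smaller children of largest value, and repeat. Only the
  candidates that remain are few enough to compute all their mutual distances.
\<close>

section \<open>Step counting for programs\<close>

text \<open>The relative error per level must be as small as \<open>O(1 / lev)\<close> because it
  compounds: \<open>lev\<close> bounds the number of levels, so the product of all factors stays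
  constant and only the additive terms are counted. One and the same \<open>Q\<close> can be moved
  into every block of a level, since the loss in moving it is measured against each block's own
  candidates. Greedy contracts its gap by \<open>1 - 1 / k\<close> per round, so the number of
  rounds is governed by the logarithm of the ratio between its start and the cost of the competitor.
  Weights are arbitrary reals, so distances alone do not control this ratio; matching the heavy
  picks with the competing centres cancels the weights. The remaining distance ratio is found by
  doubling, since the machine has no rounding. Recomputing every saving in every round would
  multiply block size, candidates and rounds, about a factor \<open>k\<close> too much. With lazy
  distances an update is paid from a potential, the number of factors \<open>q\<close> still
  contained in the recorded distance; what is lost is a factor \<open>q\<^sup>2\<close> in the
  comparison with a competitor.\<close>

primrec ivs :: "com \<Rightarrow> vname set" where
  "ivs Skip = {}"
| "ivs (ISet x e) = {x}"
| "ivs (RSet x e) = {}"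
| "ivs (IPut a i e) = {}"
| "ivs (RPut a i e) = {}"
| "ivs (Seq a b) = ivs a \<union> ivs b"
| "ivs (Cond b c e) = ivs c \<union> ivs e"
| "ivs (While b c) = ivs c"

primrec rvs :: "com \<Rightarrow> vname set" where
  "rvs Skip = {}"
| "rvs (ISet x e) = {}"
| "rvs (RSet x e) = {x}"
| "rvs (IPut a i e) = {}"
| "rvs (RPut a i e) = {}"
| "rvs (Seq a b) = rvs a \<union> rvs b"
| "rvs (Cond b c e) = rvs c \<union> rvs e"
| "rvs (While b c) = rvs c"

primrec ias :: "com \<Rightarrow> vname set" where
  "ias Skip = {}"
| "ias (ISet x e) = {}"
| "ias (RSet x e) = {}"
| "ias (IPut a i e) = {a}"
| "ias (RPut a i e) = {}"
| "ias (Seq a b) = ias a \<union> ias b"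
| "ias (Cond b c e) = ias c \<union> ias e"
| "ias (While b c) = ias c"

primrec ras :: "com \<Rightarrow> vname set" where
  "ras Skip = {}"
| "ras (ISet x e) = {}"
| "ras (RSet x e) = {}"
| "ras (IPut a i e) = {}"
| "ras (RPut a i e) = {a}"
| "ras (Seq a b) = ras a \<union> ras b"
| "ras (Cond b c e) = ras c \<union> ras e"
| "ras (While b c) = ras c"

text \<open>Takes the place of a frame rule: whatever a program does not syntactically assign
  survives its execution, so that specifications need to mention only what changes.\<close>

definition frame :: "com \<Rightarrow> state \<Rightarrow> state \<Rightarrow> bool" where
  "frame c s s' \<longleftrightarrow> (\<forall>x. x \<notin> ivs c \<longrightarrow> ivar s' x = ivar s x) \<and> (\<forall>x. x \<notin> rvs c \<longrightarrow> rvar s' x = rvar s x)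
    \<and> (\<forall>x. x \<notin> ias c \<longrightarrow> iarr s' x = iarr s x) \<and> (\<forall>x. x \<notin> ras c \<longrightarrow> rarr s' x = rarr s x)"

lemma frame_refl: "frame c s s"
  by (simp add: frame_def)

lemma frame_trans: "frame c s s' \<Longrightarrow> frame c s' s'' \<Longrightarrow> frame c s s''"
  by (simp add: frame_def)

lemma exec_frame: "exec d c s t s' \<Longrightarrow> frame c s s'"
  by (induction rule: exec.induct) (auto simp: frame_def)

lemma frameD:
  assumes "frame c s s'"
  shows "x \<notin> ivs c \<Longrightarrow> ivar s' x = ivar s x" "x \<notin> rvs c \<Longrightarrow> rvar s' x = rvar s x"
    "x \<notin> ias c \<Longrightarrow> iarr s' x = iarr s x" "x \<notin> ras c \<Longrightarrow> rarr s' x = rarr s x"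
  using assms by (auto simp: frame_def)

primrec isize :: "iexp \<Rightarrow> nat" where
  "isize (INum m) = 1"
| "isize (IVar x) = 1"
| "isize (IGet a i) = 1 + isize i"
| "isize (IAdd e f) = 1 + isize e + isize f"
| "isize (ISub e f) = 1 + isize e + isize f"
| "isize (IMul e f) = 1 + isize e + isize f"
| "isize (IDiv e f) = 1 + isize e + isize f"

primrec rsize :: "rexp \<Rightarrow> nat" where
  "rsize (RNat e) = 1 + isize e"
| "rsize (RVar x) = 1"
| "rsize (RGet a i) = 1 + isize i"
| "rsize (RDist i j) = 1 + isize i + isize j"
| "rsize (RAdd e f) = 1 + rsize e + rsize f"
| "rsize (RSub e f) = 1 + rsize e + rsize f"
| "rsize (RMul e f) = 1 + rsize e + rsize f"
| "rsize (RDiv e f) = 1 + rsize e + rsize f"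

primrec bsize :: "bexp \<Rightarrow> nat" where
  "bsize (ILess e f) = 1 + isize e + isize f"
| "bsize (RLess e f) = 1 + rsize e + rsize f"
| "bsize (BNot b) = 1 + bsize b"
| "bsize (BAnd b c) = 1 + bsize b + bsize c"

definition bounded :: "nat \<Rightarrow> state \<Rightarrow> bool" where
  "bounded M s \<longleftrightarrow> (\<forall>x. ivar s x \<le> M) \<and> (\<forall>a i. iarr s a i \<le> M)"

text \<open>Conditions are imposed only where a value can grow: literals, sums and products.
  Variables and array cells are covered by \<open>bounded\<close>, and truncated subtraction and
  division never exceed their first operand.\<close>

primrec ibd :: "nat \<Rightarrow> state \<Rightarrow> iexp \<Rightarrow> bool" where
  "ibd M s (INum m) \<longleftrightarrow> m \<le> M"
| "ibd M s (IVar x) \<longleftrightarrow> True"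
| "ibd M s (IGet a i) \<longleftrightarrow> ibd M s i"
| "ibd M s (IAdd e f) \<longleftrightarrow> ival s e + ival s f \<le> M \<and> ibd M s e \<and> ibd M s f"
| "ibd M s (ISub e f) \<longleftrightarrow> ibd M s e \<and> ibd M s f"
| "ibd M s (IMul e f) \<longleftrightarrow> ival s e * ival s f \<le> M \<and> ibd M s e \<and> ibd M s f"
| "ibd M s (IDiv e f) \<longleftrightarrow> ibd M s e \<and> ibd M s f"

primrec rbd :: "nat \<Rightarrow> state \<Rightarrow> rexp \<Rightarrow> bool" where
  "rbd M s (RNat e) \<longleftrightarrow> ibd M s e"
| "rbd M s (RVar x) \<longleftrightarrow> True"
| "rbd M s (RGet a i) \<longleftrightarrow> ibd M s i"
| "rbd M s (RDist i j) \<longleftrightarrow> ibd M s i \<and> ibd M s j"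
| "rbd M s (RAdd e f) \<longleftrightarrow> rbd M s e \<and> rbd M s f"
| "rbd M s (RSub e f) \<longleftrightarrow> rbd M s e \<and> rbd M s f"
| "rbd M s (RMul e f) \<longleftrightarrow> rbd M s e \<and> rbd M s f"
| "rbd M s (RDiv e f) \<longleftrightarrow> rbd M s e \<and> rbd M s f"

primrec bbd :: "nat \<Rightarrow> state \<Rightarrow> bexp \<Rightarrow> bool" where
  "bbd M s (ILess e f) \<longleftrightarrow> ibd M s e \<and> ibd M s f"
| "bbd M s (RLess e f) \<longleftrightarrow> rbd M s e \<and> rbd M s f"
| "bbd M s (BNot b) \<longleftrightarrow> bbd M s b"
| "bbd M s (BAnd b c) \<longleftrightarrow> bbd M s b \<and> bbd M s c"

lemma word_cost_mono: "m \<le> M \<Longrightarrow> word_cost m \<le> word_cost M"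
  by (simp add: floorlog_mono)

text \<open>Value and cost are bounded in one induction, because a difference or a quotient is
  bounded only through its operand.\<close>

lemma iexp_bound:
  assumes "bounded M s"
  shows "ibd M s e \<Longrightarrow> ival s e \<le> M \<and> icost s e \<le> word_cost M * isize e"
proof (induction e)
  case (IGet a e)
  have "word_cost (ival s (IGet a e)) \<le> word_cost M"
    using assms by (intro word_cost_mono) (auto simp: bounded_def)
  then show ?case using IGet assms by (auto simp: bounded_def algebra_simps)
next
  case (ISub e f)
  then have "word_cost (ival s (ISub e f)) \<le> word_cost M"
    by (intro word_cost_mono) auto
  then show ?case using ISub by (auto simp: algebra_simps)
next
  case (IDiv e f)
  have le: "ival s e div ival s f \<le> M" using IDiv
    by simp (meson div_le_dividend le_trans)
  have "word_cost (ival s (IDiv e f)) \<le> word_cost M"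
    using le by (intro word_cost_mono) auto
  then show ?case using IDiv le by (auto simp: algebra_simps)
next
  case (INum x)
  then show ?case using word_cost_mono[of x M] by simp
next
  case (IVar x)
  have "ivar s x \<le> M" using assms by (simp add: bounded_def)
  then show ?case using word_cost_mono[of "ivar s x" M] by simp
next
  case (IAdd e f)
  then have "word_cost (ival s (IAdd e f)) \<le> word_cost M"
    by (intro word_cost_mono) auto
  then show ?case using IAdd by (auto simp: algebra_simps)
next
  case (IMul e f)
  then have "word_cost (ival s (IMul e f)) \<le> word_cost M"
    by (intro word_cost_mono) auto
  then show ?case using IMul by (auto simp: algebra_simps)
qed

lemma rexp_bound:
  assumes "bounded M s"
  shows "rbd M s e \<Longrightarrow> rcost s e \<le> word_cost M * rsize e"
proof (induction e)
  case (RNat e)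
  then show ?case using iexp_bound[OF assms, of e] by (auto simp: algebra_simps)
next
  case (RGet a e)
  then show ?case using iexp_bound[OF assms, of e] by (auto simp: algebra_simps)
next
  case (RDist e f)
  then show ?case using iexp_bound[OF assms, of e] iexp_bound[OF assms, of f]
    by (auto simp: algebra_simps)
qed (auto simp: algebra_simps)

lemma bexp_bound:
  assumes "bounded M s"
  shows "bbd M s b \<Longrightarrow> bcost s b \<le> word_cost M * bsize b"
proof (induction b)
  case (ILess e f)
  then show ?case using iexp_bound[OF assms, of e] iexp_bound[OF assms, of f]
    by (auto simp: algebra_simps)
next
  case (RLess e f)
  then show ?case using rexp_bound[OF assms, of e] rexp_bound[OF assms, of f]
    by (auto simp: algebra_simps)
qed (auto simp: algebra_simps)

text \<open>\<open>wp\<close> counts steps; a step costs at most \<open>word_cost M\<close> as long as no integer exceeds \<open>M\<close>.\<close>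

definition wp :: "(nat \<Rightarrow> nat \<Rightarrow> real) \<Rightarrow> nat \<Rightarrow> com \<Rightarrow> (state \<Rightarrow> nat \<Rightarrow> bool) \<Rightarrow> state \<Rightarrow> bool" where
  "wp d M c Q s \<longleftrightarrow> (bounded M s \<longrightarrow>
     (\<exists>s' t \<tau>. exec d c s t s' \<and> t \<le> word_cost M * \<tau> \<and> bounded M s' \<and> Q s' \<tau>))"

lemma wp_Skip: "Q s 1 \<Longrightarrow> wp d M Skip Q s"
  unfolding wp_def by (metis Skip mult.right_neutral le_add1)

lemma wp_ISet:
  assumes "ibd M s e" "Q (s\<lparr>ivar := (ivar s)(x := ival s e)\<rparr>) (1 + isize e)"
  shows "wp d M (ISet x e) Q s"
  unfolding wp_def
proof
  assume b: "bounded M s"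
  from iexp_bound[OF b assms(1)] have e: "ival s e \<le> M" "icost s e \<le> word_cost M * isize e"
    by auto
  show "\<exists>s' t \<tau>. exec d (ISet x e) s t s' \<and> t \<le> word_cost M * \<tau> \<and> bounded M s' \<and> Q s' \<tau>"
    by (rule exI, rule exI, rule exI, rule conjI[OF ISet], rule conjI[OF _ conjI[OF _ assms(2)]])
      (use e b in \<open>auto simp: bounded_def algebra_simps\<close>)
qed

lemma wp_RSet:
  assumes "rbd M s e" "Q (s\<lparr>rvar := (rvar s)(x := rval d s e)\<rparr>) (1 + rsize e)"
  shows "wp d M (RSet x e) Q s"
  unfolding wp_def
proof
  assume b: "bounded M s"
  from rexp_bound[OF b assms(1)] have e: "rcost s e \<le> word_cost M * rsize e" .
  show "\<exists>s' t \<tau>. exec d (RSet x e) s t s' \<and> t \<le> word_cost M * \<tau> \<and> bounded M s' \<and> Q s' \<tau>"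
    by (rule exI, rule exI, rule exI, rule conjI[OF RSet], rule conjI[OF _ conjI[OF _ assms(2)]])
      (use e b in \<open>auto simp: bounded_def algebra_simps\<close>)
qed

lemma wp_IPut:
  assumes "ibd M s i" "ibd M s e"
    "Q (s\<lparr>iarr := (iarr s)(a := (iarr s a)(ival s i := ival s e))\<rparr>) (1 + isize i + isize e)"
  shows "wp d M (IPut a i e) Q s"
  unfolding wp_def
proof
  assume b: "bounded M s"
  from iexp_bound[OF b assms(1)] iexp_bound[OF b assms(2)]
  have e: "ival s e \<le> M" "icost s e \<le> word_cost M * isize e" "icost s i \<le> word_cost M * isize i"
    by auto
  show "\<exists>s' t \<tau>. exec d (IPut a i e) s t s' \<and> t \<le> word_cost M * \<tau> \<and> bounded M s' \<and> Q s' \<tau>"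
    by (rule exI, rule exI, rule exI, rule conjI[OF IPut], rule conjI[OF _ conjI[OF _ assms(3)]])
      (use e b in \<open>auto simp: bounded_def algebra_simps\<close>)
qed

lemma wp_RPut:
  assumes "ibd M s i" "rbd M s e"
    "Q (s\<lparr>rarr := (rarr s)(a := (rarr s a)(ival s i := rval d s e))\<rparr>) (1 + isize i + rsize e)"
  shows "wp d M (RPut a i e) Q s"
  unfolding wp_def
proof
  assume b: "bounded M s"
  from iexp_bound[OF b assms(1)] rexp_bound[OF b assms(2)]
  have e: "rcost s e \<le> word_cost M * rsize e" "icost s i \<le> word_cost M * isize i"
    by auto
  show "\<exists>s' t \<tau>. exec d (RPut a i e) s t s' \<and> t \<le> word_cost M * \<tau> \<and> bounded M s' \<and> Q s' \<tau>"
    by (rule exI, rule exI, rule exI, rule conjI[OF RPut], rule conjI[OF _ conjI[OF _ assms(3)]])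
      (use e b in \<open>auto simp: bounded_def algebra_simps\<close>)
qed

lemma wp_Seq:
  assumes "wp d M a (\<lambda>s1 t1. wp d M b (\<lambda>s2 t2. Q s2 (t1 + t2)) s1) s"
  shows "wp d M (Seq a b) Q s"
  unfolding wp_def
proof
  assume "bounded M s"
  with assms obtain s1 t1 \<tau>1 where 1: "exec d a s t1 s1" "t1 \<le> word_cost M * \<tau>1" "bounded M s1"
    "wp d M b (\<lambda>s2 t2. Q s2 (\<tau>1 + t2)) s1"
    unfolding wp_def[of _ _ a] by blast
  then obtain s2 t2 \<tau>2 where 2: "exec d b s1 t2 s2" "t2 \<le> word_cost M * \<tau>2" "bounded M s2" "Q s2 (\<tau>1 + \<tau>2)"
    unfolding wp_def by blast
  have "t1 + t2 \<le> word_cost M * (\<tau>1 + \<tau>2)" using 1 2 by (simp add: algebra_simps)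
  then show "\<exists>s' t \<tau>. exec d (Seq a b) s t s' \<and> t \<le> word_cost M * \<tau> \<and> bounded M s' \<and> Q s' \<tau>"
    using 1 2 Seq by blast
qed

lemma wp_Cond:
  assumes "bbd M s b" "bval d s b \<Longrightarrow> wp d M c (\<lambda>s' t. Q s' (1 + bsize b + t)) s"
    "\<not> bval d s b \<Longrightarrow> wp d M e (\<lambda>s' t. Q s' (1 + bsize b + t)) s"
  shows "wp d M (Cond b c e) Q s"
  unfolding wp_def
proof
  assume bd: "bounded M s"
  from bexp_bound[OF bd assms(1)] have e: "bcost s b \<le> word_cost M * bsize b" .
  show "\<exists>s' t \<tau>. exec d (Cond b c e) s t s' \<and> t \<le> word_cost M * \<tau> \<and> bounded M s' \<and> Q s' \<tau>"
  proof (cases "bval d s b")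
    case True
    from assms(2)[OF this] bd obtain s' t \<tau> where 1: "exec d c s t s'" "t \<le> word_cost M * \<tau>"
      "bounded M s'" "Q s' (1 + bsize b + \<tau>)" unfolding wp_def by blast
    have "1 + bcost s b + t \<le> word_cost M * (1 + bsize b + \<tau>)"
      using 1 e by (simp add: algebra_simps)
    with 1 CondTrue[of d s b, OF True] show ?thesis by blast
  next
    case False
    from assms(3)[OF this] bd obtain s' t \<tau> where 1: "exec d e s t s'" "t \<le> word_cost M * \<tau>"
      "bounded M s'" "Q s' (1 + bsize b + \<tau>)" unfolding wp_def by blast
    have "1 + bcost s b + t \<le> word_cost M * (1 + bsize b + \<tau>)"
      using 1 e by (simp add: algebra_simps)
    with 1 CondFalse[of d s b, OF False] show ?thesis by blast
  qed
qed

text \<open>Consequence rule that supplies the frame fact for free; verified subprograms are invoked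
  through it.\<close>

lemma wp_use:
  assumes "wp d M c Q' s" "\<And>s' \<tau>. frame c s s' \<Longrightarrow> Q' s' \<tau> \<Longrightarrow> Q s' \<tau>"
  shows "wp d M c Q s"
  using assms exec_frame unfolding wp_def by metis

text \<open>\<open>wp\<close> already has \<open>bounded\<close> as a premise, so it may be assumed.
  \<open>wp_For\<close> learns from it that the loop limit does not exceed \<open>M\<close>.\<close>

lemma wp_bounded:
  assumes "bounded M s \<Longrightarrow> wp d M c Q s"
  shows "wp d M c Q s"
  using assms unfolding wp_def by metis

text \<open>The invariant sees the steps spent so far, which makes amortised time bounds
  expressible. The measure \<open>m\<close> gives termination, and every iteration may use the frame
  of the whole loop.\<close>

lemma wp_While:
  fixes m :: "state \<Rightarrow> nat"
  assumes "Inv s 0"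
    and step: "\<And>s' \<tau>. Inv s' \<tau> \<Longrightarrow> frame (While b c) s s' \<Longrightarrow> bval d s' b \<Longrightarrow>
       wp d M c (\<lambda>s'' \<tau>'. Inv s'' (\<tau> + \<tau>' + 1 + bsize b) \<and> m s'' < m s') s'"
    and bd: "\<And>s' \<tau>. Inv s' \<tau> \<Longrightarrow> frame (While b c) s s' \<Longrightarrow> bbd M s' b"
    and post: "\<And>s' \<tau>. Inv s' \<tau> \<Longrightarrow> frame (While b c) s s' \<Longrightarrow> \<not> bval d s' b \<Longrightarrow> Q s' (\<tau> + 1 + bsize b)"
  shows "wp d M (While b c) Q s"
proof -
  have *: "Inv s' \<tau> \<Longrightarrow> frame (While b c) s s' \<Longrightarrow> bounded M s' \<Longrightarrow>
     \<exists>s'' t \<tau>'. exec d (While b c) s' t s'' \<and> t \<le> word_cost M * \<tau>' \<and> bounded M s'' \<and> Q s'' (\<tau> + \<tau>')" for s' \<tau>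
  proof (induction "m s'" arbitrary: s' \<tau> rule: less_induct)
    case less
    from bexp_bound[OF less.prems(3) bd[OF less.prems(1,2)]]
    have e: "bcost s' b \<le> word_cost M * bsize b" .
    show ?case
    proof (cases "bval d s' b")
      case True
      from step[OF less.prems(1,2) True] less.prems(3)
      obtain s1 t1 \<tau>1 where 1: "exec d c s' t1 s1" "t1 \<le> word_cost M * \<tau>1" "bounded M s1"
        "Inv s1 (\<tau> + \<tau>1 + 1 + bsize b)" "m s1 < m s'"
        unfolding wp_def by blast
      have "frame (While b c) s' s1" using exec_frame[OF 1(1)] by (simp add: frame_def)
      then have fr: "frame (While b c) s s1" by (rule frame_trans[OF less.prems(2)])
      from less.hyps[OF 1(5) 1(4) fr 1(3)]
      obtain s2 t2 \<tau>2 where 2: "exec d (While b c) s1 t2 s2" "t2 \<le> word_cost M * \<tau>2" "bounded M s2"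
        "Q s2 (\<tau> + \<tau>1 + 1 + bsize b + \<tau>2)" by blast
      have "1 + bcost s' b + t1 + t2 \<le> word_cost M * (\<tau>1 + 1 + bsize b + \<tau>2)"
        using 1 2 e by (simp add: algebra_simps)
      moreover have "Q s2 (\<tau> + (\<tau>1 + 1 + bsize b + \<tau>2))" using 2 by (simp add: add.assoc)
      ultimately show ?thesis using WhileTrue[of d s' b, OF True 1(1) 2(1)] 2(3) by blast
    next
      case False
      have "1 + bcost s' b \<le> word_cost M * (1 + bsize b)" using e by (simp add: algebra_simps)
      moreover have "Q s' (\<tau> + (1 + bsize b))"
        using post[OF less.prems(1,2) False] by (simp add: add.assoc)
      ultimately show ?thesis using WhileFalse[of d s' b, OF False] less.prems(3) by blast
    qed
  qed
  show ?thesis unfolding wp_def using *[OF assms(1) frame_refl] by simp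
qed

section \<open>Counted loops\<close>

definition For :: "vname \<Rightarrow> iexp \<Rightarrow> vname \<Rightarrow> com \<Rightarrow> com" where
  "For i lo h c = Seq (ISet i lo) (While (ILess (IVar i) (IVar h)) (Seq c (ISet i (IAdd (IVar i) (INum 1)))))"

lemma For_mods [simp]:
  "ivs (For i lo h c) = insert i (ivs c)" "rvs (For i lo h c) = rvs c"
  "ias (For i lo h c) = ias c" "ras (For i lo h c) = ras c"
  by (auto simp: For_def)

text \<open>The 8 steps per round are 4 for the test and 4 for the increment;
  \<open>isize lo + 5\<close> pays for the initialisation and the failing test. The body has to
  establish the invariant for the state in which the counter is already advanced.\<close>

lemma wp_For:
  assumes i: "i \<notin> ivs c" "h \<notin> ivs c" "h \<noteq> i"
    and lo: "ibd M s lo" "ival s lo = a" and h: "ivar s h = b" and ab: "a \<le> b"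
    and init: "Inv a (s\<lparr>ivar := (ivar s)(i := a)\<rparr>) 0"
    and step: "\<And>j s' \<tau>. a \<le> j \<Longrightarrow> j < b \<Longrightarrow> ivar s' i = j \<Longrightarrow> frame (For i lo h c) s s' \<Longrightarrow> Inv j s' \<tau> \<Longrightarrow>
       wp d M c (\<lambda>s'' \<tau>'. Inv (Suc j) (s''\<lparr>ivar := (ivar s'')(i := Suc j)\<rparr>) (\<tau> + \<tau>' + 8)) s'"
    and post: "\<And>s' \<tau>. frame (For i lo h c) s s' \<Longrightarrow> ivar s' i = b \<Longrightarrow> Inv b s' \<tau> \<Longrightarrow> Q s' (\<tau> + isize lo + 5)"
  shows "wp d M (For i lo h c) Q s"
proof (rule wp_bounded)
  assume "bounded M s"
  then have "ivar s h \<le> M" by (simp add: bounded_def)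
  with h have bM: "b \<le> M" by simp
  let ?s = "s\<lparr>ivar := (ivar s)(i := a)\<rparr>"
  have fr0: "frame (For i lo h c) s ?s" by (simp add: frame_def)
  show ?thesis unfolding For_def
  proof (intro wp_Seq wp_ISet)
    show "ibd M s lo" by fact
    show "wp d M (While (ILess (IVar i) (IVar h)) (Seq c (ISet i (IAdd (IVar i) (INum 1)))))
     (\<lambda>s2 t2. Q s2 (1 + isize lo + t2)) (s\<lparr>ivar := (ivar s)(i := ival s lo)\<rparr>)"
      unfolding lo(2)
    proof (rule wp_While[where m = "\<lambda>s'. b - ivar s' i" and
          Inv = "\<lambda>s' \<tau>. a \<le> ivar s' i \<and> ivar s' i \<le> b \<and> Inv (ivar s' i) s' \<tau> \<and> ivar s' h = b"])
      show "a \<le> ivar ?s i \<and> ivar ?s i \<le> b \<and> Inv (ivar ?s i) ?s 0 \<and> ivar ?s h = b"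
        using ab init h i by simp
    next
      fix s' \<tau>
      let ?W = "While (ILess (IVar i) (IVar h)) (Seq c (ISet i (IAdd (IVar i) (INum 1))))"
      assume I: "a \<le> ivar s' i \<and> ivar s' i \<le> b \<and> Inv (ivar s' i) s' \<tau> \<and> ivar s' h = b"
        and fr: "frame ?W ?s s'"
      have fr1: "frame (For i lo h c) s s'"
        using frame_trans[OF fr0, of s'] fr by (auto simp: frame_def For_def)
      show "bbd M s' (ILess (IVar i) (IVar h))" by simp
      { assume "\<not> bval d s' (ILess (IVar i) (IVar h))"
        with I have "ivar s' i = b" by simp
        then show "Q s' (1 + isize lo + (\<tau> + 1 + bsize (ILess (IVar i) (IVar h))))"
          using post[OF fr1, of \<tau>] I by (simp add: numeral_eq_Suc add.commute) }
      { assume "bval d s' (ILess (IVar i) (IVar h))"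
        with I have lt: "ivar s' i < b" by simp
        show "wp d M (Seq c (ISet i (IAdd (IVar i) (INum 1))))
            (\<lambda>s'' \<tau>'. (a \<le> ivar s'' i \<and> ivar s'' i \<le> b \<and> Inv (ivar s'' i) s'' (\<tau> + \<tau>' + 1 + bsize (ILess (IVar i) (IVar h))) \<and> ivar s'' h = b) \<and>
              b - ivar s'' i < b - ivar s' i) s'"
        proof (intro wp_Seq, rule wp_use[OF step[OF _ lt refl fr1, of \<tau>]], goal_cases)
          case (3 s1 \<tau>1)
          have "ivar s1 i = ivar s' i" "ivar s1 h = b" using frameD(1)[OF 3(1)] i I by auto
          with 3(2) lt bM I i show ?case
            by (intro wp_ISet) (auto simp: add.assoc numeral_eq_Suc)
        qed (use I in auto) }
    qed
  qed
qed

text \<open>The case of a uniform bound \<open>\<beta>\<close> per round: time disappears from the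
  invariant.\<close>

lemma wp_For_const:
  assumes i: "i \<notin> ivs c" "h \<notin> ivs c" "h \<noteq> i"
    and lo: "ibd M s lo" "ival s lo = a" and h: "ivar s h = b" and ab: "a \<le> b"
    and init: "Inv a (s\<lparr>ivar := (ivar s)(i := a)\<rparr>)"
    and step: "\<And>j s'. a \<le> j \<Longrightarrow> j < b \<Longrightarrow> ivar s' i = j \<Longrightarrow> frame (For i lo h c) s s' \<Longrightarrow> Inv j s' \<Longrightarrow>
       wp d M c (\<lambda>s'' \<tau>'. Inv (Suc j) (s''\<lparr>ivar := (ivar s'')(i := Suc j)\<rparr>) \<and> \<tau>' + 8 \<le> \<beta>) s'"
    and post: "\<And>s' \<tau>. frame (For i lo h c) s s' \<Longrightarrow> ivar s' i = b \<Longrightarrow> Inv b s' \<Longrightarrow>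
       \<tau> \<le> (b - a) * \<beta> + isize lo + 5 \<Longrightarrow> Q s' \<tau>"
  shows "wp d M (For i lo h c) Q s"
proof (rule wp_For[where Inv = "\<lambda>j s' \<tau>. Inv j s' \<and> \<tau> \<le> (j - a) * \<beta>", OF i lo h ab], goal_cases)
  case 1
  then show ?case using init by simp
next
  case (2 j s' \<tau>)
  show ?case
  proof (rule wp_use[OF step[OF 2(1-4)]], goal_cases)
    case 1 then show ?case using 2 by simp
  next
    case (2 s'' \<tau>')
    have "Suc j - a = Suc (j - a)" using \<open>a \<le> j\<close> by simp
    then show ?case using 2 \<open>Inv j s' \<and> \<tau> \<le> (j - a) * \<beta>\<close> by simp
  qed
next
  case (3 s' \<tau>)
  then show ?case using post by simp
qed

section \<open>Greedy centres from ball values\<close>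

lemma dist_to_set_le: "finite S \<Longrightarrow> y \<in> S \<Longrightarrow> dist_to_set d x S \<le> d x y"
  unfolding dist_to_set_def by (rule Min_le) auto

lemma dist_to_set_attained:
  assumes "finite S" "S \<noteq> {}"
  obtains y where "y \<in> S" "dist_to_set d x S = d x y"
proof -
  have "Min ((\<lambda>y. d x y) ` S) \<in> (\<lambda>y. d x y) ` S" using assms by (intro Min_in) auto
  then show ?thesis using that unfolding dist_to_set_def by auto
qed

lemma dist_to_set_ge:
  assumes "finite S" "S \<noteq> {}" "\<And>y. y \<in> S \<Longrightarrow> r \<le> d x y"
  shows "r \<le> dist_to_set d x S"
  using dist_to_set_attained[OF assms(1,2), of d x] assms(3) by metis

text \<open>\<open>R_last\<close> makes every point not yet chosen isolated at the last level, so a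
  choice is always possible. \<open>R_first\<close> replaces the missing larger ball for a point
  that is isolated already at level 0; \<open>132 = 3 * 44\<close>.\<close>

locale ball_greedy = Metric_space "{..<N}" \<delta>
  for N :: nat and \<delta> :: "nat \<Rightarrow> nat \<Rightarrow> real" +
  fixes \<mu> :: "nat \<Rightarrow> real" and R :: "nat \<Rightarrow> real" and L :: nat
  assumes weight: "y < N \<Longrightarrow> 0 \<le> \<mu> y"
    and R_Suc: "R (Suc j) = R j / 3" and R0: "0 < R 0"
    and R_last: "x < N \<Longrightarrow> y < N \<Longrightarrow> x \<noteq> y \<Longrightarrow> 44 * R L \<le> \<delta> x y"
    and R_first: "x < N \<Longrightarrow> y < N \<Longrightarrow> \<delta> x y \<le> 132 * R 0"
begin

lemma R_pos: "0 < R j"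
  by (induction j) (use R0 in \<open>auto simp: R_Suc\<close>)

lemma R_antimono: "i \<le> j \<Longrightarrow> R j \<le> R i"
proof (induction rule: dec_induct)
  case (step j)
  then show ?case using R_pos[of j] by (simp add: R_Suc)
qed simp

lemma R_le_iff: "R i \<le> R j \<longleftrightarrow> j \<le> i"
proof
  assume "R i \<le> R j"
  show "j \<le> i"
  proof (rule ccontr)
    assume "\<not> j \<le> i"
    then have "R j \<le> R (Suc i)" by (intro R_antimono) simp
    with \<open>R i \<le> R j\<close> R_pos[of i] show False by (simp add: R_Suc)
  qed
qed (rule R_antimono)

text \<open>The squared-distance form of the value of a ball: what a centre at \<open>x\<close>
  would save inside the ball if its points were otherwise served from distance
  \<open>R j\<close>.\<close>

definition val :: "nat \<Rightarrow> nat \<Rightarrow> real" where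
  "val x j = (\<Sum>y<N. \<mu> y * max 0 ((R j)\<^sup>2 - (\<delta> x y)\<^sup>2))"

definition iso :: "(nat \<Rightarrow> nat) \<Rightarrow> nat \<Rightarrow> nat \<Rightarrow> nat \<Rightarrow> bool" where
  "iso z m x j \<longleftrightarrow> (\<forall>i<m. 44 * R j \<le> \<delta> x (z i))"

lemma iso_upward: "iso z m x j \<Longrightarrow> j \<le> j' \<Longrightarrow> iso z m x j'"
  unfolding iso_def using R_antimono[of j j'] by fastforce

text \<open>
  A chain starts at an isolated ball and runs down to level \<open>L\<close>. The constants fit together as follows:
  the centre of a chain moves by at most \<open>6 R + 6 R / 3 + \<dots> = 9 R\<close> below a ball of radius \<open>R\<close>, so a
  point within \<open>2 R\<close> of the ball is within \<open>11 R\<close> of the final centre; isolation by \<open>44 R = 4 * 11 R\<close>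
  makes a later chain near the same point start at a radius at most \<open>R / 3\<close>, hence within
  \<open>2 R + 11 R / 3 \<le> 6 R\<close>, which is the range of the children.
\<close>

definition greedy_run :: "(nat \<Rightarrow> nat) \<Rightarrow> nat \<Rightarrow> (nat \<Rightarrow> nat) \<Rightarrow> (nat \<Rightarrow> nat \<Rightarrow> nat) \<Rightarrow> bool" where
  "greedy_run z m a ch \<longleftrightarrow> (\<forall>i<m. a i \<le> L \<and> (\<forall>l. a i \<le> l \<longrightarrow> l \<le> L \<longrightarrow> ch i l < N) \<and> z i = ch i L
     \<and> (\<forall>l. a i \<le> l \<longrightarrow> l < L \<longrightarrow> \<delta> (ch i l) (ch i (Suc l)) \<le> 6 * R l
          \<and> (\<forall>y<N. \<delta> (ch i l) y \<le> 6 * R l \<longrightarrow> val y (Suc l) \<le> val (ch i (Suc l)) (Suc l)))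
     \<and> iso z i (ch i (a i)) (a i)
     \<and> (\<forall>x<N. \<forall>j\<le>L. iso z i x j \<longrightarrow> val x j \<le> val (ch i (a i)) (a i)))"

lemma val_antimono: "j \<le> j' \<Longrightarrow> val x j' \<le> val x j"
proof -
  assume "j \<le> j'"
  then have "(R j')\<^sup>2 \<le> (R j)\<^sup>2" using R_antimono R_pos by (meson less_imp_le power_mono)
  then show ?thesis unfolding val_def
    by (intro sum_mono mult_left_mono) (auto intro: weight)
qed

text \<open>Successive squares have ratio 1/9, so the largest term dominates. The constant 2 is
  generous enough for the telescoping bound \<open>2 * ((R a)\<^sup>2 - (R b)\<^sup>2)\<close>,
  which carries the induction.\<close>

lemma geometric_levels:
  assumes "finite J" "0 \<le> D" "\<And>j. j \<in> J \<Longrightarrow> R j \<le> D"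
  shows "(\<Sum>j\<in>J. (R j)\<^sup>2) \<le> 2 * D\<^sup>2"
proof (cases "J = {}")
  case False
  define a where "a = Min J"
  have a: "a \<in> J" "\<And>j. j \<in> J \<Longrightarrow> a \<le> j" using assms(1) False by (auto simp: a_def)
  have tele: "(\<Sum>j\<in>{a..<b}. (R j)\<^sup>2) \<le> 2 * ((R a)\<^sup>2 - (R b)\<^sup>2)" if "a \<le> b" for b
    using that
  proof (induction rule: dec_induct)
    case (step b)
    have "(R (Suc b))\<^sup>2 = (R b)\<^sup>2 / 9" "0 \<le> (R b)\<^sup>2" by (simp_all add: R_Suc power_divide)
    moreover have "(\<Sum>j\<in>{a..<Suc b}. (R j)\<^sup>2) = (\<Sum>j\<in>{a..<b}. (R j)\<^sup>2) + (R b)\<^sup>2"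
      using step by simp
    moreover have "u + r \<le> 2 * (t - r / 9)" if "u \<le> 2 * (t - r)" "0 \<le> r" for u r t :: real
      using that by simp
    ultimately show ?case using step by metis
  qed simp
  have "(\<Sum>j\<in>J. (R j)\<^sup>2) \<le> (\<Sum>j\<in>{a..<Suc (Max J)}. (R j)\<^sup>2)"
    using a assms(1) by (intro sum_mono2) (auto simp: less_Suc_eq_le)
  also have "\<dots> \<le> 2 * ((R a)\<^sup>2 - (R (Suc (Max J)))\<^sup>2)"
    using a assms(1) by (intro tele) (auto simp: le_SucI)
  also have "\<dots> \<le> 2 * (R a)\<^sup>2" by simp
  also have "\<dots> \<le> 2 * D\<^sup>2" using assms(3)[OF a(1)] R_pos[of a] by (simp add: power_mono)
  finally show ?thesis .
qed simp

end

section \<open>Cost of a greedy run against an arbitrary set of at most \<open>k\<close>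
  centres\<close>

locale greedy_centers = ball_greedy +
  fixes k :: nat and z a ch and X :: "nat set"
  assumes run: "greedy_run z k a ch" and k: "1 \<le> k"
    and X: "X \<subseteq> {..<N}" "X \<noteq> {}" "card X \<le> k"
begin

abbreviation Z where "Z \<equiv> z ` {..<k}"

lemma finX: "finite X" using X finite_subset by blast

lemma run_a: "i < k \<Longrightarrow> a i \<le> L" and run_ch: "i < k \<Longrightarrow> a i \<le> l \<Longrightarrow> l \<le> L \<Longrightarrow> ch i l < N"
  and run_z: "i < k \<Longrightarrow> z i = ch i L"
  and run_step: "i < k \<Longrightarrow> a i \<le> l \<Longrightarrow> l < L \<Longrightarrow> \<delta> (ch i l) (ch i (Suc l)) \<le> 6 * R l"
  and run_child: "i < k \<Longrightarrow> a i \<le> l \<Longrightarrow> l < L \<Longrightarrow> y < N \<Longrightarrow> \<delta> (ch i l) y \<le> 6 * R l \<Longrightarrow>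
     val y (Suc l) \<le> val (ch i (Suc l)) (Suc l)"
  and run_iso: "i < k \<Longrightarrow> iso z i (ch i (a i)) (a i)"
  and run_max: "i < k \<Longrightarrow> x < N \<Longrightarrow> j \<le> L \<Longrightarrow> iso z i x j \<Longrightarrow> val x j \<le> val (ch i (a i)) (a i)"
  using run unfolding greedy_run_def by blast+

lemma run_zN: "i < k \<Longrightarrow> z i < N"
  using run_ch[of i L] run_z run_a by simp

text \<open>One step moves by at most \<open>6 * R l\<close>, which equals
  \<open>9 * (R l - R (Suc l))\<close>; in this form the bound telescopes.\<close>

lemma drift:
  assumes "i < k" "a i \<le> l" "l \<le> l'" "l' \<le> L"
  shows "\<delta> (ch i l) (ch i l') \<le> 9 * (R l - R l')"
  using assms(3,4)
proof (induction rule: dec_induct)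
  case base
  then show ?case using assms run_ch[of i l] by simp
next
  case (step m)
  have "\<delta> (ch i l) (ch i (Suc m)) \<le> \<delta> (ch i l) (ch i m) + \<delta> (ch i m) (ch i (Suc m))"
    using assms step by (intro triangle) (auto intro!: run_ch)
  then show ?case using step run_step[of i m] assms by (simp add: R_Suc)
qed

lemma drift9:
  assumes "i < k" "a i \<le> l" "l \<le> l'" "l' \<le> L"
  shows "\<delta> (ch i l) (ch i l') \<le> 9 * R l"
  using drift[OF assms] R_pos[of l'] by simp

text \<open>Levels count downwards in radius: this is the largest ball around \<open>x\<close> that
  is still isolated from all \<open>k\<close> chosen centres.\<close>

definition level :: "nat \<Rightarrow> nat" where
  "level x = (LEAST j. iso z k x j)"

lemma level:
  assumes "x < N" "x \<notin> Z"
  shows "iso z k x (level x)" "level x \<le> L" "iso z k x j \<Longrightarrow> level x \<le> j"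
proof -
  have L: "iso z k x L" unfolding iso_def
    using assms run_zN R_last by (metis imageI lessThan_iff)
  then show "iso z k x (level x)" unfolding level_def by (rule LeastI)
  from L show "level x \<le> L" unfolding level_def by (rule Least_le)
  show "iso z k x j \<Longrightarrow> level x \<le> j" unfolding level_def by (rule Least_le)
qed

text \<open>One level higher the ball fails to be isolated, so a centre lies within
  \<open>44 * R j\<close>, where \<open>R j\<close> is three times the radius at the level of
  \<open>x\<close>.\<close>

lemma level_close:
  assumes "x < N" "x \<notin> Z"
  obtains i where "i < k" "\<delta> x (z i) \<le> 132 * R (level x)"
proof (cases "level x")
  case 0
  then show ?thesis using that[of 0] k R_first assms run_zN by simp
next
  case (Suc j)
  then have "\<not> iso z k x j" using level(3)[OF assms, of j] by auto
  then obtain i where "i < k" "\<delta> x (z i) < 44 * R j" by (auto simp: iso_def not_le)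
  then show ?thesis using that[of i] Suc by (simp add: R_Suc)
qed

definition X' where "X' = X - Z"

definition v where "v x = val x (level x)"

lemma X'N: "x \<in> X' \<Longrightarrow> x < N" "x \<in> X' \<Longrightarrow> x \<notin> Z" "x \<in> X' \<Longrightarrow> x \<in> X"
  using X by (auto simp: X'_def)

text \<open>A ball isolated from all \<open>k\<close> centres was isolated from every initial part
  of them, so it competed when run \<open>i\<close> chose its start.\<close>

lemma v_le_start: assumes "i < k" "x \<in> X'" shows "v x \<le> val (ch i (a i)) (a i)"
proof -
  have "iso z i x (level x)" using level(1)[of x] X'N assms by (auto simp: iso_def)
  then show ?thesis unfolding v_def using assms level(2) X'N run_max by auto
qed

definition near where "near i l p \<longleftrightarrow> p \<in> X \<and> a i \<le> l \<and> l \<le> L \<and> \<delta> (ch i l) p < 2 * R l"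

text \<open>A far ball is paid for by the cost of \<open>X\<close>: a point closer than
  \<open>R l\<close> to its centre is farther than \<open>R l\<close> from every point of
  \<open>X\<close>.\<close>

definition far where "far i l \<longleftrightarrow> a i \<le> l \<and> l \<le> L \<and> (\<forall>p\<in>X. 2 * R l \<le> \<delta> (ch i l) p)"

lemma near_or_far: "a i \<le> l \<Longrightarrow> l \<le> L \<Longrightarrow> far i l \<or> (\<exists>p. near i l p)"
  unfolding near_def far_def by (meson not_le)

text \<open>Take the last level that is near some \<open>p\<close>; the level after it is far. The
  exception is a chain that is near at level \<open>L\<close>, and by \<open>near_last\<close> such
  a chain has ended in \<open>p\<close> itself.\<close>

lemma chain_type:
  assumes "i < k"
  shows "far i (a i) \<or> (\<exists>l p. near i l p \<and> (l < L \<longrightarrow> far i (Suc l)))"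
proof (cases "far i (a i)")
  case False
  then obtain p0 where p0: "near i (a i) p0" using near_or_far[of i "a i"] run_a assms by auto
  define l where "l = (GREATEST l. \<exists>p. near i l p)"
  have ex: "\<exists>p. near i l p" unfolding l_def
    by (rule GreatestI_nat[where b = L]) (use p0 in \<open>auto simp: near_def\<close>)
  have gr: "l' \<le> l" if "near i l' p" for l' p unfolding l_def
    by (rule Greatest_le_nat[where b = L]) (use that in \<open>auto simp: near_def\<close>)
  have "l < L \<longrightarrow> far i (Suc l)"
  proof
    assume "l < L"
    moreover have "a i \<le> l" using ex by (auto simp: near_def)
    ultimately show "far i (Suc l)" using near_or_far[of i "Suc l"] gr[of "Suc l"] by force
  qed
  with ex show ?thesis by blast
qed simp

lemma near_last:
  assumes "i < k" "near i L p" shows "p = z i"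
proof (rule ccontr)
  assume "p \<noteq> z i"
  then have "44 * R L \<le> \<delta> (z i) p" using R_last[of "z i" p] run_zN assms X by (auto simp: near_def)
  then show False using assms run_z R_pos[of L] by (auto simp: near_def)
qed

lemma near_center:
  assumes "i < k" "near i l p"
  shows "\<delta> p (z i) \<le> 11 * R l"
proof -
  have "p < N" using assms X by (auto simp: near_def)
  then have "\<delta> p (z i) \<le> \<delta> p (ch i l) + \<delta> (ch i l) (z i)"
    using assms by (intro triangle) (auto simp: near_def run_zN intro!: run_ch)
  also have "\<dots> \<le> 2 * R l + 9 * R l"
    using assms drift9[of i l L] run_z by (intro add_mono) (auto simp: near_def commute)
  finally show ?thesis by simp
qed

lemma near_start:
  assumes "i < k" "near i l p"
  shows "\<delta> (ch i (a i)) p \<le> 11 * R (a i)"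
proof -
  have "p < N" using assms X by (auto simp: near_def)
  then have "\<delta> (ch i (a i)) p \<le> \<delta> (ch i (a i)) (ch i l) + \<delta> (ch i l) p"
    using assms run_a by (intro triangle) (auto simp: near_def intro!: run_ch)
  also have "\<dots> \<le> 9 * R (a i) + 2 * R l"
    using assms drift9[of i "a i" l] by (intro add_mono) (auto simp: near_def)
  also have "\<dots> \<le> 11 * R (a i)" using R_antimono[of "a i" l] assms by (simp add: near_def)
  finally show ?thesis .
qed

text \<open>If two runs pass near the same point, the start of the later one was a candidate child of the
  earlier one, so the earlier run may be charged to an arbitrary point of \<open>X\<close>.\<close>

lemma near_twice:
  assumes "i < i'" "i' < k" "near i l p" "near i' l' p"
  shows "l < L \<and> val (ch i' (a i')) (a i') \<le> val (ch i (Suc l)) (Suc l)"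
proof -
  have ik: "i < k" using assms by simp
  have N: "p < N" "ch i' (a i') < N" "ch i l < N" "z i < N"
    using assms X run_a run_zN by (auto simp: near_def intro!: run_ch)
  have s': "\<delta> (ch i' (a i')) p \<le> 11 * R (a i')" by (rule near_start) fact+
  have zi: "\<delta> p (z i) \<le> 11 * R l" by (rule near_center[OF ik]) fact
  have "44 * R (a i') \<le> \<delta> (ch i' (a i')) (z i)" using run_iso[of i'] assms by (auto simp: iso_def)
  also have "\<dots> \<le> \<delta> (ch i' (a i')) p + \<delta> p (z i)" using N by (intro triangle) auto
  \<comment> \<open>Isolation leaves \<open>44 - 11 = 33 = 3 * 11\<close>, exactly one factor 3, so
    the later start lies at least one level deeper.\<close>
  finally have "R (a i') \<le> R (Suc l)" using s' zi by (simp add: R_Suc)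
  then have la: "Suc l \<le> a i'" by (simp add: R_le_iff)
  then have lL: "l < L" using run_a[of i'] assms by simp
  have "\<delta> (ch i l) (ch i' (a i')) \<le> \<delta> (ch i l) p + \<delta> p (ch i' (a i'))" using N by (intro triangle) auto
  also have "\<dots> \<le> 2 * R l + 11 * R (a i')" using assms s' by (intro add_mono) (auto simp: near_def commute)
  also have "\<dots> \<le> 6 * R l" using \<open>R (a i') \<le> R (Suc l)\<close> R_pos[of l] by (simp add: R_Suc)
  finally have "val (ch i' (a i')) (Suc l) \<le> val (ch i (Suc l)) (Suc l)"
    using run_child[OF ik _ lL] assms N by (auto simp: near_def)
  moreover have "val (ch i' (a i')) (a i') \<le> val (ch i' (a i')) (Suc l)" using la by (rule val_antimono)
  ultimately show ?thesis using lL by simp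
qed

text \<open>\<open>p\<close> is within \<open>11 * R l\<close> of \<open>z i\<close>, hence not
  isolated at level \<open>l\<close>, and its own ball lies strictly deeper. Since \<open>p\<close>
  was also a possible child of the chain at \<open>l\<close>, the child actually taken is worth at
  least \<open>v p\<close>.\<close>

lemma near_pays:
  assumes "i < k" "near i l p" "p \<in> X'"
  shows "l < L \<and> v p \<le> val (ch i (Suc l)) (Suc l)"
proof -
  have lL: "l < L"
  proof (rule ccontr)
    assume "\<not> l < L"
    then have "p = z i" using assms near_last[of i p] by (auto simp: near_def)
    then show False using assms X'N by auto
  qed
  have "Suc l \<le> level p"
  proof (rule ccontr)
    assume "\<not> Suc l \<le> level p"
    then have "iso z k p l" using level(1)[of p] X'N[OF assms(3)] iso_upward[of z k p "level p" l] by simp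
    then have "44 * R l \<le> \<delta> p (z i)" using assms by (auto simp: iso_def)
    then show False using near_center[OF assms(1,2)] R_pos[of l] by simp
  qed
  then have "v p \<le> val p (Suc l)" unfolding v_def by (rule val_antimono)
  also have "\<dots> \<le> val (ch i (Suc l)) (Suc l)"
    using assms lL R_pos[of l] X'N by (intro run_child) (auto simp: near_def)
  finally show ?thesis using lL by simp
qed

text \<open>Each run pays for at most one point of \<open>X'\<close>. The last run near a point
  \<open>q\<close> pays for \<open>q\<close>; every other run may pay for any point, because its far
  ball is worth as much as some start (\<open>near_twice\<close>) or is itself a start
  (\<open>v_le_start\<close>). Reserving one run per point of \<open>H\<close> leaves at least as
  many free runs as there are points outside \<open>H\<close>.\<close>

lemma charge:
  obtains \<tau> b where "inj_on \<tau> X'" "\<And>x. x \<in> X' \<Longrightarrow> \<tau> x < k \<and> far (\<tau> x) (b (\<tau> x))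
      \<and> v x \<le> val (ch (\<tau> x) (b (\<tau> x))) (b (\<tau> x))"
proof -
  define nr where "nr i l p \<longleftrightarrow> near i l p \<and> (l < L \<longrightarrow> far i (Suc l))" for i l p
  define Nr where "Nr = {i. i < k \<and> (\<exists>l p. nr i l p)}"
  have "\<forall>i\<in>Nr. \<exists>lp. nr i (fst lp) (snd lp)" unfolding Nr_def by auto
  then obtain lp where lp: "\<And>i. i \<in> Nr \<Longrightarrow> nr i (fst (lp i)) (snd (lp i))" by metis
  define l where "l i = fst (lp i)" for i
  define p where "p i = snd (lp i)" for i
  have nr: "nr i (l i) (p i)" if "i \<in> Nr" for i using lp that by (simp add: l_def p_def)
  have finNr: "finite Nr" by (simp add: Nr_def)
  define H where "H = p ` Nr"
  have HX: "H \<subseteq> X" using nr by (auto simp: H_def nr_def near_def)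
  define \<sigma> where "\<sigma> q = Max {i\<in>Nr. p i = q}" for q
  have \<sigma>: "\<sigma> q \<in> Nr \<and> p (\<sigma> q) = q" if "q \<in> H" for q
  proof -
    have "\<sigma> q \<in> {i\<in>Nr. p i = q}" unfolding \<sigma>_def using that finNr by (intro Max_in) (auto simp: H_def)
    then show ?thesis by simp
  qed
  have \<sigma>max: "i \<le> \<sigma> (p i)" if "i \<in> Nr" for i unfolding \<sigma>_def using that finNr by (intro Max_ge) auto
  \<comment> \<open>The level just below the last near one, or the start if there is none. For a
    chain near at level \<open>L\<close> this gives the invalid level \<open>Suc L\<close>, but such
    a chain is reserved for its own centre, which is not in \<open>X'\<close>, and never
    pays.\<close>
  define b where "b i = (if i \<in> Nr then Suc (l i) else a i)" for i
  define Fr where "Fr = {..<k} - \<sigma> ` H"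
  have free: "far i (b i) \<and> v x \<le> val (ch i (b i)) (b i)" if "i \<in> Fr" "x \<in> X'" for i x
  proof (cases "i \<in> Nr")
    case True
    have i': "i < \<sigma> (p i)" using \<sigma>max[OF True] that True by (force simp: Fr_def H_def)
    have "p i \<in> H" using True by (auto simp: H_def)
    note s = \<sigma>[OF this]
    have ik: "\<sigma> (p i) < k" using s by (simp add: Nr_def)
    have n1: "near i (l i) (p i)" using nr[OF True] by (simp add: nr_def)
    have n2: "near (\<sigma> (p i)) (l (\<sigma> (p i))) (p i)" using nr[of "\<sigma> (p i)"] s by (simp add: nr_def)
    from near_twice[OF i' ik n1 n2] v_le_start[OF ik that(2)] nr[OF True] True
    show ?thesis by (auto simp: b_def nr_def)
  next
    case False
    then have "far i (a i)" using chain_type[of i] that by (auto simp: Nr_def Fr_def nr_def)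
    then show ?thesis using v_le_start[of i x] that False by (simp add: b_def Fr_def)
  qed
  have hit: "far (\<sigma> x) (b (\<sigma> x)) \<and> v x \<le> val (ch (\<sigma> x) (b (\<sigma> x))) (b (\<sigma> x))" if "x \<in> H" "x \<in> X'" for x
  proof -
    have s: "\<sigma> x \<in> Nr" "p (\<sigma> x) = x" using \<sigma>[OF that(1)] by auto
    have ik: "\<sigma> x < k" using s by (simp add: Nr_def)
    have n: "near (\<sigma> x) (l (\<sigma> x)) x" using nr[OF s(1)] s by (simp add: nr_def)
    from near_pays[OF ik n that(2)] nr[OF s(1)] s show ?thesis by (auto simp: b_def nr_def)
  qed
  have injs: "inj_on \<sigma> H" using \<sigma> by (metis inj_onI)
  have sk: "\<sigma> ` H \<subseteq> {..<k}" using \<sigma> by (auto simp: Nr_def)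
  have finH: "finite H" using finNr by (simp add: H_def)
  have "card (X' - H) \<le> card (X - H)" using finX by (intro card_mono) (auto simp: X'_def)
  also have "\<dots> = card X - card H" using finH HX by (rule card_Diff_subset)
  also have "\<dots> \<le> k - card H" using X by simp
  also have "\<dots> = card Fr" unfolding Fr_def using sk finH
    by (subst card_Diff_subset) (auto simp: card_image[OF injs])
  finally have "card (X' - H) \<le> card Fr" .
  moreover have "finite (X' - H)" "finite Fr" using finX by (auto simp: X'_def Fr_def)
  ultimately obtain f where f: "f ` (X' - H) \<subseteq> Fr" "inj_on f (X' - H)"
    using card_le_inj by blast
  show ?thesis
  proof (rule that[of "\<lambda>x. if x \<in> H then \<sigma> x else f x" b])
    show "inj_on (\<lambda>x. if x \<in> H then \<sigma> x else f x) X'"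
    proof (rule inj_onI)
      fix x y assume xy: "x \<in> X'" "y \<in> X'" "(if x \<in> H then \<sigma> x else f x) = (if y \<in> H then \<sigma> y else f y)"
      have "f u \<in> Fr" if "u \<in> X'" "u \<notin> H" for u using that f by auto
      moreover have "\<sigma> u \<notin> Fr" if "u \<in> H" for u using that by (auto simp: Fr_def)
      ultimately show "x = y" using xy f(2) injs by (metis DiffI inj_onD)
    qed
  next
    fix x assume x: "x \<in> X'"
    show "(if x \<in> H then \<sigma> x else f x) < k \<and> far (if x \<in> H then \<sigma> x else f x) (b (if x \<in> H then \<sigma> x else f x))
      \<and> v x \<le> val (ch (if x \<in> H then \<sigma> x else f x) (b (if x \<in> H then \<sigma> x else f x))) (b (if x \<in> H then \<sigma> x else f x))"
    proof (cases "x \<in> H")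
      case True
      then show ?thesis using hit[OF True x] sk by auto
    next
      case False
      then have "f x \<in> Fr" using f x by auto
      then show ?thesis using free[of "f x" x] x False by (auto simp: Fr_def)
    qed
  qed
qed

text \<open>A common point \<open>y\<close> would tie the start of run \<open>i'\<close> to
  \<open>z i\<close> within \<open>9 * R (a i') + R l' + 10 * R l\<close>, while isolation demands
  \<open>44 * R (a i')\<close>; so the later run starts below level \<open>l\<close>. Hence the far
  balls around one point have different radii and their squares form a geometric sum.\<close>

lemma far_levels_distinct:
  assumes "i < i'" "i' < k" "far i l" "far i' l'" "y < N" "\<delta> (ch i l) y < R l" "\<delta> (ch i' l') y < R l'"
  shows "l < l'"
proof -
  have ik: "i < k" using assms by simp
  have al: "a i \<le> l" "l \<le> L" "a i' \<le> l'" "l' \<le> L" using assms by (auto simp: far_def)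
  have N: "ch i l < N" "ch i' l' < N" "ch i' (a i') < N" "z i < N"
    using assms al run_a[of i'] run_zN by (auto intro!: run_ch)
  have "44 * R (a i') \<le> \<delta> (ch i' (a i')) (z i)" using run_iso[of i'] assms by (auto simp: iso_def)
  also have "\<dots> \<le> \<delta> (ch i' (a i')) (ch i' l') + \<delta> (ch i' l') (z i)" using N by (intro triangle) auto
  also have "\<delta> (ch i' l') (z i) \<le> \<delta> (ch i' l') y + \<delta> y (z i)" using N assms by (intro triangle) auto
  also have "\<delta> y (z i) \<le> \<delta> y (ch i l) + \<delta> (ch i l) (z i)" using N assms by (intro triangle) auto
  also have "\<delta> y (ch i l) = \<delta> (ch i l) y" by (rule commute)
  finally have "44 * R (a i') < 9 * R (a i') + (R l' + (R l + 9 * R l))"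
    using drift9[of i' "a i'" l'] drift9[of i l L] assms al ik run_z[of i] by fastforce
  moreover have "R l' \<le> R (a i')" using al by (intro R_antimono)
  ultimately have "R (a i') < R l" using R_pos[of "a i'"] by simp
  then have "\<not> R l \<le> R (a i')" by simp
  then have "\<not> a i' \<le> l" by (simp add: R_le_iff)
  then show ?thesis using al by simp
qed

definition D where "D y = dist_to_set \<delta> y X"

lemma D_nonneg: "0 \<le> D y"
  unfolding D_def by (rule dist_to_set_ge[OF finX X(2)]) simp

text \<open>After charging, exchange the two sums: the paying balls that contain a fixed
  \<open>y\<close> have distinct levels and radii at most \<open>D y\<close>, so
  \<open>geometric_levels\<close> applies to each point separately.\<close>

lemma sum_v: "(\<Sum>x\<in>X'. v x) \<le> 2 * (\<Sum>y<N. \<mu> y * (D y)\<^sup>2)"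
proof -
  obtain \<tau> b where inj: "inj_on \<tau> X'" and \<tau>: "\<And>x. x \<in> X' \<Longrightarrow> \<tau> x < k \<and> far (\<tau> x) (b (\<tau> x))
      \<and> v x \<le> val (ch (\<tau> x) (b (\<tau> x))) (b (\<tau> x))" by (rule charge) blast
  define I where "I = \<tau> ` X'"
  have finI: "finite I" using finX by (simp add: I_def X'_def)
  have I: "i < k" "far i (b i)" if "i \<in> I" for i using that \<tau> by (auto simp: I_def)
  have pt: "(\<Sum>i\<in>I. max 0 ((R (b i))\<^sup>2 - (\<delta> (ch i (b i)) y)\<^sup>2)) \<le> 2 * (D y)\<^sup>2" if y: "y < N" for y
  proof -
    define Iy where "Iy = {i\<in>I. \<delta> (ch i (b i)) y < R (b i)}"
    have "(\<Sum>i\<in>I. max 0 ((R (b i))\<^sup>2 - (\<delta> (ch i (b i)) y)\<^sup>2)) = (\<Sum>i\<in>Iy. max 0 ((R (b i))\<^sup>2 - (\<delta> (ch i (b i)) y)\<^sup>2))"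
    proof (rule sum.mono_neutral_right[OF finI])
      show "\<forall>i\<in>I - Iy. max 0 ((R (b i))\<^sup>2 - (\<delta> (ch i (b i)) y)\<^sup>2) = 0"
      proof
        fix i assume "i \<in> I - Iy"
        then have "R (b i) \<le> \<delta> (ch i (b i)) y" by (auto simp: Iy_def)
        then have "(R (b i))\<^sup>2 \<le> (\<delta> (ch i (b i)) y)\<^sup>2" using R_pos[of "b i"] by (intro power_mono) auto
        then show "max 0 ((R (b i))\<^sup>2 - (\<delta> (ch i (b i)) y)\<^sup>2) = 0" by simp
      qed
    qed (auto simp: Iy_def)
    also have "\<dots> \<le> (\<Sum>i\<in>Iy. (R (b i))\<^sup>2)" by (intro sum_mono) auto
    also have "\<dots> = (\<Sum>j\<in>b ` Iy. (R j)\<^sup>2)"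
    proof (rule sum.reindex[symmetric, unfolded comp_def])
      show "inj_on b Iy"
      proof (rule inj_onI)
        fix i i' assume *: "i \<in> Iy" "i' \<in> Iy" "b i = b i'"
        then have ii: "i \<in> I" "i' \<in> I" "\<delta> (ch i (b i)) y < R (b i)" "\<delta> (ch i' (b i')) y < R (b i')"
          by (auto simp: Iy_def)
        have "\<not> i < i'" using far_levels_distinct[of i i' "b i" "b i'" y] ii I[of i] I[of i'] y *(3) by auto
        moreover have "\<not> i' < i" using far_levels_distinct[of i' i "b i'" "b i" y] ii I[of i] I[of i'] y *(3) by auto
        ultimately show "i = i'" by simp
      qed
    qed
    also have "\<dots> \<le> 2 * (D y)\<^sup>2"
    proof (rule geometric_levels)
      show "finite (b ` Iy)" using finI by (simp add: Iy_def)
      show "0 \<le> D y" by (rule D_nonneg)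
      fix j assume "j \<in> b ` Iy"
      then obtain i where i: "i \<in> I" "\<delta> (ch i j) y < R j" "j = b i" by (auto simp: Iy_def)
      show "R j \<le> D y" unfolding D_def
      proof (rule dist_to_set_ge[OF finX X(2)])
        fix p assume "p \<in> X"
        then have "2 * R j \<le> \<delta> (ch i j) p" using I[OF i(1)] i by (auto simp: far_def)
        also have "\<dots> \<le> \<delta> (ch i j) y + \<delta> y p"
          using \<open>p \<in> X\<close> X y I[OF i(1)] i by (intro triangle) (auto simp: far_def intro!: run_ch)
        finally show "R j \<le> \<delta> y p" using i by simp
      qed
    qed
    finally show ?thesis .
  qed
  have "(\<Sum>x\<in>X'. v x) \<le> (\<Sum>x\<in>X'. val (ch (\<tau> x) (b (\<tau> x))) (b (\<tau> x)))" using \<tau> by (intro sum_mono) auto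
  also have "\<dots> = (\<Sum>i\<in>I. val (ch i (b i)) (b i))" unfolding I_def using inj by (simp add: sum.reindex)
  also have "\<dots> = (\<Sum>y<N. \<mu> y * (\<Sum>i\<in>I. max 0 ((R (b i))\<^sup>2 - (\<delta> (ch i (b i)) y)\<^sup>2)))"
    unfolding val_def by (subst sum.swap) (simp add: sum_distrib_left)
  also have "\<dots> \<le> (\<Sum>y<N. \<mu> y * (2 * (D y)\<^sup>2))"
    by (intro sum_mono mult_left_mono pt) (auto intro: weight)
  finally show ?thesis by (simp add: sum_distrib_left mult_ac)
qed

text \<open>A point whose centre \<open>c\<close> in \<open>X\<close> was not chosen is sent to the
  greedy centre near \<open>c\<close>, at distance at most \<open>D y\<close> plus 132 times the
  radius of the ball of \<open>c\<close>. With \<open>K = 2 * 132\<^sup>2\<close> this costs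
  \<open>2 + K\<close> times the old cost plus \<open>K\<close> times an excess that
  \<open>sum_v\<close> bounds by twice the cost; \<open>2 + 3 * K\<close> is 104546.\<close>

theorem greedy_centers_cost:
  "(\<Sum>y<N. \<mu> y * (dist_to_set \<delta> y Z)\<^sup>2) \<le> 110000 * (\<Sum>y<N. \<mu> y * (dist_to_set \<delta> y X)\<^sup>2)"
proof -
  have "\<exists>x. x \<in> X \<and> D y = \<delta> y x" for y
    using dist_to_set_attained[OF finX X(2), of \<delta> y] unfolding D_def by metis
  then obtain c where c: "\<And>y. c y \<in> X" "\<And>y. D y = \<delta> y (c y)" by metis
  define K :: real where "K = 2 * 132\<^sup>2"
  have finZ: "finite Z" "Z \<noteq> {}" using k by (auto simp: lessThan_empty_iff)
  \<comment> \<open>Up to the weight, \<open>e y\<close> is the summand of \<open>y\<close> in the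
    value of the ball of its centre, and the squared radius is at most the square of
    \<open>D y\<close> plus \<open>e y\<close>.\<close>
  define e where "e y = (if c y \<in> X' then max 0 ((R (level (c y)))\<^sup>2 - (\<delta> (c y) y)\<^sup>2) else 0)" for y
  have pt: "(dist_to_set \<delta> y Z)\<^sup>2 \<le> (2 + K) * (D y)\<^sup>2 + K * e y" if y: "y < N" for y
  proof (cases "c y \<in> X'")
    case True
    have cN: "c y < N" using X'N True by auto
    obtain i where i: "i < k" "\<delta> (c y) (z i) \<le> 132 * R (level (c y))"
      using level_close[of "c y"] X'N[OF True] by blast
    let ?R = "R (level (c y))"
    have "dist_to_set \<delta> y Z \<le> \<delta> y (z i)" using finZ i by (intro dist_to_set_le) auto
    also have "\<dots> \<le> \<delta> y (c y) + \<delta> (c y) (z i)" using y cN i run_zN by (intro triangle) auto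
    also have "\<dots> \<le> D y + 132 * ?R" using i c by simp
    finally have le: "dist_to_set \<delta> y Z \<le> D y + 132 * ?R" .
    have "0 \<le> dist_to_set \<delta> y Z" by (rule dist_to_set_ge[OF finZ]) simp
    with le have "(dist_to_set \<delta> y Z)\<^sup>2 \<le> (D y + 132 * ?R)\<^sup>2" by (rule power_mono)
    also have "\<dots> \<le> 2 * (D y)\<^sup>2 + K * ?R\<^sup>2"
      using sum_squares_bound[of "D y" "132 * ?R"] by (simp add: K_def power2_sum power_mult_distrib)
    also have "\<dots> \<le> 2 * (D y)\<^sup>2 + K * ((D y)\<^sup>2 + e y)"
      using True c(2)[of y] commute[of y "c y"] by (intro add_left_mono mult_left_mono) (auto simp: e_def K_def)
    finally show ?thesis by (simp add: algebra_simps)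
  next
    case False
    then have "c y \<in> Z" using c(1)[of y] by (auto simp: X'_def)
    then have "dist_to_set \<delta> y Z \<le> D y" using dist_to_set_le[OF finZ(1), of "c y" \<delta> y] c by simp
    moreover have "0 \<le> dist_to_set \<delta> y Z" by (rule dist_to_set_ge[OF finZ]) simp
    ultimately have "(dist_to_set \<delta> y Z)\<^sup>2 \<le> (D y)\<^sup>2" by (simp add: power_mono)
    also have "\<dots> \<le> (2 + K) * (D y)\<^sup>2"
      using mult_right_mono[of 1 "2 + K" "(D y)\<^sup>2"] by (simp add: K_def)
    finally show ?thesis using False by (simp add: e_def)
  qed
  have "(\<Sum>y<N. \<mu> y * e y) \<le> (\<Sum>y<N. \<Sum>x\<in>X'. \<mu> y * max 0 ((R (level x))\<^sup>2 - (\<delta> x y)\<^sup>2))"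
  proof (rule sum_mono)
    fix y assume "y \<in> {..<N}"
    then have w: "0 \<le> \<mu> y" by (simp add: weight)
    show "\<mu> y * e y \<le> (\<Sum>x\<in>X'. \<mu> y * max 0 ((R (level x))\<^sup>2 - (\<delta> x y)\<^sup>2))"
    proof (cases "c y \<in> X'")
      case True
      then show ?thesis using w finX
          member_le_sum[of "c y" X' "\<lambda>x. \<mu> y * max 0 ((R (level x))\<^sup>2 - (\<delta> x y)\<^sup>2)"]
        by (simp add: e_def X'_def)
    next
      case False
      then show ?thesis using w by (auto simp: e_def intro!: sum_nonneg)
    qed
  qed
  also have "\<dots> = (\<Sum>x\<in>X'. v x)" unfolding v_def val_def by (rule sum.swap)
  also have "\<dots> \<le> 2 * (\<Sum>y<N. \<mu> y * (D y)\<^sup>2)" by (rule sum_v)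
  finally have e: "(\<Sum>y<N. \<mu> y * e y) \<le> 2 * (\<Sum>y<N. \<mu> y * (D y)\<^sup>2)" .
  have "(\<Sum>y<N. \<mu> y * (dist_to_set \<delta> y Z)\<^sup>2) \<le> (\<Sum>y<N. \<mu> y * ((2 + K) * (D y)\<^sup>2 + K * e y))"
    by (intro sum_mono mult_left_mono pt) (auto intro: weight)
  also have "\<dots> = (2 + K) * (\<Sum>y<N. \<mu> y * (D y)\<^sup>2) + K * (\<Sum>y<N. \<mu> y * e y)"
    by (simp add: sum.distrib sum_distrib_left algebra_simps)
  also have "\<dots> \<le> (2 + K) * (\<Sum>y<N. \<mu> y * (D y)\<^sup>2) + K * (2 * (\<Sum>y<N. \<mu> y * (D y)\<^sup>2))"
    using e by (intro add_left_mono mult_left_mono) (auto simp: K_def)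
  also have "\<dots> = (2 + 3 * K) * (\<Sum>y<N. \<mu> y * (D y)\<^sup>2)" by (simp add: algebra_simps)
  also have "\<dots> \<le> 110000 * (\<Sum>y<N. \<mu> y * (D y)\<^sup>2)"
    by (intro mult_right_mono sum_nonneg mult_nonneg_nonneg) (auto simp: K_def weight)
  finally show ?thesis by (simp add: D_def)
qed

end

section \<open>Reducing a candidate set inside a block\<close>

definition saving :: "(nat \<Rightarrow> real) \<Rightarrow> (nat \<Rightarrow> nat \<Rightarrow> real) \<Rightarrow> real \<Rightarrow> nat \<Rightarrow> nat \<Rightarrow> real \<Rightarrow> real" where
  "saving w d q x c v = (if q * d x c < v then w x * (v\<^sup>2 - (d x c)\<^sup>2) else 0)"

definition relax :: "(nat \<Rightarrow> nat \<Rightarrow> real) \<Rightarrow> real \<Rightarrow> nat \<Rightarrow> (nat \<Rightarrow> real) \<Rightarrow> nat \<Rightarrow> real" where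
  "relax d q c D x = (if q * d x c < D x then d x c else D x)"

text \<open>An exact identity, because \<open>saving\<close> and \<open>relax\<close> apply the same
  threshold. Laziness costs nothing here, only in the comparison with a competitor.\<close>

lemma relax_cost:
  "(\<Sum>x\<in>T. w x * (relax d q c D x)\<^sup>2) = (\<Sum>x\<in>T. w x * (D x)\<^sup>2) - (\<Sum>x\<in>T. saving w d q x c (D x))"
  unfolding sum_subtractf[symmetric]
  by (rule sum.cong) (auto simp: relax_def saving_def algebra_simps)

section \<open>Forward greedy with lazily recorded distances\<close>

locale greedy_cover =
  fixes T :: "nat set" and w :: "nat \<Rightarrow> real" and d :: "nat \<Rightarrow> nat \<Rightarrow> real" and q :: real
  assumes finT: "finite T" and wT: "x \<in> T \<Longrightarrow> 0 \<le> w x" and d0: "0 \<le> d x y" and q1: "1 \<le> q"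
begin

lemma d_le_qd: "d x y \<le> q * d x y"
  using mult_right_mono[OF q1 d0] by simp

lemma saving_nonneg: "x \<in> T \<Longrightarrow> 0 \<le> saving w d q x c v"
  using wT d0[of x c] d_le_qd[of x c] by (auto simp: saving_def intro!: mult_nonneg_nonneg power_mono)

text \<open>For each point look only at its nearest \<open>p\<close>. If the threshold fails there,
  then \<open>D x <= q * d x p\<close> holds already, and this is the origin of
  \<open>q\<^sup>2\<close>.\<close>

lemma saving_sum_ge:
  assumes "finite P" "P \<noteq> {}" "\<And>x. x \<in> T \<Longrightarrow> 0 \<le> D x"
  shows "(\<Sum>x\<in>T. w x * (D x)\<^sup>2) - q\<^sup>2 * (\<Sum>x\<in>T. w x * (dist_to_set d x P)\<^sup>2)
    \<le> (\<Sum>p\<in>P. \<Sum>x\<in>T. saving w d q x p (D x))"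
proof -
  have "(\<Sum>x\<in>T. w x * (D x)\<^sup>2) - q\<^sup>2 * (\<Sum>x\<in>T. w x * (dist_to_set d x P)\<^sup>2)
     = (\<Sum>x\<in>T. w x * (D x)\<^sup>2 - w x * (q * dist_to_set d x P)\<^sup>2)"
    by (simp add: sum_subtractf sum_distrib_left power_mult_distrib mult_ac)
  also have "\<dots> \<le> (\<Sum>x\<in>T. \<Sum>p\<in>P. saving w d q x p (D x))"
  proof (rule sum_mono)
    fix x assume x: "x \<in> T"
    obtain p where p: "p \<in> P" "dist_to_set d x P = d x p" using dist_to_set_attained[OF assms(1,2)] by metis
    have "w x * (D x)\<^sup>2 - w x * (q * d x p)\<^sup>2 \<le> saving w d q x p (D x)"
    proof (cases "q * d x p < D x")
      case True
      have "(d x p)\<^sup>2 \<le> (q * d x p)\<^sup>2" using d_le_qd d0 by (intro power_mono) auto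
      then show ?thesis using True wT[OF x] by (simp add: saving_def right_diff_distrib mult_left_mono)
    next
      case False
      then have "(D x)\<^sup>2 \<le> (q * d x p)\<^sup>2" using assms(3)[OF x] by (intro power_mono) auto
      then show ?thesis using False wT[OF x] by (simp add: saving_def mult_left_mono)
    qed
    also have "\<dots> \<le> (\<Sum>p\<in>P. saving w d q x p (D x))"
      using p assms(1) x by (intro member_le_sum) (auto simp: saving_nonneg)
    finally show "w x * (D x)\<^sup>2 - w x * (q * dist_to_set d x P)\<^sup>2 \<le> (\<Sum>p\<in>P. saving w d q x p (D x))"
      using p by simp
  qed
  also have "\<dots> = (\<Sum>p\<in>P. \<Sum>x\<in>T. saving w d q x p (D x))" by (rule sum.swap)
  finally show ?thesis .
qed

text \<open>The at most \<open>k\<close> points of \<open>P\<close> together save the whole gap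
  above \<open>q\<^sup>2\<close> times their cost, so the best candidate saves at least a
  \<open>1 / k\<close> share of it.\<close>

lemma greedy_step:
  fixes k :: nat
  assumes P: "finite P" "P \<noteq> {}" "card P \<le> k" and D: "\<And>x. x \<in> T \<Longrightarrow> 0 \<le> D x"
    and best: "\<And>p. p \<in> P \<Longrightarrow> (\<Sum>x\<in>T. saving w d q x p (D x)) \<le> (\<Sum>x\<in>T. saving w d q x c (D x))"
    and IH: "(\<Sum>x\<in>T. w x * (D x)\<^sup>2) \<le> q\<^sup>2 * (\<Sum>x\<in>T. w x * (dist_to_set d x P)\<^sup>2) + r * F"
  shows "(\<Sum>x\<in>T. w x * (relax d q c D x)\<^sup>2)
    \<le> q\<^sup>2 * (\<Sum>x\<in>T. w x * (dist_to_set d x P)\<^sup>2) + (1 - 1 / real k) * r * F"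
proof -
  define g where "g = (\<Sum>x\<in>T. saving w d q x c (D x))"
  define f where "f = (\<Sum>x\<in>T. w x * (D x)\<^sup>2)"
  define p where "p = q\<^sup>2 * (\<Sum>x\<in>T. w x * (dist_to_set d x P)\<^sup>2)"
  have k: "1 \<le> k" using P by (metis One_nat_def Suc_leI card_gt_0_iff le_trans)
  have g0: "0 \<le> g" unfolding g_def by (intro sum_nonneg saving_nonneg)
  have "f - p \<le> (\<Sum>p\<in>P. \<Sum>x\<in>T. saving w d q x p (D x))"
    unfolding f_def p_def by (rule saving_sum_ge[OF P(1,2) D])
  also have "\<dots> \<le> (\<Sum>p\<in>P. g)" unfolding g_def by (rule sum_mono) (rule best)
  also have "\<dots> = real (card P) * g" by simp
  also have "\<dots> \<le> real k * g" using P g0 by (intro mult_right_mono) auto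
  finally have "f - p \<le> real k * g" .
  then have "(f - p) / real k \<le> g" using k by (simp add: field_simps)
  moreover have "f - (f - p) / real k = (1 - 1 / real k) * f + p / real k"
    using k by (simp add: field_simps)
  ultimately have "f - g \<le> (1 - 1 / real k) * f + p / real k" by linarith
  also have "\<dots> \<le> (1 - 1 / real k) * (p + r * F) + p / real k"
    using IH k unfolding f_def p_def by (intro add_right_mono mult_left_mono) auto
  also have "\<dots> = p + (1 - 1 / real k) * r * F" using k by (simp add: field_simps)
  finally show ?thesis unfolding relax_cost f_def[symmetric] g_def[symmetric] p_def[symmetric] .
qed

text \<open>\<open>H\<close> collects the points picked so far; the second alternative is an exhausted block.\<close>

definition heavy_picks :: "nat \<Rightarrow> (nat \<Rightarrow> real) \<Rightarrow> bool" where
  "heavy_picks i D \<longleftrightarrow> (\<exists>H \<subseteq> T. card H = i \<and> (\<forall>h\<in>H. D h = 0) \<and> (\<forall>h\<in>H. \<forall>x\<in>T. 0 < D x \<longrightarrow> w x \<le> w h))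
     \<or> (\<forall>x\<in>T. D x = 0)"

lemma heavy_picks_0: "heavy_picks 0 D"
  unfolding heavy_picks_def by (intro disjI1 exI[of _ "{}"]) simp

text \<open>A picked point drops to distance 0 and a point at 0 never rises again, so
  \<open>H\<close> gains a new element as long as a positive distance is left.\<close>

lemma heavy_picks_Suc:
  assumes "heavy_picks i D" "c \<in> T" "\<And>x. x \<in> T \<Longrightarrow> 0 \<le> D x" "d c c = 0"
    and best: "\<And>x. x \<in> T \<Longrightarrow> 0 < D x \<Longrightarrow> 0 < D c \<and> w x \<le> w c"
  shows "heavy_picks (Suc i) (relax d q c D)"
proof -
  have le: "relax d q c D x \<le> D x" for x
    using d_le_qd[of x c] by (simp add: relax_def)
  have ge: "0 \<le> relax d q c D x" if "x \<in> T" for x using assms(3)[OF that] d0 by (simp add: relax_def)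
  have zero: "relax d q c D x = 0" if "x \<in> T" "D x = 0" for x using le[of x] ge[of x] that by simp
  show ?thesis
  proof (cases "\<forall>x\<in>T. D x = 0")
    case True
    then show ?thesis using zero by (auto simp: heavy_picks_def)
  next
    case False
    then obtain x where "x \<in> T" "0 < D x" using assms(3) by force
    then have c: "0 < D c" using best by blast
    from assms(1) False obtain H where H: "H \<subseteq> T" "card H = i" "\<forall>h\<in>H. D h = 0"
      "\<forall>h\<in>H. \<forall>x\<in>T. 0 < D x \<longrightarrow> w x \<le> w h" unfolding heavy_picks_def by blast
    have "c \<notin> H" using H c by auto
    have fin: "finite H" using H finT finite_subset by blast
    have c0: "relax d q c D c = 0" using c assms(4) by (simp add: relax_def)
    have "0 < D x" if "0 < relax d q c D x" for x using le[of x] that by simp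
    then show ?thesis unfolding heavy_picks_def
      using H \<open>c \<notin> H\<close> fin c0 assms(2) zero best
      by (intro disjI1 exI[of _ "insert c H"]) auto
  qed
qed

text \<open>Exchange argument: \<open>H\<close> has at least as many elements as \<open>P\<close>,
  so the points of \<open>P\<close> with positive recorded distance inject into the picks outside
  \<open>P\<close>, each of which weighs at least as much.\<close>

lemma heavy_picks_weight:
  fixes k :: nat
  assumes hp: "heavy_picks k D" and P: "finite P" "card P \<le> k" and D: "\<And>x. x \<in> T \<Longrightarrow> 0 \<le> D x"
  shows "sum w {x\<in>T. 0 < D x} \<le> sum w (T - P)"
proof (cases "\<forall>x\<in>T. D x = 0")
  case True
  then have "{x\<in>T. 0 < D x} = {}" by auto
  then have "sum w {x\<in>T. 0 < D x} = 0" by (simp only: sum.empty)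
  then show ?thesis using wT by (auto intro!: sum_nonneg)
next
  case False
  with hp obtain H where H: "H \<subseteq> T" "card H = k" "\<forall>h\<in>H. D h = 0"
    "\<forall>h\<in>H. \<forall>x\<in>T. 0 < D x \<longrightarrow> w x \<le> w h" unfolding heavy_picks_def by blast
  define U where "U = {x\<in>T. 0 < D x}"
  have finU: "finite U" and finH: "finite H" using finT H finite_subset by (auto simp: U_def)
  have disj: "U \<inter> H = {}" using H by (auto simp: U_def)
  have "card (U \<inter> P) + card (H \<inter> P) = card ((U \<inter> P) \<union> (H \<inter> P))"
    using finU finH disj by (subst card_Un_disjoint) auto
  also have "\<dots> \<le> card P" using P by (intro card_mono) auto
  finally have "card (U \<inter> P) \<le> card H - card (H \<inter> P)" using H P by simp
  also have "\<dots> = card (H - P)" using finH by (metis card_Diff_subset_Int finite_Int)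
  finally obtain f where f: "f ` (U \<inter> P) \<subseteq> H - P" "inj_on f (U \<inter> P)"
    using card_le_inj[of "U \<inter> P" "H - P"] finU finH by auto
  have "sum w (U \<inter> P) \<le> (\<Sum>x\<in>U \<inter> P. w (f x))"
    using f H by (intro sum_mono) (auto simp: U_def)
  also have "\<dots> = sum w (f ` (U \<inter> P))" using f by (simp add: sum.reindex)
  also have "\<dots> \<le> sum w (H - P)" using f finH H wT by (intro sum_mono2) auto
  finally have "sum w U \<le> sum w (U - P) + sum w (H - P)"
    using sum.Int_Diff[OF finU, of w P] by simp
  also have "\<dots> = sum w ((U - P) \<union> (H - P))" using finU finH disj by (subst sum.union_disjoint) auto
  also have "\<dots> \<le> sum w (T - P)" using finT H wT by (intro sum_mono2) (auto simp: U_def)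
  finally show ?thesis by (simp add: U_def)
qed

text \<open>Every point with positive recorded distance is charged at most \<open>2 ^ m * l\<close>,
  every point outside \<open>P\<close> costs \<open>P\<close> at least \<open>l\<close>, and
  \<open>heavy_picks_weight\<close> compares the total weights of the two groups. No bound on ratios
  of weights enters.\<close>

lemma greedy_start:
  fixes k :: nat
  assumes hp: "heavy_picks k D" and P: "finite P" "P \<noteq> {}" "card P \<le> k" and D: "\<And>x. x \<in> T \<Longrightarrow> 0 \<le> D x"
    and top: "\<And>x. x \<in> T \<Longrightarrow> D x \<le> u" and u: "u \<le> 2 ^ m * l" and l: "0 \<le> l"
    and low: "\<And>x p. x \<in> T - P \<Longrightarrow> p \<in> P \<Longrightarrow> l \<le> d x p"
  shows "(\<Sum>x\<in>T. w x * (D x)\<^sup>2) \<le> 4 ^ m * (\<Sum>x\<in>T. w x * (dist_to_set d x P)\<^sup>2)"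
proof -
  define U where "U = {x\<in>T. 0 < D x}"
  have "(\<Sum>x\<in>T. w x * (D x)\<^sup>2) = (\<Sum>x\<in>U. w x * (D x)\<^sup>2)"
    using D by (intro sum.mono_neutral_right[OF finT]) (force simp: U_def)+
  also have "\<dots> \<le> (\<Sum>x\<in>U. w x * (2 ^ m * l)\<^sup>2)"
    using top u D wT by (intro sum_mono mult_left_mono power_mono) (force simp: U_def)+
  also have "\<dots> = 4 ^ m * l\<^sup>2 * sum w U"
  proof -
    have "((2::real) ^ m)\<^sup>2 = 4 ^ m" by (simp add: power2_eq_square power_mult_distrib[symmetric])
    then show ?thesis by (simp add: sum_distrib_right power_mult_distrib mult_ac)
  qed
  also have "\<dots> \<le> 4 ^ m * l\<^sup>2 * sum w (T - P)"
    using heavy_picks_weight[OF hp P(1,3) D] by (intro mult_left_mono) (auto simp: U_def)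
  also have "\<dots> = 4 ^ m * (\<Sum>x\<in>T - P. w x * l\<^sup>2)" by (simp add: sum_distrib_left sum_distrib_right mult_ac)
  also have "\<dots> \<le> 4 ^ m * (\<Sum>x\<in>T - P. w x * (dist_to_set d x P)\<^sup>2)"
    using l wT low P by (intro mult_left_mono sum_mono power_mono dist_to_set_ge) auto
  also have "\<dots> \<le> 4 ^ m * (\<Sum>x\<in>T. w x * (dist_to_set d x P)\<^sup>2)"
    using finT wT by (intro mult_left_mono sum_mono2) auto
  finally show ?thesis .
qed

text \<open>Every \<open>k\<close> rounds shrink the gap by a factor \<open>e\<close>:
  \<open>2 * m\<close> such batches cancel the start factor \<open>4 ^ m\<close>, and
  \<open>l\<close> more bring the remainder below \<open>1 / l\<close>. Then
  \<open>q\<^sup>2 + 1 / l <= 1 + 4 / l\<close>.\<close>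

lemma greedy_result:
  fixes k l :: nat
  assumes C: "0 \<le> C" "F \<le> 4 ^ m * C" and k: "1 \<le> k" and l: "1 \<le> l" "q = 1 + 1 / real l"
    and f: "f \<le> q\<^sup>2 * C + (1 - 1 / real k) ^ (k * (2 * m + l)) * F"
  shows "f \<le> exp (4 / real l) * C"
proof -
  have "(1 - 1 / real k) ^ k \<le> exp (-1)"
    using exp_ge_one_minus_x_over_n_power_n[of 1 k] k by simp
  then have "(1 - 1 / real k) ^ (k * (2 * m + l)) \<le> exp (-1) ^ (2 * m + l)"
    unfolding power_mult using k by (intro power_mono) auto
  also have "\<dots> = (exp (-1) ^ 2) ^ m * exp (- real l)"
    by (simp add: power_add power_mult exp_of_nat_mult[symmetric])
  also have "\<dots> \<le> (1 / 4) ^ m * (1 / real l)"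
  proof (intro mult_mono power_mono)
    have "2 \<le> exp (1::real)" using exp_ge_add_one_self[of 1] by simp
    then have "(2::real)\<^sup>2 \<le> (exp 1)\<^sup>2" by (intro power_mono) auto
    then show "(exp (-1::real))\<^sup>2 \<le> 1 / 4" by (simp add: exp_minus divide_simps)
    have "real l \<le> exp (real l)" using exp_ge_add_one_self[of "real l"] by linarith
    then show "exp (- real l) \<le> 1 / real l" using l by (simp add: exp_minus divide_simps)
  qed auto
  finally have "(1 - 1 / real k) ^ (k * (2 * m + l)) * F \<le> ((1 / 4) ^ m * (1 / real l)) * (4 ^ m * C)"
    using C k by (intro order_trans[OF mult_left_mono[OF C(2)] mult_right_mono]) auto
  also have "\<dots> = 1 / real l * C" by (simp add: power_divide)
  finally have "f \<le> (q\<^sup>2 + 1 / real l) * C" using f by (simp add: algebra_simps)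
  also have "q\<^sup>2 + 1 / real l \<le> exp (4 / real l)"
  proof -
    have "q\<^sup>2 + 1 / real l = 1 + 3 / real l + (1 / real l) * (1 / real l)"
      by (simp add: l power2_eq_square algebra_simps)
    also have "(1 / real l) * (1 / real l) \<le> (1 / real l) * 1"
      using l by (intro mult_left_mono) auto
    finally show ?thesis using exp_ge_add_one_self[of "4 / real l"] by linarith
  qed
  finally show ?thesis using C by (simp add: mult_right_mono)
qed

end

section \<open>The cost of one level of merging\<close>

locale kmeans_instance = Metric_space "{..<n}" d
  for n :: nat and d :: "nat \<Rightarrow> nat \<Rightarrow> real" +
  fixes w :: "nat \<Rightarrow> real" and k :: nat
  assumes w0: "x < n \<Longrightarrow> 0 \<le> w x" and k1: "1 \<le> k" and kn: "k \<le> n"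
begin

text \<open>The root of the weight is moved into the function, so that Minkowski's inequality for
  \<open>L2_set\<close> applies.\<close>

lemma cost_sqrt:
  "sqrt (\<Sum>x\<in>A. w x * (f x)\<^sup>2) = L2_set (\<lambda>x. sqrt (w x) * f x) A" if "A \<subseteq> {..<n}"
  unfolding L2_set_def using that w0
  by (intro arg_cong[where f = sqrt] sum.cong) (auto simp: power_mult_distrib)

lemma cost_triangle:
  assumes "A \<subseteq> {..<n}"
  shows "sqrt (\<Sum>x\<in>A. w x * (f x + g x)\<^sup>2) \<le> sqrt (\<Sum>x\<in>A. w x * (f x)\<^sup>2) + sqrt (\<Sum>x\<in>A. w x * (g x)\<^sup>2)"
  unfolding cost_sqrt[OF assms] distrib_left by (rule L2_set_triangle_ineq)

lemma cost_scale:
  assumes "A \<subseteq> {..<n}" "0 \<le> c"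
  shows "sqrt (\<Sum>x\<in>A. w x * (c * f x)\<^sup>2) = c * sqrt (\<Sum>x\<in>A. w x * (f x)\<^sup>2)"
  using assms by (simp add: power_mult_distrib real_sqrt_mult mult.left_commute[of _ "c\<^sup>2"] sum_distrib_left[symmetric])

text \<open>Replacing every centre of \<open>Q\<close> by its nearest point of \<open>S\<close> loses only twice the distance to
  \<open>Q\<close>, independently of how good \<open>S\<close> is.\<close>

lemma restrict_centers:
  assumes S: "S \<subseteq> {..<n}" "S \<noteq> {}" and Q: "Q \<subseteq> {..<n}" "Q \<noteq> {}" "card Q \<le> k"
  obtains P where "P \<subseteq> S" "P \<noteq> {}" "card P \<le> k"
    "\<And>x. x < n \<Longrightarrow> dist_to_set d x P \<le> 2 * dist_to_set d x Q + dist_to_set d x S"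
proof -
  have fin: "finite S" "finite Q" using S Q finite_subset by blast+
  have "\<forall>c. \<exists>s. s \<in> S \<and> dist_to_set d c S = d c s" using dist_to_set_attained[OF fin(1) S(2)] by metis
  then obtain s where s: "\<And>c. s c \<in> S" "\<And>c. dist_to_set d c S = d c (s c)" by metis
  show ?thesis
  proof
    show "s ` Q \<subseteq> S" "s ` Q \<noteq> {}" using s Q by auto
    show "card (s ` Q) \<le> k" using Q card_image_le[OF fin(2), of s] by simp
    fix x assume x: "x < n"
    obtain c where c: "c \<in> Q" "dist_to_set d x Q = d x c" using dist_to_set_attained[OF fin(2) Q(2)] by metis
    have N: "c < n" "s c < n" "s x < n" using c Q s S by auto
    have "dist_to_set d x (s ` Q) \<le> d x (s c)" using fin c by (intro dist_to_set_le) auto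
    also have "\<dots> \<le> d x c + d c (s c)" using x N by (intro triangle) auto
    \<comment> \<open>\<open>s c\<close> is a best candidate for \<open>c\<close>, hence no worse
      for \<open>c\<close> than the candidate \<open>s x\<close> of the point itself; the way back
      through \<open>x\<close> costs \<open>d x c\<close> a second time.\<close>
    also have "d c (s c) \<le> d c (s x)" using s dist_to_set_le[OF fin(1), of "s x" d c] by metis
    also have "d c (s x) \<le> d c x + d x (s x)" using x N by (intro triangle) auto
    finally show "dist_to_set d x (s ` Q) \<le> 2 * dist_to_set d x Q + dist_to_set d x S"
      using c s commute[of c x] by simp
  qed
qed

definition blk :: "nat \<Rightarrow> nat \<Rightarrow> nat set" where
  "blk B x = {y. y < n \<and> y div B = x div B}"

text \<open>Each point is served by the candidates of its own block only, which is what a merge can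
  be compared with. Once a block contains all points, this is the ordinary cost.\<close>

definition block_cost :: "nat \<Rightarrow> nat set \<Rightarrow> nat set \<Rightarrow> real" where
  "block_cost B A T = (\<Sum>x\<in>T. w x * (dist_to_set d x (A \<inter> blk B x))\<^sup>2)"

lemma blk_double: "blk B x \<subseteq> blk (2 * B) x"
  unfolding blk_def by (auto simp: mult.commute[of 2] div_mult2_eq)

lemma finite_blk: "finite (blk B x)"
  by (simp add: blk_def)

lemma dist_antimono:
  assumes "finite S'" "S \<subseteq> S'" "S \<noteq> {}"
  shows "dist_to_set d x S' \<le> dist_to_set d x S"
  using assms finite_subset[OF assms(2,1)] by (intro dist_to_set_ge) (auto intro: dist_to_set_le)

lemma dist_nonneg: "finite S \<Longrightarrow> S \<noteq> {} \<Longrightarrow> 0 \<le> dist_to_set d x S"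
  by (rule dist_to_set_ge) auto

text \<open>The competitor in a block is the image of the global \<open>Q\<close> among the
  candidates of that block. It has at most \<open>k\<close> points in every block, and the bound
  refers to the same \<open>Q\<close> throughout, so the bounds of all blocks can be added.\<close>

lemma merge_block:
  assumes A: "A \<subseteq> {..<n}" "\<And>x. x < n \<Longrightarrow> A \<inter> blk B x \<noteq> {}" and T: "T \<subseteq> {..<n}" "T \<noteq> {}"
    and T2: "\<And>x. x \<in> T \<Longrightarrow> blk (2 * B) x = T"
    and A': "\<And>P. P \<subseteq> A \<inter> T \<Longrightarrow> P \<noteq> {} \<Longrightarrow> card P \<le> k \<Longrightarrow>
       (\<Sum>x\<in>T. w x * (dist_to_set d x (A' \<inter> T))\<^sup>2) \<le> \<rho> * (\<Sum>x\<in>T. w x * (dist_to_set d x P)\<^sup>2)"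
    and \<rho>: "0 \<le> \<rho>"
    and Q: "Q \<subseteq> {..<n}" "Q \<noteq> {}" "card Q \<le> k"
  shows "block_cost (2 * B) A' T
    \<le> \<rho> * (\<Sum>x\<in>T. w x * (2 * dist_to_set d x Q + dist_to_set d x (A \<inter> blk B x))\<^sup>2)"
proof -
  have sub: "A \<inter> blk B x \<subseteq> A \<inter> T" if "x \<in> T" for x using blk_double[of B x] T2[OF that] by auto
  have ne: "A \<inter> T \<noteq> {}" using T sub A(2) by blast
  have fin: "finite (A \<inter> T)" using T finite_subset by blast
  obtain P where P: "P \<subseteq> A \<inter> T" "P \<noteq> {}" "card P \<le> k"
    "\<And>x. x < n \<Longrightarrow> dist_to_set d x P \<le> 2 * dist_to_set d x Q + dist_to_set d x (A \<inter> T)"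
    using restrict_centers[of "A \<inter> T" Q] A(1) ne Q by blast
  have finP: "finite P" using P fin finite_subset by blast
  have "block_cost (2 * B) A' T = (\<Sum>x\<in>T. w x * (dist_to_set d x (A' \<inter> T))\<^sup>2)"
    unfolding block_cost_def using T2 by (intro sum.cong) auto
  also have "\<dots> \<le> \<rho> * (\<Sum>x\<in>T. w x * (dist_to_set d x P)\<^sup>2)" by (rule A'[OF P(1-3)])
  also have "\<dots> \<le> \<rho> * (\<Sum>x\<in>T. w x * (2 * dist_to_set d x Q + dist_to_set d x (A \<inter> blk B x))\<^sup>2)"
  proof (intro mult_left_mono[OF _ \<rho>] sum_mono mult_left_mono power_mono)
    fix x assume x: "x \<in> T"
    then have xn: "x < n" using T by auto
    show "dist_to_set d x P \<le> 2 * dist_to_set d x Q + dist_to_set d x (A \<inter> blk B x)"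
      using P(4)[OF xn] dist_antimono[OF fin sub[OF x] A(2)[OF xn], of x] by simp
    show "0 \<le> w x" by (rule w0[OF xn])
    show "0 \<le> dist_to_set d x P" using finP P by (intro dist_nonneg) auto
  qed
  finally show ?thesis .
qed

lemma merge_level:
  assumes le: "block_cost (2 * B) A' {..<n}
      \<le> (exp \<epsilon>)\<^sup>2 * (\<Sum>x<n. w x * (2 * dist_to_set d x Q + dist_to_set d x (A \<inter> blk B x))\<^sup>2)"
  shows "sqrt (block_cost (2 * B) A' {..<n})
    \<le> exp \<epsilon> * (2 * sqrt (\<Sum>x<n. w x * (dist_to_set d x Q)\<^sup>2) + sqrt (block_cost B A {..<n}))"
proof -
  have "sqrt (block_cost (2 * B) A' {..<n})
     \<le> sqrt ((exp \<epsilon>)\<^sup>2 * (\<Sum>x<n. w x * (2 * dist_to_set d x Q + dist_to_set d x (A \<inter> blk B x))\<^sup>2))"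
    using le by (rule real_sqrt_le_mono)
  also have "\<dots> = exp \<epsilon> * sqrt (\<Sum>x<n. w x * (2 * dist_to_set d x Q + dist_to_set d x (A \<inter> blk B x))\<^sup>2)"
    by (simp add: real_sqrt_mult)
  also have "\<dots> \<le> exp \<epsilon> * (sqrt (\<Sum>x<n. w x * (2 * dist_to_set d x Q)\<^sup>2)
      + sqrt (\<Sum>x<n. w x * (dist_to_set d x (A \<inter> blk B x))\<^sup>2))"
    by (intro mult_left_mono cost_triangle) auto
  also have "sqrt (\<Sum>x<n. w x * (2 * dist_to_set d x Q)\<^sup>2) = 2 * sqrt (\<Sum>x<n. w x * (dist_to_set d x Q)\<^sup>2)"
    by (rule cost_scale) auto
  finally show ?thesis by (simp add: block_cost_def)
qed

end

section \<open>Programs for the reduction of a block\<close>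

lemmas wp_intros = wp_Seq wp_Cond wp_RPut wp_IPut wp_ISet wp_RSet wp_Skip

abbreviation (input) "rzero \<equiv> RNat (INum 0)"

abbreviation (input) saving_exp :: "rexp \<Rightarrow> rexp" where
  "saving_exp e \<equiv> RMul (RGet ''w'' (IVar ''x''))
     (RSub (RMul e e) (RMul (RDist (IVar ''x'') (IGet ''C'' (IVar ''j''))) (RDist (IVar ''x'') (IGet ''C'' (IVar ''j'')))))"

text \<open>Takes the old contribution of \<open>x\<close> out of every entry of \<open>G\<close>
  and puts the new one in: a changed distance costs one pass over the candidates instead of a
  recomputation of the savings.\<close>

definition set_D :: com where
  "set_D = Seq (For ''j'' (INum 0) ''nc'' (Seq
     (Cond (RLess (RMul (RVar ''q'') (RDist (IVar ''x'') (IGet ''C'' (IVar ''j'')))) (RGet ''D'' (IVar ''x'')))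
       (RPut ''G'' (IVar ''j'') (RSub (RGet ''G'' (IVar ''j'')) (saving_exp (RGet ''D'' (IVar ''x''))))) Skip)
     (Cond (RLess (RMul (RVar ''q'') (RDist (IVar ''x'') (IGet ''C'' (IVar ''j'')))) (RVar ''v''))
       (RPut ''G'' (IVar ''j'') (RAdd (RGet ''G'' (IVar ''j'')) (saving_exp (RVar ''v'')))) Skip)))
   (RPut ''D'' (IVar ''x'') (RVar ''v''))"

definition add_center :: com where
  "add_center = Seq (IPut ''A'' (IVar ''c'') (INum 1))
     (For ''x'' (IVar ''lo'') ''hi'' (Seq (RSet ''v'' (RDist (IVar ''x'') (IVar ''c'')))
       (Cond (RLess (RMul (RVar ''q'') (RVar ''v'')) (RGet ''D'' (IVar ''x''))) set_D Skip)))"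

lemma set_D_mods [simp]: "ivs set_D = {''j''}" "rvs set_D = {}" "ias set_D = {}" "ras set_D = {''G'', ''D''}"
  by (auto simp: set_D_def)

lemma add_center_mods [simp]: "ivs add_center = {''x'', ''j''}" "rvs add_center = {''v''}"
  "ias add_center = {''A''}" "ras add_center = {''G'', ''D''}"
  by (auto simp: add_center_def)

text \<open>\<open>2 ^ Y\<close> bounds \<open>n\<close> times the aspect ratio, \<open>dl\<close> is a lower bound on the non-zero distances, and
  \<open>M\<close> bounds every integer that the program computes.\<close>

locale kmeans_run = kmeans_instance +
  fixes Y M :: nat and dl :: real
  assumes Y1: "1 \<le> Y" and nY: "n \<le> 2 ^ Y" and dl0: "0 < dl"
    and dl: "x < n \<Longrightarrow> y < n \<Longrightarrow> x \<noteq> y \<Longrightarrow> dl \<le> d x y"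
    and dY: "x < n \<Longrightarrow> y < n \<Longrightarrow> real n * d x y \<le> 2 ^ Y * dl"
    and M: "M = 50 * n * Y"
begin

lemma n1: "1 \<le> n" using k1 kn by simp

lemma nY1: "1 \<le> n * Y" "n \<le> n * Y" "Y \<le> n * Y" using n1 Y1 by simp_all

lemma M_ge [simp]: "50 * n \<le> M" "50 * Y \<le> M" "50 \<le> M" "Suc 0 \<le> M" "0 < M"
  using nY1 by (simp_all add: M)

lemma set_D:
  assumes st: "ivar s ''x'' = x" "ivar s ''nc'' = nc" "rvar s ''q'' = q" "rvar s ''v'' = v" "iarr s ''C'' = C"
    "rarr s ''D'' = D" "rarr s ''G'' = G" "rarr s ''w'' x = w x"
  shows "wp d M set_D (\<lambda>s' \<tau>. rarr s' ''D'' = D(x := v)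
     \<and> rarr s' ''G'' = (\<lambda>j. if j < nc then G j - saving w d q x (C j) (D x) + saving w d q x (C j) v else G j)
     \<and> \<tau> \<le> 100 * nc + 20) s"
proof -
  define G' where "G' i = (\<lambda>j. if j < i then G j - saving w d q x (C j) (D x) + saving w d q x (C j) v else G j)" for i
  show ?thesis
    unfolding set_D_def
  proof (rule wp_Seq, rule wp_For_const[where Inv = "\<lambda>i s'. rarr s' ''G'' = G' i" and \<beta> = 100 and
        a = 0 and b = nc], goal_cases)
    case (9 i s')
    note fr = frameD[OF 9(4), simplified]
    show ?case
      by (intro wp_intros)
        (use st 9(1-3,5) in \<open>auto simp: fr G'_def fun_eq_iff saving_def power2_eq_square algebra_simps less_Suc_eq\<close>)
  next
    case (10 s' \<tau>)
    note fr = frameD[OF 10(1), simplified]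
    show ?case
      by (intro wp_intros) (use st 10(2-) in \<open>auto simp: fr G'_def fun_eq_iff\<close>)
  qed (use st in \<open>auto simp: G'_def\<close>)
qed

lemma sum_fun_upd:
  fixes f :: "nat \<Rightarrow> real \<Rightarrow> real"
  assumes "finite T" "x \<in> T"
  shows "(\<Sum>y\<in>T. f y ((D(x := v)) y)) = (\<Sum>y\<in>T. f y (D y)) - f x (D x) + f x v"
  using assms by (simp add: sum.remove[of T x])

definition gains :: "nat \<Rightarrow> nat \<Rightarrow> real \<Rightarrow> (nat \<Rightarrow> nat) \<Rightarrow> nat \<Rightarrow> (nat \<Rightarrow> real) \<Rightarrow> (nat \<Rightarrow> real) \<Rightarrow> bool" where
  "gains lo hi q C nc D G \<longleftrightarrow> (\<forall>j<nc. G j = (\<Sum>x\<in>{lo..<hi}. saving w d q x (C j) (D x)))"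

lemma gains_upd:
  assumes "gains lo hi q C nc D G" "lo \<le> x" "x < hi"
  shows "gains lo hi q C nc (D(x := v))
    (\<lambda>j. if j < nc then G j - saving w d q x (C j) (D x) + saving w d q x (C j) v else G j)"
  using assms sum_fun_upd[where f = "\<lambda>y. saving w d q y c" for c, of "{lo..<hi}" x]
  unfolding gains_def by simp

text \<open>The bound separates the scan of the block from the expensive updates, whose number stays
  symbolic until \<open>total_pot_relax\<close> pays for it.\<close>

lemma add_center:
  assumes st: "ivar s ''lo'' = lo" "ivar s ''hi'' = hi" "ivar s ''nc'' = nc" "ivar s ''c'' = c"
      "rvar s ''q'' = q" "rarr s ''D'' = D" "lo \<le> hi" "hi \<le> n" "\<And>x. x < n \<Longrightarrow> rarr s ''w'' x = w x"
    and g: "gains lo hi q (iarr s ''C'') nc D (rarr s ''G'')"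
  shows "wp d M add_center (\<lambda>s' \<tau>.
      rarr s' ''D'' = (\<lambda>x. if lo \<le> x \<and> x < hi then relax d q c D x else D x)
    \<and> gains lo hi q (iarr s ''C'') nc (rarr s' ''D'') (rarr s' ''G'')
    \<and> iarr s' ''A'' = (iarr s ''A'')(c := 1)
    \<and> \<tau> \<le> 50 * (hi - lo) + (100 * nc + 50) * card {x\<in>{lo..<hi}. q * d x c < D x} + 20) s"
proof -
  define Dj where "Dj j = (\<lambda>x. if lo \<le> x \<and> x < j then relax d q c D x else D x)" for j
  define Tj where "Tj j = 50 * (j - lo) + (100 * nc + 50) * card {x\<in>{lo..<j}. q * d x c < D x}" for j
  have Tj: "Tj (Suc j) = Tj j + 50 + (if q * d j c < D j then 100 * nc + 50 else 0)" if "lo \<le> j" for j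
  proof -
    have "{x\<in>{lo..<Suc j}. q * d x c < D x} =
        (if q * d j c < D j then insert j {x\<in>{lo..<j}. q * d x c < D x} else {x\<in>{lo..<j}. q * d x c < D x})"
      using that by (auto simp: less_Suc_eq)
    then show ?thesis using that by (auto simp: Tj_def Suc_diff_le algebra_simps)
  qed
  have Dj: "Dj (Suc j) = (Dj j)(j := relax d q c D j)" "Dj j j = D j" if "lo \<le> j" for j
    using that by (auto simp: Dj_def fun_eq_iff less_Suc_eq)
  have Dj0: "Dj lo = D" by (auto simp: Dj_def fun_eq_iff)
  show ?thesis
    unfolding add_center_def
  proof (intro wp_Seq wp_IPut, goal_cases)
    case 3
    let ?s = "s\<lparr>iarr := (iarr s)(''A'' := (iarr s ''A'')(ival s (IVar ''c'') := ival s (INum 1)))\<rparr>"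
    show ?case
    proof (rule wp_For[where Inv = "\<lambda>j s' \<tau>. rarr s' ''D'' = Dj j \<and>
          gains lo hi q (iarr s ''C'') nc (Dj j) (rarr s' ''G'') \<and> \<tau> \<le> Tj j" and a = lo and b = hi], goal_cases)
      case (9 j s' \<tau>)
      note fr = frameD[OF 9(4), simplified]
      have sC: "iarr s' ''C'' = iarr s ''C''" "ivar s' ''nc'' = nc" "ivar s' ''c'' = c" "rvar s' ''q'' = q"
        "rarr s' ''w'' j = w j"
        using st 9(2) by (auto simp: fr)
      show ?case
      proof (intro wp_Seq wp_RSet wp_Cond wp_Skip, goal_cases)
        case 3
        then have c: "q * d j c < D j" using 9 sC Dj by simp
        note 99 = \<open>j < hi\<close> 9(5)
        show ?case
        proof (rule wp_use[OF set_D[where x = j and nc = nc and q = q and v = "d j c" and C = "iarr s ''C''"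
                and D = "Dj j" and G = "rarr s' ''G''"]], goal_cases)
          case (9 s'' \<tau>')
          note fr2 = frameD[OF 9(1), simplified]
          show ?case
            using 9(2) \<open>lo \<le> j\<close> \<open>ivar s' ''x'' = j\<close> 99 sC c gains_upd[of lo hi q "iarr s ''C''" nc "Dj j" "rarr s' ''G''" j "d j c"]
            by (auto simp: fr2 Dj Tj relax_def)
        qed (use sC 99 \<open>ivar s' ''x'' = j\<close> in auto)
      next
        case 4
        then have "\<not> q * d j c < D j" using 9 sC Dj by simp
        then have "Dj (Suc j) = Dj j" using Dj[OF 9(1)] by (simp add: relax_def fun_upd_idem)
        then show ?case using 9(1-3,5) \<open>\<not> q * d j c < D j\<close> by (auto simp: Tj)
      qed auto
    next
      case (10 s' \<tau>)
      note fr = frameD[OF 10(1), simplified]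
      show ?case using 10(2,3) st by (auto simp: fr Dj_def Tj_def)
    qed (use st g in \<open>auto simp: Dj0 Tj_def\<close>)
  qed auto
qed

end

text \<open>If no positive recorded distance is left, the default \<open>lo\<close> is returned; the
  second alternative of \<open>heavy_picks\<close> covers that case.\<close>

definition heavy_pick :: com where
  "heavy_pick = Seq (ISet ''c'' (IVar ''lo'')) (For ''x'' (IVar ''lo'') ''hi''
     (Cond (BAnd (RLess rzero (RGet ''D'' (IVar ''x'')))
              (BNot (BAnd (RLess rzero (RGet ''D'' (IVar ''c'')))
                (BNot (RLess (RGet ''w'' (IVar ''c'')) (RGet ''w'' (IVar ''x'')))))))
        (ISet ''c'' (IVar ''x'')) Skip))"

definition gain_pick :: com where
  "gain_pick = Seq (ISet ''b'' (INum 0)) (Seq (For ''j'' (INum 0) ''nc''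
     (Cond (RLess (RGet ''G'' (IVar ''b'')) (RGet ''G'' (IVar ''j''))) (ISet ''b'' (IVar ''j'')) Skip))
     (ISet ''c'' (IGet ''C'' (IVar ''b''))))"

lemma heavy_pick_mods [simp]: "ivs heavy_pick = {''c'', ''x''}" "rvs heavy_pick = {}"
  "ias heavy_pick = {}" "ras heavy_pick = {}"
  by (auto simp: heavy_pick_def)

lemma gain_pick_mods [simp]: "ivs gain_pick = {''b'', ''j'', ''c''}" "rvs gain_pick = {}"
  "ias gain_pick = {}" "ras gain_pick = {}"
  by (auto simp: gain_pick_def)

section \<open>Greedy rounds on one block and their amortised time\<close>

locale block_run = kmeans_run +
  fixes lo hi nc l :: nat and C :: "nat \<Rightarrow> nat" and q :: real
  assumes lohi: "lo < hi" "hi \<le> n" and nc: "1 \<le> nc" "nc \<le> hi - lo"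
    and C: "j < nc \<Longrightarrow> lo \<le> C j \<and> C j < hi" and l: "1 \<le> l" "l \<le> Y + 1" and q: "q = 1 + 1 / real l"
begin

abbreviation T where "T \<equiv> {lo..<hi}"

lemma TN: "x \<in> T \<Longrightarrow> x < n" using lohi by simp

sublocale greedy_cover T w d q
  by unfold_locales (use lohi w0 q in auto)

text \<open>By the last conjunct \<open>D x\<close> is the distance to some chosen point, not
  necessarily the nearest. So it bounds the true distance from above, and it is either 0 or at least
  \<open>dl\<close>, as \<open>pot\<close> requires.\<close>

definition blk_state :: "state \<Rightarrow> bool" where
  "blk_state s \<longleftrightarrow> ivar s ''lo'' = lo \<and> ivar s ''hi'' = hi \<and> ivar s ''nc'' = nc \<and> rvar s ''q'' = q
    \<and> iarr s ''C'' = C \<and> (\<forall>x<n. rarr s ''w'' x = w x)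
    \<and> gains lo hi q C nc (rarr s ''D'') (rarr s ''G'')
    \<and> (\<forall>x\<in>T. \<exists>y\<in>T. 0 < iarr s ''A'' y \<and> rarr s ''D'' x = d x y)"

definition alive :: "state \<Rightarrow> nat set" where
  "alive s = {y\<in>T. 0 < iarr s ''A'' y}"

lemma heavy_pick:
  assumes "blk_state s"
  shows "wp d M heavy_pick (\<lambda>s' \<tau>. ivar s' ''c'' \<in> T \<and>
    (\<forall>x\<in>T. 0 < rarr s ''D'' x \<longrightarrow> 0 < rarr s ''D'' (ivar s' ''c'') \<and> w x \<le> w (ivar s' ''c''))
    \<and> \<tau> \<le> 50 * (hi - lo) + 30) s"
  unfolding heavy_pick_def
proof (intro wp_Seq wp_ISet, goal_cases)
  case 2
  have st: "ivar s ''lo'' = lo" "ivar s ''hi'' = hi" "\<forall>x<n. rarr s ''w'' x = w x"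
    using assms by (auto simp: blk_state_def)
  show ?case
  proof (rule wp_For_const[where a = lo and b = hi and \<beta> = 50 and Inv = "\<lambda>j s'. ivar s' ''c'' \<in> T \<and>
    (\<forall>x\<in>{lo..<j}. 0 < rarr s ''D'' x \<longrightarrow> 0 < rarr s ''D'' (ivar s' ''c'') \<and> w x \<le> w (ivar s' ''c''))"], goal_cases)
    case (9 j s')
    note fr = frameD[OF 9(4), simplified]
    have "rarr s ''w'' j = w j" "rarr s ''w'' (ivar s' ''c'') = w (ivar s' ''c'')" using st 9 lohi by auto
    then show ?case
      by (intro wp_intros) (use 9(1-3,5) in \<open>auto simp: fr less_Suc_eq; force\<close>)+
  next
    case (10 s' \<tau>)
    then show ?case by auto
  qed (use st lohi in auto)
qed auto

lemma gain_pick: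
  assumes "blk_state s"
  shows "wp d M gain_pick (\<lambda>s' \<tau>. ivar s' ''c'' \<in> C ` {..<nc} \<and>
    (\<forall>p\<in>C ` {..<nc}. (\<Sum>x\<in>T. saving w d q x p (rarr s ''D'' x)) \<le> (\<Sum>x\<in>T. saving w d q x (ivar s' ''c'') (rarr s ''D'' x)))
    \<and> \<tau> \<le> 50 * (hi - lo) + 30) s"
  unfolding gain_pick_def
proof (intro wp_Seq wp_ISet, goal_cases)
  case 2
  have st: "ivar s ''nc'' = nc" "iarr s ''C'' = C" "gains lo hi q C nc (rarr s ''D'') (rarr s ''G'')"
    using assms by (auto simp: blk_state_def)
  show ?case
  proof (rule wp_For_const[where a = 0 and b = nc and \<beta> = 40 and Inv = "\<lambda>j s'. ivar s' ''b'' < nc \<and>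
    (\<forall>i<j. rarr s ''G'' i \<le> rarr s ''G'' (ivar s' ''b''))"], goal_cases)
    case (9 j s')
    note fr = frameD[OF 9(4), simplified]
    show ?case
      by (intro wp_intros) (use 9(1-3,5) in \<open>auto simp: fr less_Suc_eq; force\<close>)+
  next
    case (10 s' \<tau>)
    note fr = frameD[OF 10(1), simplified]
    show ?case
      by (intro wp_ISet) (use 10(3-) nc st in \<open>auto simp: fr gains_def\<close>)
  qed (use st nc in auto)
qed auto

text \<open>Bounds how often \<open>v\<close> can still fall by the factor \<open>q\<close>: the
  logarithm of \<open>v / dl\<close> to base \<open>q\<close>, and one last fall to 0.\<close>

definition pot :: "real \<Rightarrow> nat" where
  "pot v = (if v = 0 then 0 else 1 + nat \<lfloor>log q (v / dl)\<rfloor>)"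

lemma q_gt1: "1 < q" using q l by simp

lemma pot_drop:
  assumes "q * u < v" "u = 0 \<or> dl \<le> u" "dl \<le> v"
  shows "pot u + 1 \<le> pot v"
proof (cases "u = 0")
  case True
  then show ?thesis using assms dl0 by (simp add: pot_def)
next
  case False
  with assms dl0 have u: "dl \<le> u" "0 < u" by auto
  have "q * (u / dl) \<le> v / dl" using assms dl0 by (simp add: field_simps)
  then have "log q (q * (u / dl)) \<le> log q (v / dl)"
    using q_gt1 u dl0 assms by (subst log_le_cancel_iff) auto
  moreover have "log q (q * (u / dl)) = 1 + log q (u / dl)"
    using q_gt1 u dl0 by (subst log_mult) auto
  moreover have "0 \<le> log q (u / dl)" using q_gt1 u dl0 by (subst zero_le_log_cancel_iff) auto
  ultimately have "nat \<lfloor>log q (u / dl)\<rfloor> + 1 \<le> nat \<lfloor>log q (v / dl)\<rfloor>" by linarith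
  then show ?thesis using False assms dl0 by (simp add: pot_def)
qed

text \<open>Since \<open>ln (1 / q) <= 1 / q - 1\<close>, the logarithm of \<open>q\<close> is at
  least \<open>1 / (l + 1)\<close>, so \<open>2 ^ Y\<close> contains at most
  \<open>Y * (l + 1)\<close> factors \<open>q\<close>.\<close>

lemma pot_bound:
  assumes "v \<le> 2 ^ Y * dl" "v = 0 \<or> dl \<le> v"
  shows "pot v \<le> 1 + Y * (l + 1)"
proof (cases "v = 0")
  case False
  then have v: "dl \<le> v" "0 < v" using assms dl0 by auto
  have lq: "1 / (real l + 1) \<le> ln q"
  proof -
    have "ln (1 / q) \<le> 1 / q - 1" using q_gt1 by (intro ln_le_minus_one) auto
    moreover have "ln (1 / q) = - ln q" using q_gt1 by (simp add: ln_div)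
    moreover have "1 / q = real l / (real l + 1)" using l unfolding q by (simp add: field_simps)
    then have "1 / q - 1 = - (1 / (real l + 1))" by (simp add: field_simps)
    ultimately show ?thesis by linarith
  qed
  have "v / dl \<le> 2 ^ Y" using assms dl0 by (simp add: field_simps)
  then have "ln (v / dl) \<le> ln (2 ^ Y)" using v dl0 by (subst ln_le_cancel_iff) auto
  also have "\<dots> \<le> real Y" using ln_2_less_1 by (simp add: ln_realpow mult_left_le)
  finally have Yb: "ln (v / dl) \<le> real Y" .
  have "log q (v / dl) = ln (v / dl) / ln q" by (simp add: log_def)
  also have "\<dots> \<le> real Y / (1 / (real l + 1))"
    using Yb lq v dl0 by (intro frac_le) auto
  also have "\<dots> = real (Y * (l + 1))" by (simp add: algebra_simps)
  finally have "nat \<lfloor>log q (v / dl)\<rfloor> \<le> Y * (l + 1)" by linarith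
  then show ?thesis using False by (simp add: pot_def)
qed (simp add: pot_def)

definition total_pot :: "(nat \<Rightarrow> real) \<Rightarrow> nat" where "total_pot D = (\<Sum>x\<in>T. pot (D x))"

lemma d_range: "x < n \<Longrightarrow> y < n \<Longrightarrow> d x y = 0 \<or> dl \<le> d x y"
  using dl[of x y] by (cases "x = y") auto

lemma d_le: "x < n \<Longrightarrow> y < n \<Longrightarrow> d x y \<le> 2 ^ Y * dl"
  using dY[of x y] mult_right_mono[of 1 "real n" "d x y"] n1 by simp

text \<open>Every updated point pays for its update with at least one unit of its own
  potential.\<close>

lemma total_pot_relax:
  assumes "c \<in> T" "\<And>x. x \<in> T \<Longrightarrow> \<exists>y\<in>T. D x = d x y" "\<And>x. x \<in> T \<Longrightarrow> D' x = relax d q c D x"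
  shows "total_pot D' + card {x\<in>T. q * d x c < D x} \<le> total_pot D"
proof -
  have "total_pot D' + card {x\<in>T. q * d x c < D x} = (\<Sum>x\<in>T. pot (D' x) + (if q * d x c < D x then 1 else 0))"
    unfolding total_pot_def by (simp add: sum.distrib sum.If_cases Int_def)
  also have "\<dots> \<le> total_pot D" unfolding total_pot_def
  proof (rule sum_mono)
    fix x assume x: "x \<in> T"
    obtain y where y: "y \<in> T" "D x = d x y" using assms(2)[OF x] by blast
    show "pot (D' x) + (if q * d x c < D x then 1 else 0) \<le> pot (D x)"
    proof (cases "q * d x c < D x")
      case True
      have "0 < D x" using True q_gt1 nonneg[of x c] by (smt (verit) mult_nonneg_nonneg)
      then have "dl \<le> D x" using d_range[of x y] TN[OF x] TN[OF y(1)] y by auto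
      then show ?thesis using True pot_drop[OF True] d_range[of x c] TN[OF x] TN[OF assms(1)] assms(3)[OF x]
        by (simp add: relax_def)
    qed (simp add: assms(3)[OF x] relax_def)
  qed
  finally show ?thesis .
qed

lemma total_pot_bound:
  assumes "\<And>x. x \<in> T \<Longrightarrow> \<exists>y\<in>T. D x = d x y"
  shows "total_pot D \<le> (hi - lo) * (1 + Y * (l + 1))"
proof -
  have "pot (D x) \<le> 1 + Y * (l + 1)" if x: "x \<in> T" for x
  proof -
    obtain y where "y \<in> T" "D x = d x y" using assms[OF x] by blast
    then show ?thesis using d_range[of x y] d_le[of x y] TN x by (intro pot_bound) auto
  qed
  then have "total_pot D \<le> (\<Sum>x\<in>T. 1 + Y * (l + 1))" unfolding total_pot_def by (rule sum_mono)
  then show ?thesis by simp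
qed

text \<open>Stated once for both phases of a block: \<open>pick\<close> becomes
  \<open>heavy_pick\<close> or \<open>gain_pick\<close>, and \<open>\<Phi>\<close> is the property
  of the recorded distances that a round passes on. Time is stated together with the remaining
  potential, so that both phases draw on one budget.\<close>

lemma rounds:
  fixes \<Phi> :: "nat \<Rightarrow> (nat \<Rightarrow> real) \<Rightarrow> bool" and Pick :: "nat \<Rightarrow> (nat \<Rightarrow> real) \<Rightarrow> bool"
  assumes mods: "ivs pick \<subseteq> {''b'', ''c'', ''j'', ''x''}" "rvs pick = {}" "ias pick = {}" "ras pick = {}"
    and h: "h \<in> {''k'', ''g''}" "ivar s h = r"
    and pick: "\<And>s'. blk_state s' \<Longrightarrow> wp d M pick (\<lambda>s'' \<tau>. ivar s'' ''c'' \<in> T \<and> Pick (ivar s'' ''c'') (rarr s' ''D'')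
        \<and> \<tau> \<le> 50 * (hi - lo) + 30) s'"
    and \<Phi>: "\<And>i c D D'. \<Phi> i D \<Longrightarrow> c \<in> T \<Longrightarrow> Pick c D \<Longrightarrow> (\<And>x. x \<in> T \<Longrightarrow> 0 \<le> D x) \<Longrightarrow>
        (\<And>x. x \<in> T \<Longrightarrow> D' x = relax d q c D x) \<Longrightarrow> \<Phi> (Suc i) D'"
    and s: "blk_state s" "\<Phi> 0 (rarr s ''D'')"
  shows "wp d M (For ''i'' (INum 0) h (Seq pick add_center)) (\<lambda>s' \<tau>. blk_state s' \<and> \<Phi> r (rarr s' ''D'')
    \<and> card (alive s') \<le> card (alive s) + r \<and> alive s \<subseteq> alive s' \<and> (\<forall>x. x \<notin> T \<longrightarrow> iarr s' ''A'' x = iarr s ''A'' x)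
    \<and> \<tau> + (100 * nc + 50) * total_pot (rarr s' ''D'') \<le>
        r * (100 * (hi - lo) + 100) + (100 * nc + 50) * total_pot (rarr s ''D'') + 10) s"
proof (rule wp_For[where a = 0 and b = r and Inv = "\<lambda>i s' \<tau>. blk_state s' \<and> \<Phi> i (rarr s' ''D'')
    \<and> card (alive s') \<le> card (alive s) + i \<and> alive s \<subseteq> alive s' \<and> (\<forall>x. x \<notin> T \<longrightarrow> iarr s' ''A'' x = iarr s ''A'' x)
    \<and> \<tau> + (100 * nc + 50) * total_pot (rarr s' ''D'') \<le>
        i * (100 * (hi - lo) + 100) + (100 * nc + 50) * total_pot (rarr s ''D'')"], goal_cases)
  case (9 i s' \<tau>)
  show ?case
  proof (rule wp_Seq, rule wp_use[OF pick], goal_cases)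
    case 1 then show ?case using 9 by simp
  next
    case (2 s1 \<tau>1)
    have ivp: "x \<notin> {''b'', ''c'', ''j'', ''x''} \<Longrightarrow> ivar s1 x = ivar s' x" for x
      using frameD(1)[OF 2(1), of x] mods(1) by auto
    have eq: "rvar s1 = rvar s'" "iarr s1 = iarr s'" "rarr s1 = rarr s'"
      using frameD[OF 2(1)] mods by auto
    have st: "ivar s1 ''lo'' = lo" "ivar s1 ''hi'' = hi" "ivar s1 ''nc'' = nc" "rvar s1 ''q'' = q"
      "iarr s1 ''C'' = C" "\<And>x. x < n \<Longrightarrow> rarr s1 ''w'' x = w x"
      using 9(5) by (auto simp: blk_state_def ivp eq)
    have g: "gains lo hi q (iarr s1 ''C'') nc (rarr s' ''D'') (rarr s1 ''G'')"
      using 9(5) by (simp_all add: blk_state_def eq)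
    have cov: "\<And>x. x \<in> T \<Longrightarrow> \<exists>y\<in>T. 0 < iarr s' ''A'' y \<and> rarr s' ''D'' x = d x y"
      using 9(5) unfolding blk_state_def by blast
    let ?c = "ivar s1 ''c''"
    show ?case
    proof (rule wp_use[OF add_center[where D = "rarr s' ''D''", OF st(1-3) refl st(4)]], goal_cases)
      case (6 s2 \<tau>2)
      note fr2 = frameD[OF 6(1), simplified]
      have D': "\<And>x. x \<in> T \<Longrightarrow> rarr s2 ''D'' x = relax d q ?c (rarr s' ''D'') x" using 6 by simp
      have A': "iarr s2 ''A'' = (iarr s' ''A'')(?c := 1)" using 6 by (simp add: eq)
      have al: "alive s2 = insert ?c (alive s')" using 2 by (auto simp: alive_def A')
      have "\<exists>y\<in>T. rarr s' ''D'' x = d x y" if "x \<in> T" for x using cov[OF that] by blast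
      from total_pot_relax[OF _ this D'] 2
      have tp: "total_pot (rarr s2 ''D'') + card {x\<in>T. q * d x ?c < rarr s' ''D'' x} \<le> total_pot (rarr s' ''D'')"
        by auto
      have D0: "0 \<le> rarr s' ''D'' x" if "x \<in> T" for x using cov[OF that] by auto
      have "\<Phi> (Suc i) (rarr s2 ''D'')"
        using \<Phi>[OF _ _ _ D0 D', of i] 9(5) 2(2) by blast
      moreover have "blk_state s2"
        unfolding blk_state_def
      proof (intro conjI ballI)
        fix x assume x: "x \<in> T"
        then obtain y where y: "y \<in> T" "0 < iarr s' ''A'' y" "rarr s' ''D'' x = d x y" using cov by blast
        have "?c \<in> T" using 2(2) by simp
        then show "\<exists>y\<in>T. 0 < iarr s2 ''A'' y \<and> rarr s2 ''D'' x = d x y"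
          using y D'[OF x] by (cases "q * d x ?c < rarr s' ''D'' x")
            (auto simp: A' relax_def intro: bexI[of _ ?c] bexI[of _ y])
      qed (use 6(2) st in \<open>auto simp: fr2\<close>)
      moreover have "card (alive s2) \<le> card (alive s) + Suc i" "alive s \<subseteq> alive s2"
        using 9(5) card_insert_le_m1[of "Suc (card (alive s'))" "alive s'" ?c] al
        by (auto simp: alive_def card_insert_if)
      moreover have "\<forall>x. x \<notin> T \<longrightarrow> iarr s2 ''A'' x = iarr s ''A'' x" using 9(5) 2(2) by (auto simp: A')
      moreover have "(\<tau> + (\<tau>1 + \<tau>2) + 8) + (100 * nc + 50) * total_pot (rarr s2 ''D'')
        \<le> Suc i * (100 * (hi - lo) + 100) + (100 * nc + 50) * total_pot (rarr s ''D'')"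
      proof -
        have "(100 * nc + 50) * total_pot (rarr s2 ''D'') + (100 * nc + 50) * card {x\<in>T. q * d x ?c < rarr s' ''D'' x}
          \<le> (100 * nc + 50) * total_pot (rarr s' ''D'')"
          using mult_le_mono2[OF tp, of "100 * nc + 50"] by (simp only: distrib_left)
        then show ?thesis using 9(5) 2(2) 6(2) by (simp add: eq)
      qed
      ultimately show ?case by (simp add: blk_state_def alive_def)
    qed (use lohi st g eq in auto)
  qed
qed (use h s mods in \<open>auto simp: blk_state_def alive_def\<close>)

end

section \<open>Preparing a block for the greedy rounds\<close>

definition gather :: com where
  "gather = Seq (ISet ''nc'' (INum 0)) (For ''x'' (IVar ''lo'') ''hi''
     (Cond (ILess (INum 0) (IGet ''A'' (IVar ''x'')))
        (Seq (IPut ''C'' (IVar ''nc'') (IVar ''x''))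
          (Seq (ISet ''nc'' (IAdd (IVar ''nc'') (INum 1))) (IPut ''A'' (IVar ''x'') (INum 0)))) Skip))"

text \<open>At recorded distance 0 every saving is 0, so a zeroed \<open>G\<close> is consistent
  with \<open>D\<close>, and from then on every change can go through \<open>set_D\<close>.\<close>

definition clear_D :: com where
  "clear_D = Seq (For ''j'' (INum 0) ''nc'' (RPut ''G'' (IVar ''j'') rzero))
     (For ''x'' (IVar ''lo'') ''hi'' (RPut ''D'' (IVar ''x'') rzero))"

text \<open>The first point of the block, candidate or not, is chosen so that every recorded
  distance belongs to a chosen point. The sum \<open>dmx\<close> bounds all these distances; using
  it in place of the maximum loses at most the factor \<open>n\<close> for which
  \<open>2 ^ Y\<close> has room.\<close>

definition first_center :: com where
  "first_center = Seq (RSet ''dmx'' rzero) (Seq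
     (For ''x'' (IVar ''lo'') ''hi'' (Seq (RSet ''v'' (RDist (IVar ''x'') (IVar ''lo'')))
        (Seq set_D (RSet ''dmx'' (RAdd (RVar ''dmx'') (RVar ''v''))))))
     (IPut ''A'' (IVar ''lo'') (INum 1)))"

text \<open>Only distances to candidates are inspected, because competitors \<open>P\<close> consist
  of candidates; this avoids a time quadratic in the block. The initial value \<open>dmx\<close>
  serves when no smaller non-zero distance exists.\<close>

definition min_dist :: com where
  "min_dist = Seq (RSet ''dm'' (RVar ''dmx'')) (For ''x'' (IVar ''lo'') ''hi'' (For ''j'' (INum 0) ''nc''
     (Seq (RSet ''v'' (RDist (IVar ''x'') (IGet ''C'' (IVar ''j''))))
       (Cond (BAnd (RLess rzero (RVar ''v'')) (RLess (RVar ''v'') (RVar ''dm'')))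
          (RSet ''dm'' (RVar ''v'')) Skip))))"

text \<open>Doubling finds the exponent \<open>q2\<close> with \<open>dmx <= 2 ^ q2 * dm\<close>
  without a logarithm; \<open>g\<close> is then the number of rounds in the exponent of
  \<open>greedy_result\<close>.\<close>

definition num_rounds :: com where
  "num_rounds = Seq (RSet ''v'' (RVar ''dm'')) (Seq (ISet ''q2'' (INum 0))
     (Seq (While (RLess (RVar ''v'') (RVar ''dmx''))
        (Seq (RSet ''v'' (RAdd (RVar ''v'') (RVar ''v''))) (ISet ''q2'' (IAdd (IVar ''q2'') (INum 1)))))
     (ISet ''g'' (IMul (IVar ''k'') (IAdd (IMul (INum 2) (IVar ''q2'')) (IVar ''lev''))))))"

definition choose_centers :: com where
  "choose_centers = Seq clear_D (Seq first_center (Seq min_dist (Seq num_rounds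
     (Seq (For ''i'' (INum 0) ''k'' (Seq heavy_pick add_center))
       (For ''i'' (INum 0) ''g'' (Seq gain_pick add_center))))))"

definition reduce_block :: com where
  "reduce_block = Seq gather choose_centers"

lemma mods [simp]:
  "ivs gather = {''nc'', ''x''}" "rvs gather = {}" "ias gather = {''C'', ''A''}" "ras gather = {}"
  "ivs clear_D = {''j'', ''x''}" "rvs clear_D = {}" "ias clear_D = {}" "ras clear_D = {''G'', ''D''}"
  "ivs first_center = {''j'', ''x''}" "rvs first_center = {''dmx'', ''v''}" "ias first_center = {''A''}"
  "ras first_center = {''G'', ''D''}"
  "ivs min_dist = {''j'', ''x''}" "rvs min_dist = {''dm'', ''v''}" "ias min_dist = {}" "ras min_dist = {}"
  "ivs num_rounds = {''g'', ''q2''}" "rvs num_rounds = {''v''}" "ias num_rounds = {}" "ras num_rounds = {}"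
  by (auto simp: gather_def clear_D_def first_center_def min_dist_def num_rounds_def)

lemma reduce_block_mods [simp]:
  "ivs reduce_block = {''nc'', ''x'', ''j'', ''g'', ''q2'', ''i'', ''c'', ''b''}"
  "rvs reduce_block = {''dmx'', ''dm'', ''v''}" "ias reduce_block = {''C'', ''A''}"
  "ras reduce_block = {''G'', ''D''}"
  by (auto simp: reduce_block_def choose_centers_def)

lemma extend_enum:
  fixes f :: "nat \<Rightarrow> nat"
  assumes "inj_on f {..<m}" "j \<notin> f ` {..<m}"
  shows "inj_on (f(m := j)) {..<Suc m}" "(f(m := j)) ` {..<Suc m} = insert j (f ` {..<m})"
proof -
  have e: "(f(m := j)) ` {..<m} = f ` {..<m}" by (rule image_cong) auto
  show "(f(m := j)) ` {..<Suc m} = insert j (f ` {..<m})" unfolding lessThan_Suc image_insert e by simp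
  have "inj_on (f(m := j)) {..<m}" using assms(1) by (simp add: inj_on_def)
  then show "inj_on (f(m := j)) {..<Suc m}" unfolding lessThan_Suc inj_on_insert using e assms(2) by simp
qed

context kmeans_run
begin

lemma gather:
  assumes st: "ivar s ''lo'' = lo" "ivar s ''hi'' = hi" "lo \<le> hi" "hi \<le> n"
  shows "wp d M gather (\<lambda>s' \<tau>. inj_on (iarr s' ''C'') {..<ivar s' ''nc''}
    \<and> iarr s' ''C'' ` {..<ivar s' ''nc''} = {x\<in>{lo..<hi}. 0 < iarr s ''A'' x} \<and> ivar s' ''nc'' \<le> hi - lo
    \<and> iarr s' ''A'' = (\<lambda>x. if lo \<le> x \<and> x < hi then 0 else iarr s ''A'' x)
    \<and> \<tau> \<le> 40 * (hi - lo) + 20) s"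
  unfolding gather_def
proof (intro wp_Seq wp_ISet, goal_cases)
  case 2
  show ?case
  proof (rule wp_For_const[where a = lo and b = hi and \<beta> = 40 and Inv = "\<lambda>j s'.
      inj_on (iarr s' ''C'') {..<ivar s' ''nc''}
    \<and> iarr s' ''C'' ` {..<ivar s' ''nc''} = {x\<in>{lo..<j}. 0 < iarr s ''A'' x} \<and> ivar s' ''nc'' \<le> j - lo
    \<and> iarr s' ''A'' = (\<lambda>x. if lo \<le> x \<and> x < j then 0 else iarr s ''A'' x)"], goal_cases)
    case (9 j s')
    note fr = frameD[OF 9(4), simplified]
    let ?C = "iarr s' ''C''" and ?nc = "ivar s' ''nc''"
    have ncM: "Suc ?nc \<le> M"
    proof -
      have "Suc ?nc \<le> n" using 9(1,2,5) st by linarith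
      then show ?thesis using M_ge(1) by linarith
    qed
    show ?case
    proof (rule wp_Cond, goal_cases)
      case 2
      then have Aj: "0 < iarr s ''A'' j" using 9 by simp
      have "j \<notin> ?C ` {..<?nc}" using 9(5) by simp
      note inj = extend_enum(1)[OF conjunct1[OF 9(5)] this] and im = extend_enum(2)[OF conjunct1[OF 9(5)] this]
      have "insert j (?C ` {..<?nc}) = {x\<in>{lo..<Suc j}. 0 < iarr s ''A'' x}"
        using 9(1,5) Aj by (auto simp: less_Suc_eq)
      with im have im: "(?C(?nc := j)) ` {..<Suc ?nc} = {x\<in>{lo..<Suc j}. 0 < iarr s ''A'' x}" by simp
      have A: "(iarr s' ''A'')(j := 0) = (\<lambda>x. if lo \<le> x \<and> x < Suc j then 0 else iarr s ''A'' x)"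
        unfolding 9(5)[THEN conjunct2, THEN conjunct2, THEN conjunct2] using 9(1) by (intro ext) simp
      have "?nc < Suc j - lo" using 9(1,5) by linarith
      then show ?case
        by (intro wp_intros) (use inj im A ncM 9(3) in simp_all)
    next
      case 3
      then have Aj: "iarr s ''A'' j = 0" using 9 by simp
      then have "{x\<in>{lo..<j}. 0 < iarr s ''A'' x} = {x\<in>{lo..<Suc j}. 0 < iarr s ''A'' x}"
        by (auto simp: less_Suc_eq)
      moreover have "(\<lambda>x. if lo \<le> x \<and> x < j then 0 else iarr s ''A'' x) = (\<lambda>x. if lo \<le> x \<and> x < Suc j then 0 else iarr s ''A'' x)"
        using Aj by (intro ext) (auto simp: less_Suc_eq)
      moreover have "j - lo \<le> Suc j - lo" by simp
      ultimately show ?case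
        by (intro wp_Skip) (use 9(5) in simp)
    qed simp
  qed (use st in auto)
qed auto

end

context block_run
begin

lemma saving_0: "saving w d q x c 0 = 0"
proof -
  have "0 \<le> q * d x c" using q_gt1 by simp
  then show ?thesis by (simp add: saving_def)
qed

lemma clear_D:
  assumes st: "ivar s ''lo'' = lo" "ivar s ''hi'' = hi" "ivar s ''nc'' = nc"
  shows "wp d M clear_D (\<lambda>s' \<tau>. gains lo hi q C nc (rarr s' ''D'') (rarr s' ''G'') \<and> \<tau> \<le> 40 * (hi - lo) + 20) s"
  unfolding clear_D_def
proof (rule wp_Seq, rule wp_For_const[where a = 0 and b = nc and \<beta> = 20 and Inv = "\<lambda>j s'.
    \<forall>i<j. rarr s' ''G'' i = 0"], goal_cases)
  case (9 j s')
  then show ?case by (intro wp_intros) (auto simp: less_Suc_eq)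
next
  case (10 s1 \<tau>1)
  note fr = frameD[OF 10(1), simplified]
  show ?case
  proof (rule wp_For_const[where a = lo and b = hi and \<beta> = 20 and Inv = "\<lambda>j s'.
    \<forall>i\<in>{lo..<j}. rarr s' ''D'' i = 0"], goal_cases)
    case (9 j s')
    then show ?case by (intro wp_intros) (auto simp: less_Suc_eq)
  next
    case (10 s2 \<tau>2)
    note fr2 = frameD[OF 10(1), simplified]
    have G: "\<forall>i<nc. rarr s2 ''G'' i = 0" using \<open>\<forall>i<nc. rarr s1 ''G'' i = 0\<close> by (simp add: fr2)
    have "gains lo hi q C nc (rarr s2 ''D'') (rarr s2 ''G'')"
      unfolding gains_def using G 10(3) by (simp add: saving_0)
    then show ?case using 10(4) \<open>\<tau>1 \<le> _\<close> nc by simp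
  qed (use st lohi in \<open>auto simp: fr\<close>)
qed (use st in auto)

lemma first_center:
  assumes st: "ivar s ''lo'' = lo" "ivar s ''hi'' = hi" "ivar s ''nc'' = nc" "rvar s ''q'' = q" "iarr s ''C'' = C"
    "\<And>x. x < n \<Longrightarrow> rarr s ''w'' x = w x"
    and g: "gains lo hi q C nc (rarr s ''D'') (rarr s ''G'')"
  shows "wp d M first_center (\<lambda>s' \<tau>. gains lo hi q C nc (rarr s' ''D'') (rarr s' ''G'')
     \<and> (\<forall>x\<in>T. rarr s' ''D'' x = d x lo) \<and> rvar s' ''dmx'' = (\<Sum>x\<in>T. d x lo)
     \<and> iarr s' ''A'' = (iarr s ''A'')(lo := 1)
     \<and> \<tau> \<le> (hi - lo) * (100 * nc + 50) + 20) s"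
  unfolding first_center_def
proof (intro wp_Seq wp_RSet, goal_cases)
  case 2
  show ?case
  proof (rule wp_For_const[where a = lo and b = hi and \<beta> = "100 * nc + 50" and Inv = "\<lambda>j s'.
    gains lo hi q C nc (rarr s' ''D'') (rarr s' ''G'')
     \<and> (\<forall>x\<in>{lo..<j}. rarr s' ''D'' x = d x lo) \<and> rvar s' ''dmx'' = (\<Sum>x\<in>{lo..<j}. d x lo)"], goal_cases)
    case (9 j s')
    note fr = frameD[OF 9(4), simplified]
    have st': "ivar s' ''lo'' = lo" "ivar s' ''nc'' = nc" "rvar s' ''q'' = q" "iarr s' ''C'' = C" "rarr s' ''w'' j = w j"
      using st 9(2) lohi by (auto simp: fr)
    show ?case
    proof (intro wp_Seq wp_RSet, goal_cases)
      case 2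
      show ?case
      proof (rule wp_use[OF set_D[where x = j and nc = nc and q = q and v = "d j lo" and C = C
                and D = "rarr s' ''D''" and G = "rarr s' ''G''"]], goal_cases)
        case (9 s2 \<tau>2)
        note fr2 = frameD[OF 9(1), simplified]
        show ?case
          by (intro wp_RSet)
            (use 9(2) \<open>lo \<le> j\<close> \<open>ivar s' ''x'' = j\<close> \<open>j < hi\<close> \<open>gains _ _ _ _ _ _ _ \<and> _\<close> st'
              gains_upd[of lo hi q C nc "rarr s' ''D''" "rarr s' ''G''" j "d j lo"]
             in \<open>auto simp: fr2 less_Suc_eq\<close>)
      qed (use st' \<open>ivar s' ''x'' = j\<close> in auto)
    qed auto
  next
    case (10 s' \<tau>)
    note fr = frameD[OF 10(1), simplified]
    show ?case
      by (intro wp_intros) (use 10(3,4) st in \<open>auto simp: fr\<close>)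
  qed (use st lohi g in auto)
qed auto

lemma min_dist:
  assumes st: "ivar s ''lo'' = lo" "ivar s ''hi'' = hi" "ivar s ''nc'' = nc" "iarr s ''C'' = C"
     "rvar s ''dmx'' = dmx" "0 \<le> dmx"
  shows "wp d M min_dist (\<lambda>s' \<tau>. (\<forall>x\<in>T. \<forall>j<nc. d x (C j) \<noteq> 0 \<longrightarrow> rvar s' ''dm'' \<le> d x (C j))
     \<and> (rvar s' ''dm'' = dmx \<or> dl \<le> rvar s' ''dm'') \<and> \<tau> \<le> (hi - lo) * (50 * nc + 50) + 20) s"
  unfolding min_dist_def
proof (intro wp_Seq wp_RSet, goal_cases)
  case 2
  let ?I = "\<lambda>s'. rvar s' ''dm'' = dmx \<or> dl \<le> rvar s' ''dm''"
  show ?case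
  proof (rule wp_For_const[where a = lo and b = hi and \<beta> = "50 * nc + 50" and Inv = "\<lambda>j s'.
    (\<forall>x\<in>{lo..<j}. \<forall>j<nc. d x (C j) \<noteq> 0 \<longrightarrow> rvar s' ''dm'' \<le> d x (C j)) \<and> ?I s'"], goal_cases)
    case (9 x s')
    note fr = frameD[OF 9(4), simplified]
    have st': "ivar s' ''x'' = x" "ivar s' ''nc'' = nc" "iarr s' ''C'' = C"
      using st 9(3) by (auto simp: fr)
    show ?case
    proof (rule wp_For_const[where a = 0 and b = nc and \<beta> = 50 and Inv = "\<lambda>j s1.
       (\<forall>x'\<in>{lo..<x}. \<forall>j<nc. d x' (C j) \<noteq> 0 \<longrightarrow> rvar s1 ''dm'' \<le> d x' (C j)) \<and> ?I s1
       \<and> (\<forall>i<j. d x (C i) \<noteq> 0 \<longrightarrow> rvar s1 ''dm'' \<le> d x (C i))"], goal_cases)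
      case (9 j s1)
      note fr2 = frameD[OF 9(4), simplified]
      have r: "d x (C j) = 0 \<or> dl \<le> d x (C j)"
        using d_range[of x "C j"] C[OF 9(2)] lohi \<open>x < hi\<close> by auto
      have st2: "ivar s1 ''x'' = x" "ivar s1 ''j'' = j" "iarr s1 ''C'' = C" using st' 9(3) by (simp_all add: fr2)
      show ?case
      proof (intro wp_Seq wp_RSet wp_Cond wp_Skip, goal_cases)
        case 4
        then have "0 < d x (C j)" "d x (C j) < rvar s1 ''dm''" by (simp_all add: st2)
        with r 9(5) show ?case by (fastforce simp: st2 less_Suc_eq)
      next
        case 5
        then have "\<not> (0 < d x (C j) \<and> d x (C j) < rvar s1 ''dm'')" by (simp add: st2)
        then have "d x (C j) \<noteq> 0 \<Longrightarrow> rvar s1 ''dm'' \<le> d x (C j)" using nonneg[of x "C j"] by linarith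
        with 9(5) show ?case by (auto simp: st2 less_Suc_eq)
      qed auto
    next
      case (10 s1 \<tau>1)
      note fr2 = frameD[OF 10(1), simplified]
      show ?case using 10(3,4) by (auto simp: fr2 less_Suc_eq)
    qed (use st' 9(5) in auto)
  qed (use st lohi in auto)
qed auto

lemma num_rounds:
  assumes st: "ivar s ''k'' = k" "ivar s ''lev'' = l" "rvar s ''dm'' = dm" "rvar s ''dmx'' = dmx"
    and dm: "0 \<le> dm" "dmx \<le> 2 ^ Y * dm"
  shows "wp d M num_rounds (\<lambda>s' \<tau>. \<exists>m\<le>Y. dmx \<le> 2 ^ m * dm \<and> ivar s' ''g'' = k * (2 * m + l) \<and> \<tau> \<le> 30 * Y + 40) s"
  unfolding num_rounds_def
proof (intro wp_Seq wp_RSet wp_ISet, goal_cases)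
  case 3
  show ?case
  proof (rule wp_While[where m = "\<lambda>s'. Y - ivar s' ''q2''" and Inv = "\<lambda>s' \<tau>. ivar s' ''q2'' \<le> Y \<and>
      rvar s' ''v'' = 2 ^ ivar s' ''q2'' * dm \<and> \<tau> \<le> 30 * ivar s' ''q2''"], goal_cases)
    case (2 s' \<tau>)
    note fr = frameD[OF 2(2), simplified]
    have "rvar s' ''dmx'' = dmx" using st by (simp add: fr)
    then have "2 ^ ivar s' ''q2'' * dm < 2 ^ Y * dm" using 2(1,3) dm by simp
    then have "ivar s' ''q2'' \<noteq> Y" by auto
    then have lt: "ivar s' ''q2'' < Y" using 2(1) by simp
    then have "Suc (ivar s' ''q2'') \<le> M" using M_ge(2) by linarith
    then show ?case
      by (intro wp_intros) (use 2(1) lt in auto)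
  next
    case (4 s' \<tau>)
    note fr = frameD[OF 4(2), simplified]
    have st': "ivar s' ''k'' = k" "ivar s' ''lev'' = l" "rvar s' ''dmx'' = dmx" using st by (simp_all add: fr)
    have b: "2 * ivar s' ''q2'' + l \<le> 4 * Y" using 4(1) l Y1 by linarith
    then have "k * (2 * ivar s' ''q2'' + l) \<le> n * (4 * Y)" using kn by (rule mult_le_mono[rotated])
    then have "k * (2 * ivar s' ''q2'' + l) \<le> M" by (simp add: M)
    moreover have "2 * ivar s' ''q2'' + l \<le> M" using b M_ge(2) by linarith
    moreover have "2 \<le> M" using M_ge(3) by linarith
    ultimately show ?case
      by (intro wp_ISet) (use 4(1,3) st' in \<open>auto intro!: exI[of _ "ivar s' ''q2''"]\<close>)
  qed (use st in auto)
qed (use st in auto)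

end

context block_run
begin

text \<open>The rounds describe the new distances only inside the block, so
  \<open>heavy_picks\<close> must not depend on the others.\<close>

lemma heavy_picks_cong:
  assumes hp: "heavy_picks i D" and eq: "\<And>x. x \<in> T \<Longrightarrow> D' x = D x"
  shows "heavy_picks i D'"
proof (cases "\<forall>x\<in>T. D x = 0")
  case True
  then show ?thesis using eq by (simp add: heavy_picks_def)
next
  case False
  with hp obtain H where "H \<subseteq> T" "card H = i" "\<forall>h\<in>H. D h = 0" "\<forall>h\<in>H. \<forall>x\<in>T. 0 < D x \<longrightarrow> w x \<le> w h"
    unfolding heavy_picks_def by blast
  then show ?thesis unfolding heavy_picks_def using eq
    by (intro disjI1 exI[of _ H]) (auto simp: subset_eq)
qed

text \<open>The program does not know the competitor, so one execution is compared with every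
  \<open>P\<close> at once. The size bound adds the first point, the \<open>k\<close> heavy picks
  and the gain rounds.\<close>

lemma choose_centers:
  assumes st: "ivar s ''lo'' = lo" "ivar s ''hi'' = hi" "ivar s ''nc'' = nc" "ivar s ''k'' = k" "ivar s ''lev'' = l"
    "rvar s ''q'' = q" "iarr s ''C'' = C" "\<And>x. x < n \<Longrightarrow> rarr s ''w'' x = w x"
    and empty: "\<And>x. x \<in> T \<Longrightarrow> iarr s ''A'' x = 0"
  shows "wp d M choose_centers (\<lambda>s' \<tau>. (\<forall>x. x \<notin> T \<longrightarrow> iarr s' ''A'' x = iarr s ''A'' x)
     \<and> alive s' \<noteq> {} \<and> card (alive s') \<le> 1 + k + k * (2 * Y + l)
     \<and> (\<forall>P \<subseteq> C ` {..<nc}. P \<noteq> {} \<longrightarrow> card P \<le> k \<longrightarrow>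
          (\<Sum>x\<in>T. w x * (dist_to_set d x (alive s'))\<^sup>2) \<le> exp (4 / real l) * (\<Sum>x\<in>T. w x * (dist_to_set d x P)\<^sup>2))
     \<and> \<tau> \<le> (hi - lo) * (1000 * k * Y + 1400 * nc * Y\<^sup>2)) s"
  unfolding choose_centers_def
proof (rule wp_Seq, rule wp_use[OF clear_D], goal_cases)
  case (4 s1 \<tau>1)
  note fr1 = frameD[OF 4(1), simplified]
  note p1 = 4(2)
  show ?case
  proof (rule wp_Seq, rule wp_use[OF first_center], goal_cases)
    case (8 s2 \<tau>2)
    note fr2 = frameD[OF 8(1), simplified]
    note p2 = 8(2)
    define dmx where "dmx = (\<Sum>x\<in>T. d x lo)"
    have dmx0: "0 \<le> dmx" by (simp add: dmx_def sum_nonneg)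
    show ?case
    proof (rule wp_Seq, rule wp_use[OF min_dist[where dmx = dmx]], goal_cases)
      case (7 s3 \<tau>3)
      note fr3 = frameD[OF 7(1), simplified]
      note p3 = 7(2)
      define dm where "dm = rvar s3 ''dm''"
      have dm0: "0 \<le> dm" using p3 dmx0 dl0 by (auto simp: dm_def)
      \<comment> \<open>If \<open>dm\<close> differs from \<open>dmx\<close>, it is at least
        \<open>dl\<close>, and the sum \<open>dmx\<close> is at most \<open>2 ^ Y * dl\<close> by
        the factor \<open>n\<close> contained in \<open>dY\<close>.\<close>
      have dmY: "dmx \<le> 2 ^ Y * dm"
      proof (cases "dm = dmx")
        case True
        then show ?thesis using mult_right_mono[of 1 "2 ^ Y" dmx] dmx0 by simp
      next
        case False
        then have "dl \<le> dm" using p3 by (simp add: dm_def)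
        have "real n * dmx = (\<Sum>x\<in>T. real n * d x lo)" by (simp add: dmx_def sum_distrib_left)
        also have "\<dots> \<le> (\<Sum>x\<in>T. 2 ^ Y * dl)" using lohi by (intro sum_mono dY) auto
        also have "\<dots> \<le> real n * (2 ^ Y * dl)" using lohi dl0 by (auto intro!: mult_right_mono)
        finally have "dmx \<le> 2 ^ Y * dl" using n1 by simp
        also have "\<dots> \<le> 2 ^ Y * dm" using \<open>dl \<le> dm\<close> by simp
        finally show ?thesis .
      qed
      show ?case
      proof (rule wp_Seq, rule wp_use[OF num_rounds[where dm = dm and dmx = dmx]], goal_cases)
        case (7 s4 \<tau>4)
        note fr4 = frameD[OF 7(1), simplified]
        from 7(2) obtain m where m: "m \<le> Y" "dmx \<le> 2 ^ m * dm" "ivar s4 ''g'' = k * (2 * m + l)" "\<tau>4 \<le> 30 * Y + 40"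
          by blast
        have A4: "iarr s4 ''A'' = (iarr s ''A'')(lo := 1)" using p2 by (simp add: fr4 fr3 fr1)
        have D4: "\<And>x. x \<in> T \<Longrightarrow> rarr s4 ''D'' x = d x lo" using p2 by (simp add: fr4 fr3)
        have loT: "lo \<in> T" using lohi by simp
        have bs: "blk_state s4" unfolding blk_state_def
          using st p2 D4 loT by (auto simp: fr4 fr3 fr2 fr1 A4 intro!: bexI[of _ lo])
        have al4: "alive s4 = {lo}" using empty lohi by (auto simp: alive_def A4)
        show ?case
        proof (rule wp_Seq, rule wp_use[OF rounds[where \<Phi> = "\<lambda>i D. heavy_picks i D \<and> (\<forall>x\<in>T. D x \<le> dmx)" and r = k and
                Pick = "\<lambda>c D. \<forall>x\<in>T. 0 < D x \<longrightarrow> 0 < D c \<and> w x \<le> w c"]], goal_cases)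
          case (7 s')
          then show ?case by (rule heavy_pick)
        next
          case (8 i c D D')
          have "heavy_picks (Suc i) (relax d q c D)"
            using 8 TN by (intro heavy_picks_Suc) auto
          then have "heavy_picks (Suc i) D'" using 8(5) by (rule heavy_picks_cong)
          moreover have "D' x \<le> D x" if "x \<in> T" for x
            using 8(5)[OF that] d_le_qd[of x c] by (simp add: relax_def)
          ultimately show ?case using 8(1) by (meson order_trans)
        next
          case 10
          have "d x lo \<le> dmx" if "x \<in> T" for x unfolding dmx_def using that by (intro member_le_sum) auto
          then show ?case using heavy_picks_0 D4 by simp
        next
          case (11 s5 \<tau>5)
          have fr5: "x \<noteq> ''i'' \<Longrightarrow> x \<noteq> ''c'' \<Longrightarrow> x \<noteq> ''x'' \<Longrightarrow> x \<noteq> ''j'' \<Longrightarrow> ivar s5 x = ivar s4 x" for x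
            using frameD(1)[OF 11(1), of x] by simp
          from 11(2) have p5: "blk_state s5" "heavy_picks k (rarr s5 ''D'')" "\<forall>x\<in>T. rarr s5 ''D'' x \<le> dmx"
            "card (alive s5) \<le> card (alive s4) + k" "alive s4 \<subseteq> alive s5"
            "\<forall>x. x \<notin> T \<longrightarrow> iarr s5 ''A'' x = iarr s4 ''A'' x"
            "\<tau>5 + (100 * nc + 50) * total_pot (rarr s5 ''D'') \<le>
               k * (100 * (hi - lo) + 100) + (100 * nc + 50) * total_pot (rarr s4 ''D'') + 10"
            by blast+
          \<comment> \<open>The cost after the heavy picks is the starting value of the contraction;
            the exponent \<open>t\<close> below counts gain rounds only.\<close>
          define F where "F = (\<Sum>x\<in>T. w x * (rarr s5 ''D'' x)\<^sup>2)"
          define cst where "cst P = (\<Sum>x\<in>T. w x * (dist_to_set d x P)\<^sup>2)" for P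
          have cst0: "0 \<le> cst P" for P unfolding cst_def by (intro sum_nonneg mult_nonneg_nonneg wT) auto
          show ?case
          proof (rule wp_use[OF rounds[where r = "k * (2 * m + l)" and
                \<Phi> = "\<lambda>t D. \<forall>P \<subseteq> C ` {..<nc}. P \<noteq> {} \<longrightarrow> card P \<le> k \<longrightarrow>
                  (\<Sum>x\<in>T. w x * (D x)\<^sup>2) \<le> q\<^sup>2 * cst P + (1 - 1 / real k) ^ t * F" and
                Pick = "\<lambda>c D. \<forall>p\<in>C ` {..<nc}. (\<Sum>x\<in>T. saving w d q x p (D x)) \<le> (\<Sum>x\<in>T. saving w d q x c (D x))"]],
              goal_cases)
            case (7 s')
            show ?case by (rule wp_use[OF gain_pick[OF 7]]) (use C in auto)
          next
            case (8 t c D D')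
            show ?case
            proof (intro allI impI)
              fix P assume P: "P \<subseteq> C ` {..<nc}" "P \<noteq> {}" "card P \<le> k"
              have finP: "finite P" using P(1) finite_surj by blast
              have "(\<Sum>x\<in>T. w x * (D' x)\<^sup>2) = (\<Sum>x\<in>T. w x * (relax d q c D x)\<^sup>2)"
                using 8(5) by (intro sum.cong) simp_all
              also have "\<dots> \<le> q\<^sup>2 * cst P + (1 - 1 / real k) * (1 - 1 / real k) ^ t * F"
                unfolding cst_def
              proof (rule greedy_step[OF finP P(2,3) 8(4)])
                show "(\<Sum>x\<in>T. saving w d q x p (D x)) \<le> (\<Sum>x\<in>T. saving w d q x c (D x))" if "p \<in> P" for p
                  using 8(3) P(1) that by blast
                show "(\<Sum>x\<in>T. w x * (D x)\<^sup>2) \<le> q\<^sup>2 * (\<Sum>x\<in>T. w x * (dist_to_set d x P)\<^sup>2) + (1 - 1 / real k) ^ t * F"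
                  using 8(1)[rule_format, OF P] unfolding cst_def .
              qed
              finally show "(\<Sum>x\<in>T. w x * (D' x)\<^sup>2) \<le> q\<^sup>2 * cst P + (1 - 1 / real k) ^ Suc t * F" by simp
            qed
          next
            case 9
            then show ?case by (rule p5(1))
          next
            case 10
            show ?case using cst0 unfolding F_def by simp
          next
            case (11 s6 \<tau>6)
            from 11(2) have p6: "blk_state s6" "card (alive s6) \<le> card (alive s5) + k * (2 * m + l)"
              "alive s5 \<subseteq> alive s6" "\<forall>x. x \<notin> T \<longrightarrow> iarr s6 ''A'' x = iarr s5 ''A'' x"
              "\<tau>6 + (100 * nc + 50) * total_pot (rarr s6 ''D'') \<le>
               k * (2 * m + l) * (100 * (hi - lo) + 100) + (100 * nc + 50) * total_pot (rarr s5 ''D'') + 10"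
              and f6: "\<And>P. P \<subseteq> C ` {..<nc} \<Longrightarrow> P \<noteq> {} \<Longrightarrow> card P \<le> k \<Longrightarrow>
                  (\<Sum>x\<in>T. w x * (rarr s6 ''D'' x)\<^sup>2) \<le> q\<^sup>2 * cst P + (1 - 1 / real k) ^ (k * (2 * m + l)) * F"
              by blast+
            have cov5: "\<And>x. x \<in> T \<Longrightarrow> \<exists>y\<in>T. rarr s5 ''D'' x = d x y"
              and cov6: "\<And>x. x \<in> T \<Longrightarrow> \<exists>y\<in>alive s6. rarr s6 ''D'' x = d x y"
              using p5(1) p6(1) unfolding blk_state_def alive_def by blast+
            have "lo \<in> alive s6" using p5(5) p6(3) al4 by auto
            moreover have "card (alive s6) \<le> 1 + k + k * (2 * Y + l)"
            proof -
              have "k * (2 * m + l) \<le> k * (2 * Y + l)" using m by (intro mult_le_mono2) auto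
              moreover have "card (alive s4) = 1" by (simp add: al4)
              ultimately show ?thesis using p5(4) p6(2) by linarith
            qed
            moreover have "(\<Sum>x\<in>T. w x * (dist_to_set d x (alive s6))\<^sup>2) \<le> exp (4 / real l) * cst P"
              if P: "P \<subseteq> C ` {..<nc}" "P \<noteq> {}" "card P \<le> k" for P
            proof -
              have finP: "finite P" using P(1) finite_surj by blast
              have fina: "finite (alive s6)" by (simp add: alive_def)
              have "(\<Sum>x\<in>T. w x * (dist_to_set d x (alive s6))\<^sup>2) \<le> (\<Sum>x\<in>T. w x * (rarr s6 ''D'' x)\<^sup>2)"
              proof (intro sum_mono mult_left_mono power_mono)
                fix x assume x: "x \<in> T"
                obtain y where y: "y \<in> alive s6" "rarr s6 ''D'' x = d x y" using cov6[OF x] by blast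
                then show "dist_to_set d x (alive s6) \<le> rarr s6 ''D'' x" using dist_to_set_le[OF fina] by metis
                show "0 \<le> dist_to_set d x (alive s6)" using y fina by (intro dist_nonneg) auto
              qed (auto simp: wT)
              also have "\<dots> \<le> q\<^sup>2 * cst P + (1 - 1 / real k) ^ (k * (2 * m + l)) * F" by (rule f6[OF P])
              finally have fin: "(\<Sum>x\<in>T. w x * (dist_to_set d x (alive s6))\<^sup>2) \<le> \<dots>" .
              have "F \<le> 4 ^ m * cst P" unfolding F_def cst_def
              proof (rule greedy_start[OF _ finP P(2,3)])
                show "heavy_picks k (rarr s5 ''D'')" by (rule p5(2))
                show "0 \<le> rarr s5 ''D'' x" "rarr s5 ''D'' x \<le> dmx" if "x \<in> T" for x
                  using cov5[OF that] p5(3) that by auto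
                show "dmx \<le> 2 ^ m * dm" "0 \<le> dm" by fact+
                fix x p assume x: "x \<in> T - P" "p \<in> P"
                then obtain j where j: "j < nc" "p = C j" using P by auto
                have "p < n" "x < n" using C[OF j(1)] j lohi x TN by auto
                then have "d x p \<noteq> 0" using x zero by auto
                then show "dm \<le> d x p" using p3 j x by (simp add: dm_def)
              qed
              then show ?thesis using greedy_result[OF cst0 _ k1 l(1) q fin] by blast
            qed
            moreover have "\<forall>x. x \<notin> T \<longrightarrow> iarr s6 ''A'' x = iarr s ''A'' x"
              using p5(6) p6(4) loT by (auto simp: A4)
            moreover have "\<tau>1 + (\<tau>2 + (\<tau>3 + (\<tau>4 + (\<tau>5 + \<tau>6)))) \<le> (hi - lo) * (1000 * k * Y + 1400 * nc * Y\<^sup>2)"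
            proof -
              define h where "h = hi - lo"
              have h: "1 \<le> h" using lohi by (simp add: h_def)
              define tp where "tp = total_pot (rarr s4 ''D'')"
              have "tp \<le> h * (1 + Y * (l + 1))" unfolding tp_def h_def
                using D4 loT by (intro total_pot_bound) auto
              also have "\<dots> \<le> h * (4 * Y\<^sup>2)"
              proof (rule mult_le_mono2)
                have "Y * (l + 1) \<le> Y * (3 * Y)" using l Y1 by (intro mult_le_mono2) linarith
                moreover have "1 \<le> Y\<^sup>2" using Y1 by simp
                ultimately show "1 + Y * (l + 1) \<le> 4 * Y\<^sup>2" by (simp add: power2_eq_square)
              qed
              finally have tp: "tp \<le> 4 * (h * Y\<^sup>2)" by simp
              have ncp: "(100 * nc + 50) * tp \<le> (150 * nc) * (4 * (h * Y\<^sup>2))"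
                using nc tp by (intro mult_le_mono) auto
              define r where "r = k + k * (2 * m + l)"
              have rb: "r \<le> 5 * (k * Y)"
              proof -
                have "1 + (2 * m + l) \<le> 5 * Y" using m l Y1 by linarith
                from mult_le_mono2[OF this, of k] show ?thesis by (simp add: r_def algebra_simps)
              qed
              have "r * (100 * h + 100) \<le> 5 * (k * Y) * (200 * h)"
                using rb h by (intro mult_le_mono) auto
              moreover have "\<tau>5 + \<tau>6 \<le> r * (100 * h + 100) + (100 * nc + 50) * tp + 20"
              proof -
                have "r * (100 * h + 100) = k * (100 * h + 100) + k * (2 * m + l) * (100 * h + 100)"
                  by (simp add: r_def add_mult_distrib)
                then show ?thesis using p5(7) p6(5) unfolding h_def[symmetric] tp_def[symmetric] by linarith
              qed
              ultimately have "\<tau>5 + \<tau>6 \<le> 1000 * (h * (k * Y)) + 600 * (h * nc * Y\<^sup>2) + 20"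
                using ncp by (simp add: algebra_simps)
              moreover have "\<tau>1 \<le> 40 * h + 20" "\<tau>2 \<le> h * (100 * nc + 50) + 20" "\<tau>3 \<le> h * (50 * nc + 50) + 20"
                "\<tau>4 \<le> 30 * Y + 40" using p1 p2 p3 m by (auto simp: h_def)
              moreover have "h * nc \<le> h * nc * Y\<^sup>2" "h \<le> h * nc * Y\<^sup>2" "1 \<le> h * nc * Y\<^sup>2" "Y \<le> h * nc * Y\<^sup>2"
              proof -
                have n: "1 \<le> nc * Y\<^sup>2" "1 \<le> h * nc" using nc Y1 h by simp_all
                show "h * nc \<le> h * nc * Y\<^sup>2" using Y1 by simp
                show "h \<le> h * nc * Y\<^sup>2" using mult_le_mono2[OF n(1), of h] by (simp add: mult.assoc)
                then show "1 \<le> h * nc * Y\<^sup>2" using h by linarith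
                have "Y \<le> Y\<^sup>2" using Y1 by (simp add: power2_eq_square)
                moreover have "1 * Y\<^sup>2 \<le> h * nc * Y\<^sup>2" using n(2) by (rule mult_le_mono1)
                ultimately show "Y \<le> h * nc * Y\<^sup>2" by linarith
              qed
              moreover have "h * (100 * nc + 50) = 100 * (h * nc) + 50 * h" "h * (50 * nc + 50) = 50 * (h * nc) + 50 * h"
                by (simp_all add: algebra_simps)
              ultimately have "\<tau>1 + (\<tau>2 + (\<tau>3 + (\<tau>4 + (\<tau>5 + \<tau>6)))) \<le> 1000 * (h * (k * Y)) + 1400 * (h * nc * Y\<^sup>2)"
                by linarith
              also have "\<dots> = h * (1000 * k * Y + 1400 * nc * Y\<^sup>2)" by (simp add: algebra_simps)
              finally show ?thesis by (simp add: h_def)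
            qed
            ultimately show ?case unfolding cst_def by blast
          qed (use m(3) in \<open>auto simp: fr5\<close>)
        qed (use bs st in \<open>auto simp: fr4 fr3 fr2 fr1\<close>)
      qed (use st p2 p3 dm0 dmY in \<open>auto simp: fr3 fr2 fr1 dm_def dmx_def\<close>)
    qed (use st p2 dmx0 in \<open>auto simp: fr2 fr1 dmx_def\<close>)
  qed (use st p1 in \<open>auto simp: fr1\<close>)
qed (use st in auto)

end

context kmeans_run
begin

lemma reduce_block:
  fixes l lo hi :: nat
  assumes st: "ivar s ''lo'' = lo" "ivar s ''hi'' = hi" "ivar s ''k'' = k" "ivar s ''lev'' = l"
    "rvar s ''q'' = 1 + 1 / real l" "\<And>x. x < n \<Longrightarrow> rarr s ''w'' x = w x"
    and lohi: "lo < hi" "hi \<le> n" and l: "1 \<le> l" "l \<le> Y + 1"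
  defines "alive \<equiv> \<lambda>s. {x\<in>{lo..<hi}. 0 < iarr s ''A'' x}"
  assumes ne: "alive s \<noteq> {}"
  shows "wp d M reduce_block (\<lambda>s' \<tau>. (\<forall>x. x \<notin> {lo..<hi} \<longrightarrow> iarr s' ''A'' x = iarr s ''A'' x)
     \<and> alive s' \<noteq> {} \<and> card (alive s') \<le> 1 + k + k * (2 * Y + l)
     \<and> (\<forall>P \<subseteq> alive s. P \<noteq> {} \<longrightarrow> card P \<le> k \<longrightarrow>
          (\<Sum>x=lo..<hi. w x * (dist_to_set d x (alive s'))\<^sup>2) \<le> exp (4 / real l) * (\<Sum>x=lo..<hi. w x * (dist_to_set d x P)\<^sup>2))
     \<and> \<tau> \<le> (hi - lo) * (1000 * k * Y + 1500 * card (alive s) * Y\<^sup>2)) s"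
  unfolding reduce_block_def
proof (rule wp_Seq, rule wp_use[OF gather[OF st(1,2)]], goal_cases)
  case (3 s1 \<tau>1)
  note fr = frameD[OF 3(1), simplified]
  define nc where "nc = ivar s1 ''nc''"
  define C where "C = iarr s1 ''C''"
  have C: "inj_on C {..<nc}" "C ` {..<nc} = alive s" "nc \<le> hi - lo"
    using 3(2) by (auto simp: nc_def C_def alive_def)
  have nc: "card (alive s) = nc" using C card_image by fastforce
  have fina: "finite (alive s)" by (simp add: alive_def)
  have nc1: "1 \<le> nc" using nc ne fina by (metis Suc_leI card_gt_0_iff One_nat_def)
  \<comment> \<open>The candidate list and its length exist only after \<open>gather\<close>, so the
    locale is entered here.\<close>
  interpret B: block_run n d w k Y M dl lo hi nc l C "1 + 1 / real l"
    using lohi l C(3) nc1 C(2) by unfold_locales (auto simp: alive_def)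
  have al: "B.alive s' = alive s'" for s' by (simp add: B.alive_def alive_def)
  show ?case
  proof (rule wp_use[OF B.choose_centers], goal_cases)
    case (10 s2 \<tau>2)
    define h where "h = hi - lo"
    have h: "\<tau>1 \<le> 60 * h" "\<tau>2 \<le> h * (1000 * k * Y + 1400 * nc * Y\<^sup>2)"
      using 3(2) 10(2) lohi by (auto simp: h_def)
    have "h \<le> h * (nc * Y\<^sup>2)" using nc1 Y1 by simp
    moreover have "h * (1000 * k * Y + 1400 * nc * Y\<^sup>2) = 1000 * (h * (k * Y)) + 1400 * (h * (nc * Y\<^sup>2))"
      "h * (1000 * k * Y + 1500 * nc * Y\<^sup>2) = 1000 * (h * (k * Y)) + 1500 * (h * (nc * Y\<^sup>2))"
      by (simp_all add: algebra_simps)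
    ultimately have "\<tau>1 + \<tau>2 \<le> h * (1000 * k * Y + 1500 * nc * Y\<^sup>2)" using h by linarith
    then have "\<tau>1 + \<tau>2 \<le> (hi - lo) * (1000 * k * Y + 1500 * nc * Y\<^sup>2)" by (simp only: h_def)
    moreover have "\<forall>x. x \<notin> {lo..<hi} \<longrightarrow> iarr s2 ''A'' x = iarr s ''A'' x"
      using conjunct1[OF 10(2)] 3(2) by simp
    ultimately show ?case using conjunct2[OF 10(2)] unfolding al C(2) nc by blast
  qed (use st 3(2) in \<open>auto simp: fr nc_def C_def\<close>)
qed (use lohi in auto)

end

section \<open>The merging tree\<close>

definition level_pass :: com where
  "level_pass = Seq (ISet ''lo'' (INum 0)) (While (ILess (IVar ''lo'') (IVar ''n''))
     (Seq (ISet ''hi'' (IAdd (IVar ''lo'') (IVar ''B'')))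
       (Seq (Cond (ILess (IVar ''n'') (IVar ''hi'')) (ISet ''hi'' (IVar ''n'')) Skip)
         (Seq reduce_block (ISet ''lo'' (IVar ''hi''))))))"

text \<open>\<open>lev\<close> is one more than the number of doublings that take 1 up to
  \<open>n\<close>. It is at least 1, bounds the number of merge levels, and determines the accuracy
  \<open>q\<close> of each of them.\<close>

definition num_levels :: com where
  "num_levels = Seq (ISet ''lev'' (INum 1)) (Seq (ISet ''B'' (INum 1))
     (While (ILess (IVar ''B'') (IVar ''n''))
        (Seq (ISet ''B'' (IAdd (IVar ''B'') (IVar ''B''))) (ISet ''lev'' (IAdd (IVar ''lev'') (INum 1))))))"

definition merge_tree :: com where
  "merge_tree = Seq num_levels
     (Seq (RSet ''q'' (RDiv (RNat (IAdd (IVar ''lev'') (INum 1))) (RNat (IVar ''lev''))))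
     (Seq (For ''x'' (INum 0) ''n'' (IPut ''A'' (IVar ''x'') (INum 1)))
     (Seq (ISet ''B'' (IVar ''k''))
       (While (ILess (IVar ''B'') (IVar ''n''))
          (Seq (ISet ''B'' (IAdd (IVar ''B'') (IVar ''B''))) level_pass)))))"

lemma level_pass_mods [simp]:
  "ivs level_pass = {''lo'', ''hi'', ''nc'', ''x'', ''j'', ''g'', ''q2'', ''i'', ''c'', ''b''}"
  "rvs level_pass = {''dmx'', ''dm'', ''v''}" "ias level_pass = {''C'', ''A''}"
  "ras level_pass = {''G'', ''D''}"
  by (auto simp: level_pass_def)

lemma num_levels_mods [simp]: "ivs num_levels = {''lev'', ''B''}" "rvs num_levels = {}"
  "ias num_levels = {}" "ras num_levels = {}"
  by (auto simp: num_levels_def)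

lemma merge_tree_mods [simp]:
  "ivs merge_tree = {''lev'', ''B'', ''lo'', ''hi'', ''nc'', ''x'', ''j'', ''g'', ''q2'', ''i'', ''c'', ''b''}"
  "rvs merge_tree = {''q'', ''dmx'', ''dm'', ''v''}" "ias merge_tree = {''C'', ''A''}"
  "ras merge_tree = {''G'', ''D''}"
  by (auto simp: merge_tree_def)

context kmeans_run
begin

definition alv :: "state \<Rightarrow> nat set" where
  "alv s = {x. x < n \<and> 0 < iarr s ''A'' x}"

definition inp :: "state \<Rightarrow> bool" where
  "inp s \<longleftrightarrow> ivar s ''n'' = n \<and> ivar s ''k'' = k \<and> (\<forall>x<n. rarr s ''w'' x = w x)"

definition covered :: "nat \<Rightarrow> nat \<Rightarrow> nat set \<Rightarrow> bool" where
  "covered m B A \<longleftrightarrow> (\<forall>x<n. A \<inter> blk B x \<noteq> {} \<and> card (A \<inter> blk B x) \<le> m)"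

lemma blk_interval:
  assumes "B dvd v" "v < n" "1 \<le> B" "v \<le> x" "x < min (v + B) n"
  shows "blk B x = {v..<min (v + B) n}"
proof -
  obtain m where m: "v = B * m" using assms(1) by blast
  have B: "0 < B" using assms(3) by simp
  have eq: "y div B = m \<longleftrightarrow> v \<le> y \<and> y < v + B" for y
  proof -
    have "y div B = m \<longleftrightarrow> m \<le> y div B \<and> y div B < Suc m" by auto
    also have "\<dots> \<longleftrightarrow> v \<le> y \<and> y < v + B"
      unfolding less_eq_div_iff_mult_less_eq[OF B] div_less_iff_less_mult[OF B] m
      by (simp add: mult.commute add.commute)
    finally show ?thesis .
  qed
  have xm: "x div B = m" unfolding eq using assms(4,5) by simp
  show ?thesis unfolding blk_def xm by (auto simp: eq)
qed

lemma blk_below: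
  assumes "B dvd v \<or> v = n" "x < v" "v \<le> n"
  shows "blk B x \<subseteq> {..<v}"
proof
  fix y assume y: "y \<in> blk B x"
  show "y \<in> {..<v}"
  proof (cases "v = n")
    case True
    then show ?thesis using y by (simp add: blk_def)
  next
    case False
    with assms obtain m where m: "v = B * m" by blast
    then have B: "0 < B" using assms(2) by (cases B) auto
    have "x div B < m" using assms(2) m B by (simp add: div_less_iff_less_mult mult.commute)
    then have "y div B < m" using y by (simp add: blk_def)
    then show ?thesis using m B by (simp add: div_less_iff_less_mult mult.commute)
  qed
qed

lemma level_pass:
  fixes l B m :: nat
  assumes st: "inp s" "ivar s ''B'' = 2 * B" "ivar s ''lev'' = l" "rvar s ''q'' = 1 + 1 / real l"
    and B: "1 \<le> B" "B < n" and l: "1 \<le> l" "l \<le> Y + 1"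
    and m: "m = 1 + k + k * (2 * Y + l)"
    and cov: "covered m B (alv s)" and Q: "Q \<subseteq> {..<n}" "Q \<noteq> {}" "card Q \<le> k"
  shows "wp d M level_pass (\<lambda>s' \<tau>. covered m (2 * B) (alv s')
    \<and> block_cost (2 * B) (alv s') {..<n}
       \<le> exp (4 / real l) * (\<Sum>x<n. w x * (2 * dist_to_set d x Q + dist_to_set d x (alv s \<inter> blk B x))\<^sup>2)
    \<and> \<tau> \<le> n * (1000 * k * Y + 3000 * m * Y\<^sup>2 + 50) + 10) s"
proof -
  define f where "f x = w x * (2 * dist_to_set d x Q + dist_to_set d x (alv s \<inter> blk B x))\<^sup>2" for x
  define tb where "tb = 1000 * k * Y + 3000 * m * Y\<^sup>2 + 50"
  \<comment> \<open>Left of \<open>v\<close> all blocks are merged, from \<open>v\<close> on the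
    flags are still those of \<open>s\<close>. As \<open>v\<close> is a block boundary or
    \<open>n\<close>, later merges do not touch finished blocks.\<close>
  define Inv where "Inv s' \<tau> \<longleftrightarrow> (\<exists>v. ivar s' ''lo'' = v \<and> v \<le> n \<and> (2 * B dvd v \<or> v = n) \<and>
     (\<forall>x<v. alv s' \<inter> blk (2 * B) x \<noteq> {} \<and> card (alv s' \<inter> blk (2 * B) x) \<le> m) \<and>
     (\<forall>x\<ge>v. iarr s' ''A'' x = iarr s ''A'' x) \<and>
     block_cost (2 * B) (alv s') {..<v} \<le> exp (4 / real l) * sum f {..<v} \<and> \<tau> \<le> v * tb)" for s' \<tau>
  have Inv_mono: "Inv s' \<tau> \<Longrightarrow> \<tau>' \<le> \<tau> \<Longrightarrow> Inv s' \<tau>'" for s' \<tau> \<tau>'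
    unfolding Inv_def by (meson le_trans)
  show ?thesis
    unfolding level_pass_def
  proof (rule wp_Seq, rule wp_ISet, goal_cases)
    case 2
    show ?case
    proof (rule wp_While[where Inv = Inv and m = "\<lambda>s'. n - ivar s' ''lo''"], goal_cases)
      case 1
      show ?case by (auto simp: Inv_def block_cost_def)
    next
      case (2 s1 \<tau>1)
      note fr = frameD[OF 2(2), simplified]
      from 2(1) obtain v where v: "ivar s1 ''lo'' = v" "v \<le> n" "2 * B dvd v \<or> v = n"
        "\<And>x. x < v \<Longrightarrow> alv s1 \<inter> blk (2 * B) x \<noteq> {} \<and> card (alv s1 \<inter> blk (2 * B) x) \<le> m"
        "\<And>x. v \<le> x \<Longrightarrow> iarr s1 ''A'' x = iarr s ''A'' x"
        "block_cost (2 * B) (alv s1) {..<v} \<le> exp (4 / real l) * sum f {..<v}" "\<tau>1 \<le> v * tb"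
        unfolding Inv_def by blast
      have st1: "inp s1" "ivar s1 ''n'' = n" "ivar s1 ''k'' = k" "ivar s1 ''B'' = 2 * B" "ivar s1 ''lev'' = l"
          "rvar s1 ''q'' = 1 + 1 / real l" "\<And>x. x < n \<Longrightarrow> rarr s1 ''w'' x = w x"
        using st by (auto simp: inp_def fr)
      have vn: "v < n" using 2(3) v(1) st1 by simp
      then have dv: "2 * B dvd v" using v(3) by simp
      define hi where "hi = min (v + 2 * B) n"
      have hi: "v < hi" "hi \<le> n" using vn B by (auto simp: hi_def)
      define T where "T = {v..<hi}"
      have T: "blk (2 * B) x = T" if "x \<in> T" for x
        using blk_interval[OF dv vn, of x] B that by (simp add: T_def hi_def)
      have TN: "T \<subseteq> {..<n}" "T \<noteq> {}" using hi by (auto simp: T_def)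
      have sub: "alv s \<inter> blk B v \<subseteq> alv s \<inter> T" using blk_double[of B v] T[of v] hi by (auto simp: T_def)
      define al where "al s' = {x\<in>{v..<hi}. 0 < iarr s' ''A'' x}" for s' :: state
      have al: "al s' = alv s' \<inter> T" for s' using hi by (auto simp: al_def alv_def T_def)
      have al1: "al s1 = alv s \<inter> T" using v(5) hi by (auto simp: al_def alv_def T_def)
      have ne: "al s1 \<noteq> {}" using cov vn sub al1 by (auto simp: covered_def)
      \<comment> \<open>A merged block is covered by two old blocks, each with at most
        \<open>m\<close> candidates.\<close>
      have card1: "card (al s1) \<le> 2 * m"
      proof -
        have "T \<subseteq> blk B v \<union> blk B (v + B)"
        proof
          fix y assume y: "y \<in> T"
          have Bv: "B dvd v" using dv by (rule dvd_mult_right)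
          show "y \<in> blk B v \<union> blk B (v + B)"
          proof (cases "y < v + B")
            case True
            have "blk B v = {v..<min (v + B) n}" by (rule blk_interval[OF Bv vn B(1)]) (use vn B in auto)
            then show ?thesis using y hi True by (simp add: T_def)
          next
            case False
            then have vB: "v + B < n" using y hi by (simp add: T_def)
            have "B dvd v + B" using Bv by simp
            then have "blk B (v + B) = {v + B..<min (v + B + B) n}"
              by (rule blk_interval[OF _ vB B(1)]) (use vB B in auto)
            then show ?thesis using y False by (simp add: T_def hi_def)
          qed
        qed
        \<comment> \<open>\<open>covered\<close> speaks about points only. An index beyond
          \<open>n\<close> names either the truncated last block or an empty one.\<close>
        moreover have "card (alv s \<inter> blk B x) \<le> m" for x
        proof (cases "x < n")
          case True
          then show ?thesis using cov by (simp add: covered_def)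
        next
          case False
          show ?thesis
          proof (cases "alv s \<inter> blk B x = {}")
            case False
            then obtain y where y: "y < n" "y div B = x div B" by (auto simp: blk_def)
            have "blk B x = blk B y" by (simp add: blk_def y(2))
            then show ?thesis using cov y(1) by (simp add: covered_def)
          qed simp
        qed
        ultimately have "card (al s1) \<le> card ((alv s \<inter> blk B v) \<union> (alv s \<inter> blk B (v + B)))"
          unfolding al1 by (intro card_mono) (auto simp: finite_blk)
        also have "\<dots> \<le> card (alv s \<inter> blk B v) + card (alv s \<inter> blk B (v + B))" by (rule card_Un_le)
        finally show ?thesis using \<open>\<And>x. card (alv s \<inter> blk B x) \<le> m\<close>[of v]
            \<open>\<And>x. card (alv s \<inter> blk B x) \<le> m\<close>[of "v + B"] by linarith
      qed
      have red: "wp d M reduce_block (\<lambda>s' \<tau>. (\<forall>x. x \<notin> {v..<hi} \<longrightarrow> iarr s' ''A'' x = iarr s2 ''A'' x)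
         \<and> al s' \<noteq> {} \<and> card (al s') \<le> m
         \<and> (\<forall>P \<subseteq> al s1. P \<noteq> {} \<longrightarrow> card P \<le> k \<longrightarrow>
              (\<Sum>x=v..<hi. w x * (dist_to_set d x (al s'))\<^sup>2) \<le> exp (4 / real l) * (\<Sum>x=v..<hi. w x * (dist_to_set d x P)\<^sup>2))
         \<and> \<tau> \<le> (hi - v) * (1000 * k * Y + 1500 * card (al s1) * Y\<^sup>2)) s2"
        if s2: "s2 = s1\<lparr>ivar := (ivar s1)(''hi'' := hi)\<rparr>" for s2
      proof -
        have "al s2 = al s1" by (simp add: al_def s2)
        then show ?thesis
          using reduce_block[of s2 v hi l] st1 v(1) hi l ne unfolding m al_def by (simp add: s2)
      qed
      \<comment> \<open>The slack of 20 steps pays for setting \<open>hi\<close>, clipped to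
        \<open>n\<close> or not; \<open>Inv_mono\<close> then reduces it to the actual
        number.\<close>
      have post: "wp d M (Seq reduce_block (ISet ''lo'' (IVar ''hi'')))
         (\<lambda>s3 \<tau>3. Inv s3 (\<tau>1 + (\<tau>3 + 20) + 10) \<and> n - ivar s3 ''lo'' < n - ivar s1 ''lo'') s2"
        if s2: "s2 = s1\<lparr>ivar := (ivar s1)(''hi'' := hi)\<rparr>" for s2
      proof (rule wp_Seq, rule wp_use[OF red[OF s2]], goal_cases)
        case (1 s3 \<tau>3)
        note fr3 = frameD[OF 1(1), simplified]
        from 1(2) have p: "\<And>x. x \<notin> {v..<hi} \<Longrightarrow> iarr s3 ''A'' x = iarr s1 ''A'' x" "al s3 \<noteq> {}" "card (al s3) \<le> m"
          "\<And>P. P \<subseteq> al s1 \<Longrightarrow> P \<noteq> {} \<Longrightarrow> card P \<le> k \<Longrightarrow>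
              (\<Sum>x=v..<hi. w x * (dist_to_set d x (al s3))\<^sup>2) \<le> exp (4 / real l) * (\<Sum>x=v..<hi. w x * (dist_to_set d x P)\<^sup>2)"
          "\<tau>3 \<le> (hi - v) * (1000 * k * Y + 1500 * card (al s1) * Y\<^sup>2)"
          by (simp_all add: s2)
        have h3: "ivar s3 ''hi'' = hi" using s2 by (simp add: fr3)
        define s4 where "s4 = s3\<lparr>ivar := (ivar s3)(''lo'' := hi)\<rparr>"
        have A4: "alv s4 = alv s3" "iarr s4 = iarr s3" by (simp_all add: alv_def s4_def)
        have old: "alv s3 \<inter> blk (2 * B) x = alv s1 \<inter> blk (2 * B) x" if x: "x < v" for x
        proof -
          have "blk (2 * B) x \<subseteq> {..<v}" by (rule blk_below[OF v(3) x v(2)])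
          moreover have "iarr s3 ''A'' y = iarr s1 ''A'' y" if "y < v" for y using that by (intro p(1)) auto
          ultimately show ?thesis by (auto simp: alv_def)
        qed
        have tau: "\<tau>1 + (\<tau>3 + 2 + 20) + 10 \<le> hi * tb"
        proof -
          have "1500 * card (al s1) * Y\<^sup>2 \<le> 3000 * m * Y\<^sup>2" using card1 by (intro mult_le_mono1) linarith
          then have "\<tau>3 \<le> (hi - v) * (1000 * k * Y + 3000 * m * Y\<^sup>2)"
            by (intro order_trans[OF p(5)] mult_le_mono2) linarith
          moreover have "(hi - v) * tb = (hi - v) * (1000 * k * Y + 3000 * m * Y\<^sup>2) + (hi - v) * 50"
            unfolding tb_def by (rule add_mult_distrib2)
          moreover have "1 \<le> hi - v" using hi by simp
          moreover have "hi * tb = v * tb + (hi - v) * tb" using hi by (simp add: add_mult_distrib[symmetric])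
          ultimately show ?thesis using v(7) by linarith
        qed
        have cost: "block_cost (2 * B) (alv s3) {..<hi} \<le> exp (4 / real l) * sum f {..<hi}"
        proof -
          have un: "{..<hi} = {..<v} \<union> T" "{..<v} \<inter> T = {}" using hi by (auto simp: T_def)
          have "block_cost (2 * B) (alv s3) {..<hi} = block_cost (2 * B) (alv s3) {..<v} + block_cost (2 * B) (alv s3) T"
            unfolding block_cost_def un(1) by (rule sum.union_disjoint) (use un in \<open>auto simp: T_def\<close>)
          also have "block_cost (2 * B) (alv s3) {..<v} = block_cost (2 * B) (alv s1) {..<v}"
            unfolding block_cost_def by (intro sum.cong) (auto simp: old)
          also have "block_cost (2 * B) (alv s3) T \<le> exp (4 / real l) * sum f T"
            unfolding f_def
          proof (rule merge_block[OF _ _ TN T _ _ Q])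
            show "alv s \<subseteq> {..<n}" by (auto simp: alv_def)
            show "\<And>x. x < n \<Longrightarrow> alv s \<inter> blk B x \<noteq> {}" using cov by (simp add: covered_def)
            fix P assume "P \<subseteq> alv s \<inter> T" "P \<noteq> {}" "card P \<le> k"
            from p(4)[unfolded al1, OF this]
            show "(\<Sum>x\<in>T. w x * (dist_to_set d x (alv s3 \<inter> T))\<^sup>2) \<le> exp (4 / real l) * (\<Sum>x\<in>T. w x * (dist_to_set d x P)\<^sup>2)"
              unfolding al T_def .
          qed auto
          also have "sum f {..<hi} = sum f {..<v} + sum f T"
            unfolding un(1) by (rule sum.union_disjoint) (use un in \<open>auto simp: T_def\<close>)
          then have "exp (4 / real l) * sum f {..<hi} = exp (4 / real l) * sum f {..<v} + exp (4 / real l) * sum f T"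
            by (simp add: distrib_left)
          ultimately show ?thesis using v(6) by linarith
        qed
        have cov4: "alv s3 \<inter> blk (2 * B) x \<noteq> {} \<and> card (alv s3 \<inter> blk (2 * B) x) \<le> m" if "x < hi" for x
        proof (cases "x < v")
          case True
          then show ?thesis using old v(4) by simp
        next
          case False
          then have "x \<in> T" using that by (simp add: T_def)
          then show ?thesis using T p(2,3) al by simp
        qed
        have "2 * B dvd hi \<or> hi = n" using dv by (auto simp: hi_def min_def)
        moreover have "\<forall>x\<ge>hi. iarr s3 ''A'' x = iarr s ''A'' x" using p(1) v(5) hi by auto
        ultimately have "Inv s4 (\<tau>1 + (\<tau>3 + 2 + 20) + 10)"
          unfolding Inv_def A4 using hi(2) cov4 cost tau by (intro exI[of _ hi]) (auto simp: s4_def)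
        then show ?case
          by (intro wp_ISet) (use hi v(1) h3 in \<open>auto simp: s4_def\<close>)
      qed
      have "v + 2 * B \<le> M" using vn B M_ge(1) by linarith
      moreover have "n \<le> M" using M_ge(1) by linarith
      ultimately show ?case
      proof (rule_tac wp_Seq, rule_tac wp_ISet, goal_cases)
        case 2
        show ?case
        proof (rule wp_Seq, rule wp_Cond, goal_cases)
          case 2
          have "hi = n" using 2 st1 v(1) by (simp add: hi_def)
          then have eq: "(s1\<lparr>ivar := (ivar s1)(''hi'' := n)\<rparr>) = s1\<lparr>ivar := (ivar s1)(''hi'' := hi)\<rparr>" by simp
          show ?case
            by (rule wp_ISet, simp, rule wp_use[OF post]) (use eq st1 v(1) in \<open>auto elim!: Inv_mono\<close>)
        next
          case 3
          have "hi = v + 2 * B" using 3 st1 v(1) by (simp add: hi_def)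
          then show ?case
            by (intro wp_Skip, rule_tac wp_use[OF post]) (use st1 v(1) in \<open>auto elim!: Inv_mono\<close>)
        qed auto
      qed (use st1 v(1) in auto)
    next
      case (4 s1 \<tau>1)
      note fr = frameD[OF 4(2), simplified]
      have "ivar s1 ''n'' = n" using st by (simp add: inp_def fr)
      with 4(1,3) show ?case
        unfolding Inv_def by (auto simp: covered_def f_def tb_def)
    qed auto
  qed auto
qed

lemma num_levels:
  assumes "ivar s ''n'' = n"
  shows "wp d M num_levels (\<lambda>s' \<tau>. 1 \<le> ivar s' ''lev'' \<and> ivar s' ''lev'' \<le> Y + 1
    \<and> n \<le> 2 ^ (ivar s' ''lev'' - 1) \<and> \<tau> \<le> 40 * Y + 20) s"
  unfolding num_levels_def
proof (intro wp_Seq wp_ISet, goal_cases)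
  case 3
  show ?case
  proof (rule wp_While[where m = "\<lambda>s'. Y + 1 - ivar s' ''lev''" and Inv = "\<lambda>s' \<tau>. \<exists>e. ivar s' ''lev'' = Suc e
     \<and> e \<le> Y \<and> ivar s' ''B'' = 2 ^ e \<and> \<tau> \<le> 30 * e"], goal_cases)
    case (2 s' \<tau>)
    note fr = frameD[OF 2(2), simplified]
    from 2(1) obtain e where e: "ivar s' ''lev'' = Suc e" "e \<le> Y" "ivar s' ''B'' = 2 ^ e" "\<tau> \<le> 30 * e" by blast
    have n: "ivar s' ''n'' = n" using assms by (simp add: fr)
    then have lt: "2 ^ e < n" using 2(3) e by simp
    then have "(2::nat) ^ e < 2 ^ Y" using nY by linarith
    then have eY: "e < Y" by simp
    have "2 ^ e + 2 ^ e \<le> M" "Suc (Suc e) \<le> M" using lt eY M_ge(1,2) n1 by linarith+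
    then show ?case
      by (intro wp_intros) (use e eY in auto)
  next
    case (4 s' \<tau>)
    note fr = frameD[OF 4(2), simplified]
    from 4(1) obtain e where e: "ivar s' ''lev'' = Suc e" "e \<le> Y" "ivar s' ''B'' = 2 ^ e" "\<tau> \<le> 30 * e" by blast
    have n: "ivar s' ''n'' = n" using assms by (simp add: fr)
    then show ?case using 4(3) e by auto
  qed auto
qed auto

lemma blk_small:
  assumes "1 \<le> B"
  shows "card (blk B x) \<le> B"
proof -
  have "blk B x \<subseteq> {B * (x div B)..<B * (x div B) + B}"
  proof
    fix y assume "y \<in> blk B x"
    then have "y div B = x div B" by (simp add: blk_def)
    then have "y = B * (x div B) + y mod B" by (metis mult_div_mod_eq)
    moreover have "y mod B < B" using assms by simp
    ultimately show "y \<in> {B * (x div B)..<B * (x div B) + B}" by (metis atLeastLessThan_iff le_add1 nat_add_left_cancel_less)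
  qed
  then have "card (blk B x) \<le> card {B * (x div B)..<B * (x div B) + B}" by (intro card_mono) auto
  then show ?thesis by simp
qed

text \<open>At the start all points are candidates and the cost is 0. Each level adds twice the root
  of the cost of \<open>Q\<close> and multiplies by \<open>exp (2 / l)\<close>; since the number
  \<open>j\<close> of levels is at most \<open>l\<close>, the product of the factors is at most
  \<open>exp 2\<close>, and the additive terms number \<open>j\<close>.\<close>

lemma merge_tree:
  assumes st: "inp s" and Q: "Q \<subseteq> {..<n}" "Q \<noteq> {}" "card Q \<le> k"
  shows "wp d M merge_tree (\<lambda>s' \<tau>. alv s' \<noteq> {} \<and> card (alv s') \<le> 6 * k * Y \<and>
    (\<exists>j. sqrt (\<Sum>x<n. w x * (dist_to_set d x (alv s'))\<^sup>2)
        \<le> 2 * exp 2 * real j * sqrt (\<Sum>x<n. w x * (dist_to_set d x Q)\<^sup>2) \<and> (j = 0 \<or> k * 2 ^ j \<le> 2 * n))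
    \<and> \<tau> \<le> 40000 * n * k * Y ^ 4) s"
  unfolding merge_tree_def
proof (rule wp_Seq, rule wp_use[OF num_levels], goal_cases)
  case 1
  then show ?case using st by (simp add: inp_def)
next
  case (2 s1 \<tau>1)
  note fr1 = frameD[OF 2(1), simplified]
  define l where "l = ivar s1 ''lev''"
  have l: "1 \<le> l" "l \<le> Y + 1" "n \<le> 2 ^ (l - 1)" "\<tau>1 \<le> 40 * Y + 20" using 2(2) by (simp_all add: l_def)
  have lM: "Suc l \<le> M" using l Y1 M_ge(2) by linarith
  define opt where "opt = sqrt (\<Sum>x<n. w x * (dist_to_set d x Q)\<^sup>2)"
  have opt0: "0 \<le> opt" unfolding opt_def by (intro real_sqrt_ge_zero sum_nonneg mult_nonneg_nonneg) (auto simp: w0)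
  define m where "m = 1 + k + k * (2 * Y + l)"
  have mb: "m \<le> 6 * k * Y"
  proof -
    have "k * (2 * Y + l) \<le> k * (4 * Y)" using l Y1 by (intro mult_le_mono2) linarith
    moreover have "k \<le> k * Y" using Y1 by simp
    moreover have "k * (4 * Y) = 4 * (k * Y)" "6 * k * Y = 6 * (k * Y)" by simp_all
    ultimately show ?thesis using k1 unfolding m_def by linarith
  qed
  have km: "k \<le> m" by (simp add: m_def)
  define lb where "lb = n * (1000 * k * Y + 3000 * m * Y\<^sup>2 + 50) + 30"
  show ?case
  proof (rule wp_Seq, rule wp_RSet, goal_cases)
    case 1
    then show ?case using lM by (simp add: l_def)
  next
    case 2
    define s2 where "s2 = s1\<lparr>rvar := (rvar s1)(''q'' := 1 + 1 / real l)\<rparr>"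
    have s2: "s1\<lparr>rvar := (rvar s1)(''q'' := rval d s1 (RDiv (RNat (IAdd (IVar ''lev'') (INum 1))) (RNat (IVar ''lev''))))\<rparr> = s2"
      using l(1) unfolding s2_def l_def by (simp add: field_simps)
    have st2: "inp s2" "ivar s2 ''lev'' = l" "rvar s2 ''q'' = 1 + 1 / real l" "ivar s2 ''n'' = n" "ivar s2 ''k'' = k"
      using st by (auto simp: s2_def inp_def fr1 l_def)
    show ?case unfolding s2
    proof (rule wp_Seq, rule wp_For_const[where a = 0 and b = n and \<beta> = 20 and
          Inv = "\<lambda>j s'. \<forall>x<j. iarr s' ''A'' x = 1"], goal_cases)
      case (9 j s')
      then show ?case by (intro wp_intros) (auto simp: less_Suc_eq)
    next
      case (10 s3 \<tau>3)
      note fr3 = frameD[OF 10(1), simplified]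
      have A3: "alv s3 = {..<n}" using 10(3) by (auto simp: alv_def)
      have st3: "inp s3" "ivar s3 ''lev'' = l" "rvar s3 ''q'' = 1 + 1 / real l" "ivar s3 ''n'' = n" "ivar s3 ''k'' = k"
        using st2 by (simp_all add: inp_def fr3)
      define s4 where "s4 = s3\<lparr>ivar := (ivar s3)(''B'' := k)\<rparr>"
      have st4: "inp s4" "ivar s4 ''lev'' = l" "rvar s4 ''q'' = 1 + 1 / real l" "alv s4 = {..<n}" "ivar s4 ''B'' = k"
        using st3 A3 by (simp_all add: s4_def inp_def alv_def)
      have cov0: "covered m k {..<n}" unfolding covered_def
      proof (intro allI impI conjI)
        fix x assume "x < n"
        then show "{..<n} \<inter> blk k x \<noteq> {}" by (auto simp: blk_def)
        have "card ({..<n} \<inter> blk k x) \<le> card (blk k x)" by (intro card_mono finite_blk) auto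
        then show "card ({..<n} \<inter> blk k x) \<le> m" using blk_small[OF k1, of x] km by simp
      qed
      have cost0: "block_cost k {..<n} {..<n} = 0" unfolding block_cost_def
      proof (rule sum.neutral, rule ballI)
        fix x assume x: "x \<in> {..<n}"
        have b: "{..<n} \<inter> blk k x = blk k x" by (auto simp: blk_def)
        have "dist_to_set d x (blk k x) \<le> d x x" using x finite_blk by (intro dist_to_set_le) (auto simp: blk_def)
        moreover have "0 \<le> dist_to_set d x (blk k x)" using x finite_blk by (intro dist_nonneg) (auto simp: blk_def)
        ultimately have "dist_to_set d x (blk k x) = 0" using x by simp
        then show "w x * (dist_to_set d x ({..<n} \<inter> blk k x))\<^sup>2 = 0" by (simp add: b)
      qed
      define Inv where "Inv s' \<tau> \<longleftrightarrow> (\<exists>j. ivar s' ''B'' = k * 2 ^ j \<and> (j = 0 \<or> k * 2 ^ j < 2 * n) \<and>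
         covered m (k * 2 ^ j) (alv s') \<and>
         sqrt (block_cost (k * 2 ^ j) (alv s') {..<n}) \<le> exp (2 * real j / real l) * (2 * real j) * opt \<and> \<tau> \<le> j * lb)"
        for s' \<tau>
      show ?case
      proof (rule wp_Seq, rule wp_ISet, goal_cases)
        case 2
        have e4: "s3\<lparr>ivar := (ivar s3)(''B'' := ival s3 (IVar ''k''))\<rparr> = s4" using st3 by (simp add: s4_def)
        show ?case unfolding e4
        proof (rule wp_While[where Inv = Inv and m = "\<lambda>s'. n - ivar s' ''B''"], goal_cases)
          case 1
          show ?case unfolding Inv_def by (rule exI[of _ 0]) (use st4 cov0 cost0 in simp)
        next
          case (2 s5 \<tau>5)
          note fr5 = frameD[OF 2(2), simplified]
          from 2(1) obtain j where j: "ivar s5 ''B'' = k * 2 ^ j" "covered m (k * 2 ^ j) (alv s5)"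
            "sqrt (block_cost (k * 2 ^ j) (alv s5) {..<n}) \<le> exp (2 * real j / real l) * (2 * real j) * opt" "\<tau>5 \<le> j * lb"
            unfolding Inv_def by blast
          have st5: "inp s5" "ivar s5 ''lev'' = l" "rvar s5 ''q'' = 1 + 1 / real l" "ivar s5 ''n'' = n"
            using st4 by (simp_all add: inp_def fr5)
          have lt: "k * 2 ^ j < n" using 2(3) j(1) st5 by simp
          have dbl: "k * 2 ^ Suc j = 2 * (k * 2 ^ j)" by simp
          define s6 where "s6 = s5\<lparr>ivar := (ivar s5)(''B'' := k * 2 ^ Suc j)\<rparr>"
          have e6: "s5\<lparr>ivar := (ivar s5)(''B'' := ival s5 (IAdd (IVar ''B'') (IVar ''B'')))\<rparr> = s6"
            using j(1) by (simp add: s6_def mult_2 distrib_left)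
          have A6: "alv s6 = alv s5" by (simp add: s6_def alv_def)
          have st6: "inp s6" "ivar s6 ''lev'' = l" "rvar s6 ''q'' = 1 + 1 / real l" "ivar s6 ''B'' = 2 * (k * 2 ^ j)"
            using st5 by (simp_all add: inp_def s6_def)
          have lp: "wp d M level_pass (\<lambda>s' \<tau>. covered m (2 * (k * 2 ^ j)) (alv s')
            \<and> block_cost (2 * (k * 2 ^ j)) (alv s') {..<n} \<le> exp (4 / real l) *
                (\<Sum>x<n. w x * (2 * dist_to_set d x Q + dist_to_set d x (alv s6 \<inter> blk (k * 2 ^ j) x))\<^sup>2)
            \<and> \<tau> \<le> n * (1000 * k * Y + 3000 * m * Y\<^sup>2 + 50) + 10) s6"
            using k1 by (intro level_pass[OF st6(1,4,2,3) _ lt l(1,2) m_def _ Q]) (auto simp: A6 j(2))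
          show ?case
          proof (rule wp_Seq, rule wp_ISet, goal_cases)
            case 1
            have "k * 2 ^ j + k * 2 ^ j \<le> M" using lt M_ge(1) by linarith
            then show ?case using j(1) by simp
          next
            case 2
            show ?case unfolding e6
            proof (rule wp_use[OF lp], goal_cases)
              case (1 s7 \<tau>7)
              note fr7 = frameD[OF 1(1), simplified]
              have cov7: "covered m (k * 2 ^ Suc j) (alv s7)" unfolding dbl using 1(2) by blast
              have B7: "ivar s7 ''B'' = k * 2 ^ Suc j" using st6 by (simp add: fr7)
              have "exp (4 / real l) = (exp (2 / real l))\<^sup>2" by (simp add: exp_double[symmetric])
              with 1(2) have "sqrt (block_cost (2 * (k * 2 ^ j)) (alv s7) {..<n})
                  \<le> exp (2 / real l) * (2 * opt + sqrt (block_cost (k * 2 ^ j) (alv s5) {..<n}))"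
                unfolding opt_def by (intro merge_level) (simp add: A6)
              \<comment> \<open>The new additive term is enlarged by the factor accumulated so far,
                so that this factor can be taken out of the whole sum.\<close>
              also have "\<dots> \<le> exp (2 / real l) * (exp (2 * real j / real l) * (2 * opt) + exp (2 * real j / real l) * (2 * real j) * opt)"
                using j(3) mult_right_mono[of 1 "exp (2 * real j / real l)" "2 * opt"] opt0
                by (intro mult_left_mono add_mono) auto
              also have "\<dots> = (exp (2 / real l) * exp (2 * real j / real l)) * (2 * real (Suc j)) * opt"
                by (simp add: algebra_simps)
              also have "exp (2 / real l) * exp (2 * real j / real l) = exp (2 * real (Suc j) / real l)"
                by (simp add: exp_add[symmetric] add_divide_distrib[symmetric])
              finally have c7: "sqrt (block_cost (k * 2 ^ Suc j) (alv s7) {..<n})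
                  \<le> exp (2 * real (Suc j) / real l) * (2 * real (Suc j)) * opt" by (simp only: dbl)
              have t7: "\<tau>5 + (4 + \<tau>7) + 4 \<le> Suc j * lb" using j(4) 1(2) by (simp add: lb_def)
              have "Inv s7 (\<tau>5 + (4 + \<tau>7) + 4)" unfolding Inv_def
                using B7 cov7 c7 t7 lt by (intro exI[of _ "Suc j"]) simp
              moreover have "n - ivar s7 ''B'' < n - ivar s5 ''B''"
              proof -
                have "1 \<le> k * 2 ^ j" using k1 by simp
                then show ?thesis unfolding B7 j(1) dbl using lt by linarith
              qed
              ultimately show ?case by (simp add: numeral_eq_Suc)
            qed
          qed
        next
          case (4 s5 \<tau>5)
          note fr5 = frameD[OF 4(2), simplified]
          from 4(1) obtain j where j: "ivar s5 ''B'' = k * 2 ^ j" "j = 0 \<or> k * 2 ^ j < 2 * n" "covered m (k * 2 ^ j) (alv s5)"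
            "sqrt (block_cost (k * 2 ^ j) (alv s5) {..<n}) \<le> exp (2 * real j / real l) * (2 * real j) * opt" "\<tau>5 \<le> j * lb"
            unfolding Inv_def by blast
          have n5: "ivar s5 ''n'' = n" using st4 by (simp add: inp_def fr5)
          then have ge: "n \<le> k * 2 ^ j" using 4(3) j(1) by simp
          have whole: "blk (k * 2 ^ j) x = {..<n}" if "x < n" for x using ge that by (auto simp: blk_def)
          have alvN: "alv s5 \<subseteq> {..<n}" by (auto simp: alv_def)
          then have int: "alv s5 \<inter> blk (k * 2 ^ j) x = alv s5" if "x < n" for x using whole[OF that] by auto
          have ne: "alv s5 \<noteq> {}" and cd: "card (alv s5) \<le> m"
            using j(3) int[of 0] n1 by (auto simp: covered_def)
          \<comment> \<open>Before the last doubling the block size was below \<open>n\<close>,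
            which is at most \<open>2 ^ (l - 1)\<close>.\<close>
          have jl: "j \<le> l"
          proof (cases j)
            case (Suc i)
            have "2 ^ i \<le> k * 2 ^ i" using k1 by simp
            moreover have "k * 2 ^ i < n" using j(2) Suc by simp
            ultimately have "2 ^ i < n" by (rule le_less_trans)
            then have "(2::nat) ^ i < 2 ^ (l - 1)" using l(3) by linarith
            then have "i < l - 1" by simp
            then show ?thesis using Suc by simp
          qed simp
          have "sqrt (\<Sum>x<n. w x * (dist_to_set d x (alv s5))\<^sup>2) = sqrt (block_cost (k * 2 ^ j) (alv s5) {..<n})"
            unfolding block_cost_def by (intro arg_cong[where f = sqrt] sum.cong) (auto simp: int)
          also have "\<dots> \<le> exp (2 * real j / real l) * (2 * real j) * opt" by (rule j(4))
          also have "\<dots> \<le> exp 2 * (2 * real j) * opt"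
            using jl l(1) opt0 by (intro mult_right_mono) (auto simp: divide_le_eq)
          finally have c: "sqrt (\<Sum>x<n. w x * (dist_to_set d x (alv s5))\<^sup>2) \<le> 2 * exp 2 * real j * opt" by (simp add: mult_ac)
          define z where "z = n * (k * Y ^ 3)"
          have z: "1 \<le> z" "n \<le> z" "Y \<le> z"
          proof -
            have Y3: "1 \<le> Y ^ 3" "Y \<le> Y ^ 3" using Y1 self_le_power[of Y 3] by auto
            have "1 \<le> k * Y ^ 3" using Y3 k1 by simp
            then show "n \<le> z" unfolding z_def by simp
            then show "1 \<le> z" using n1 by simp
            have "1 \<le> n * k" using n1 k1 by simp
            then have "1 * Y ^ 3 \<le> n * k * Y ^ 3" by (rule mult_le_mono1)
            then show "Y \<le> z" unfolding z_def using Y3(2) by (metis le_trans mult.assoc mult_1)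
          qed
          have lbz: "lb \<le> 19080 * z"
          proof -
            have "1000 * k * Y + 3000 * m * Y\<^sup>2 \<le> 19000 * (k * Y ^ 3)"
            proof -
              have "3000 * m * Y\<^sup>2 \<le> 3000 * (6 * k * Y) * Y\<^sup>2" using mb by (intro mult_le_mono1 mult_le_mono2)
              also have "\<dots> = 18000 * (k * Y ^ 3)" by (simp add: power2_eq_square power3_eq_cube)
              finally have "3000 * m * Y\<^sup>2 \<le> 18000 * (k * Y ^ 3)" .
              moreover have "k * Y \<le> k * Y ^ 3" using self_le_power[of Y 3] Y1 by (intro mult_le_mono2) auto
              ultimately show ?thesis by linarith
            qed
            from mult_le_mono2[OF this, of n] have "n * (1000 * k * Y + 3000 * m * Y\<^sup>2) \<le> 19000 * z"
              by (simp add: z_def)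
            moreover have "n * (1000 * k * Y + 3000 * m * Y\<^sup>2 + 50) = n * (1000 * k * Y + 3000 * m * Y\<^sup>2) + 50 * n"
              by (simp add: add_mult_distrib2)
            ultimately show ?thesis unfolding lb_def using z by linarith
          qed
          have "\<tau>5 \<le> (2 * Y) * (19080 * z)"
            using l jl Y1 by (intro order_trans[OF j(5) mult_le_mono[OF _ lbz]]) linarith
          also have "\<dots> = 38160 * (Y * z)" by simp
          finally have t5: "\<tau>5 \<le> 38160 * (Y * z)" .
          have "z \<le> Y * z" using Y1 by simp
          then have t: "\<tau>1 + (10 + (\<tau>3 + (10 + (\<tau>5 + 10)))) \<le> 40000 * (Y * z)"
          proof -
            have "\<tau>3 \<le> 20 * n + 6" using 10(4) by simp
            then show ?thesis using t5 l(4) z \<open>z \<le> Y * z\<close> by linarith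
          qed
          have "Y ^ 4 = Y * Y ^ 3" by (simp add: numeral_eq_Suc)
          then have Yz: "40000 * (Y * z) = 40000 * n * k * Y ^ 4" by (simp add: z_def)
          have jn: "j = 0 \<or> k * 2 ^ j \<le> 2 * n" using j(2) by auto
          have cY: "card (alv s5) \<le> 6 * k * Y" using cd mb by simp
          show ?case
          proof (intro conjI exI[of _ j])
            show "\<tau>1 + (1 + rsize (RDiv (RNat (IAdd (IVar ''lev'') (INum 1))) (RNat (IVar ''lev''))) +
              (\<tau>3 + (1 + isize (IVar ''k'') + (\<tau>5 + 1 + bsize (ILess (IVar ''B'') (IVar ''n'')))))) \<le> 40000 * n * k * Y ^ 4"
              using t unfolding Yz[symmetric] by simp
            show "alv s5 \<noteq> {}" "card (alv s5) \<le> 6 * k * Y" "j = 0 \<or> k * 2 ^ j \<le> 2 * n" by fact+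
            show "sqrt (\<Sum>x<n. w x * (dist_to_set d x (alv s5))\<^sup>2)
              \<le> 2 * exp 2 * real j * sqrt (\<Sum>x<n. w x * (dist_to_set d x Q)\<^sup>2)"
              using c unfolding opt_def .
          qed
        qed auto
      qed auto
    qed (use st2 in auto)
  qed
qed

end

section \<open>Programs for the final stage\<close>

context ball_greedy
begin

lemma iso_cong: "(\<And>i. i < m \<Longrightarrow> z i = z' i) \<Longrightarrow> iso z m x j \<longleftrightarrow> iso z' m x j"
  by (simp add: iso_def)

lemma iso_Suc: "iso z (Suc m) x j \<longleftrightarrow> iso z m x j \<and> 44 * R j \<le> \<delta> x (z m)"
  by (auto simp: iso_def less_Suc_eq)

definition descent :: "(nat \<Rightarrow> nat) \<Rightarrow> nat \<Rightarrow> nat \<Rightarrow> bool" where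
  "descent c a b \<longleftrightarrow> (\<forall>l. a \<le> l \<longrightarrow> l \<le> b \<longrightarrow> c l < N) \<and> (\<forall>l. a \<le> l \<longrightarrow> l < b \<longrightarrow>
     \<delta> (c l) (c (Suc l)) \<le> 6 * R l \<and> (\<forall>y<N. \<delta> (c l) y \<le> 6 * R l \<longrightarrow> val y (Suc l) \<le> val (c (Suc l)) (Suc l)))"

lemma descent_refl: "c a < N \<Longrightarrow> descent c a a"
  by (simp add: descent_def)

lemma descent_Suc:
  assumes "descent c a b" "a \<le> b" "u < N" "\<delta> (c b) u \<le> 6 * R b"
    "\<And>y. y < N \<Longrightarrow> \<delta> (c b) y \<le> 6 * R b \<Longrightarrow> val y (Suc b) \<le> val u (Suc b)"
  shows "descent (c(Suc b := u)) a (Suc b)"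
  using assms unfolding descent_def by (auto simp: less_Suc_eq le_Suc_eq)

text \<open>The conditions on run \<open>i\<close> mention only the centres before \<open>i\<close>,
  so adding one at position \<open>m\<close> does not disturb the earlier runs.\<close>

lemma greedy_run_Suc:
  assumes run: "greedy_run z m a ch" and c: "descent c b L" "b \<le> L" and iso: "iso z m (c b) b"
    and best: "\<And>x j. x < N \<Longrightarrow> j \<le> L \<Longrightarrow> iso z m x j \<Longrightarrow> val x j \<le> val (c b) b"
  shows "greedy_run (z(m := c L)) (Suc m) (a(m := b)) (ch(m := c))"
proof -
  have old: "iso (z(m := c L)) i x j \<longleftrightarrow> iso z i x j" if "i \<le> m" for i x j
    by (rule iso_cong) (use that in auto)
  show ?thesis
    unfolding greedy_run_def
  proof (rule allI, rule impI)
    fix i assume "i < Suc m"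
    then consider "i < m" | "i = m" by linarith
    then show "(a(m := b)) i \<le> L \<and> (\<forall>l. (a(m := b)) i \<le> l \<longrightarrow> l \<le> L \<longrightarrow> (ch(m := c)) i l < N)
      \<and> (z(m := c L)) i = (ch(m := c)) i L
     \<and> (\<forall>l. (a(m := b)) i \<le> l \<longrightarrow> l < L \<longrightarrow> \<delta> ((ch(m := c)) i l) ((ch(m := c)) i (Suc l)) \<le> 6 * R l
          \<and> (\<forall>y<N. \<delta> ((ch(m := c)) i l) y \<le> 6 * R l \<longrightarrow> val y (Suc l) \<le> val ((ch(m := c)) i (Suc l)) (Suc l)))
     \<and> iso (z(m := c L)) i ((ch(m := c)) i ((a(m := b)) i)) ((a(m := b)) i)
     \<and> (\<forall>x<N. \<forall>j\<le>L. iso (z(m := c L)) i x j \<longrightarrow> val x j \<le> val ((ch(m := c)) i ((a(m := b)) i)) ((a(m := b)) i))"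
    proof cases
      case 1
      then have "i \<noteq> m" "i \<le> m" by auto
      then show ?thesis using run 1 unfolding greedy_run_def old[OF \<open>i \<le> m\<close>] by simp
    next
      case 2
      then show ?thesis using c iso best unfolding descent_def old[OF eq_imp_le[OF 2]] by simp
    qed
  qed
qed

text \<open>\<open>J x\<close> is the least level at which \<open>x\<close> is isolated. The value
  \<open>Suc L\<close> marks a point isolated at no level, which by \<open>R_last\<close> is one
  already chosen.\<close>

definition levels_ok :: "(nat \<Rightarrow> nat) \<Rightarrow> nat \<Rightarrow> (nat \<Rightarrow> nat) \<Rightarrow> bool" where
  "levels_ok z m J \<longleftrightarrow> (\<forall>x<N. J x \<le> Suc L \<and> (\<forall>j<J x. \<not> iso z m x j) \<and> (J x \<le> L \<longrightarrow> iso z m x (J x)))"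

lemma levels_ok_0: "(\<And>x. x < N \<Longrightarrow> J x = 0) \<Longrightarrow> levels_ok z 0 J"
  by (simp add: levels_ok_def iso_def)

text \<open>A point isolated at no level coincides with a chosen one by \<open>R_last\<close>, and
  \<open>m\<close> choices cannot exhaust \<open>N\<close> points.\<close>

lemma levels_ok_unpicked:
  assumes "levels_ok z m J" "m < N" "\<And>i. i < m \<Longrightarrow> z i < N"
  shows "\<exists>x<N. J x \<le> L"
proof (rule ccontr)
  assume "\<not> ?thesis"
  then have no: "\<not> iso z m x L" if "x < N" for x
    using assms(1) that unfolding levels_ok_def by (metis le_neq_implies_less less_Suc_eq_le not_less)
  have "{..<N} \<subseteq> z ` {..<m}"
  proof
    fix x assume "x \<in> {..<N}"
    then obtain i where i: "i < m" "\<delta> x (z i) < 44 * R L" using no[of x] by (auto simp: iso_def not_le)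
    then have "x = z i" using R_last[of x "z i"] assms(3) \<open>x \<in> {..<N}\<close> by force
    then show "x \<in> z ` {..<m}" using i by auto
  qed
  then have "card {..<N} \<le> card (z ` {..<m})" by (intro card_mono) auto
  also have "\<dots> \<le> m" using card_image_le[of "{..<m}" z] by simp
  finally show False using assms(2) by simp
qed

text \<open>Values grow with the radius, so among the isolated balls of a point only the one at its
  least level needs to be compared.\<close>

lemma levels_ok_best:
  assumes "levels_ok z m J" "\<And>i. i < N \<Longrightarrow> J i \<le> L \<Longrightarrow> val i (J i) \<le> V" "x < N" "j \<le> L" "iso z m x j"
  shows "val x j \<le> V"
proof -
  have "J x \<le> j" using assms(1,3,5) unfolding levels_ok_def by (meson not_le)
  then have "val x j \<le> val x (J x)" by (rule val_antimono)
  also have "\<dots> \<le> V" using assms(2)[OF assms(3)] \<open>J x \<le> j\<close> assms(4) by simp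
  finally show ?thesis .
qed

text \<open>The level of a point is raised by one scan over all levels; \<open>l\<close> levels have been scanned.\<close>

definition scanned :: "(nat \<Rightarrow> nat) \<Rightarrow> nat \<Rightarrow> nat \<Rightarrow> nat \<Rightarrow> nat \<Rightarrow> bool" where
  "scanned z m x l J \<longleftrightarrow> J \<le> Suc L \<and> (\<forall>j<J. \<not> iso z (Suc m) x j) \<and> (J \<le> L \<longrightarrow> iso z m x J)
     \<and> (J \<le> L \<longrightarrow> J < l \<longrightarrow> iso z (Suc m) x J)"

lemma scanned_0:
  assumes "levels_ok z m J" "x < N"
  shows "scanned z m x 0 (J x)"
  using assms unfolding levels_ok_def scanned_def by (auto simp: iso_Suc)

lemma scanned_Suc:
  assumes "scanned z m x l J" "l \<le> L"
  shows "J = l \<Longrightarrow> \<delta> x (z m) < 44 * R l \<Longrightarrow> scanned z m x (Suc l) (Suc l)"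
    and "\<not> (J = l \<and> \<delta> x (z m) < 44 * R l) \<Longrightarrow> scanned z m x (Suc l) J"
proof -
  show "scanned z m x (Suc l) (Suc l)" if "J = l" "\<delta> x (z m) < 44 * R l"
    using assms that iso_upward[of z m x l "Suc l"] unfolding scanned_def
    by (auto simp: less_Suc_eq iso_Suc)
  show "scanned z m x (Suc l) J" if "\<not> (J = l \<and> \<delta> x (z m) < 44 * R l)"
    using assms that unfolding scanned_def by (auto simp: less_Suc_eq iso_Suc)
qed

lemma scanned_all:
  assumes "\<And>x. x < N \<Longrightarrow> scanned z m x (Suc L) (J x)"
  shows "levels_ok z (Suc m) J"
  using assms unfolding levels_ok_def scanned_def by auto

lemma val_term: "max 0 ((R j)\<^sup>2 - (\<delta> x y)\<^sup>2) = (if \<delta> x y < R j then R j * R j - \<delta> x y * \<delta> x y else 0)"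
proof (cases "\<delta> x y < R j")
  case True
  then have "(\<delta> x y)\<^sup>2 \<le> (R j)\<^sup>2" by (intro power_mono) auto
  then show ?thesis using True by (simp add: power2_eq_square)
next
  case False
  then have "(R j)\<^sup>2 \<le> (\<delta> x y)\<^sup>2" using R_pos[of j] by (intro power_mono) auto
  then show ?thesis using False by simp
qed

end

section \<open>The programs of the last stage\<close>

definition weigh :: com where
  "weigh = Seq (For ''i'' (INum 0) ''nc'' (RPut ''mu'' (IVar ''i'') rzero))
     (For ''x'' (INum 0) ''n'' (Seq (ISet ''b'' (INum 0))
       (Seq (For ''i'' (INum 0) ''nc''
          (Cond (RLess (RDist (IVar ''x'') (IGet ''C'' (IVar ''i''))) (RDist (IVar ''x'') (IGet ''C'' (IVar ''b''))))
             (ISet ''b'' (IVar ''i'')) Skip))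
         (RPut ''mu'' (IVar ''b'') (RAdd (RGet ''mu'' (IVar ''b'')) (RGet ''w'' (IVar ''x'')))))))"

text \<open>The largest distance from candidate 0 is at least half the diameter. For a single
  candidate it would be 0, and the default 1 keeps all radii positive.\<close>

definition extent :: com where
  "extent = Seq (RSet ''r'' rzero) (Seq
     (For ''i'' (INum 0) ''nc'' (Seq (RSet ''v'' (RDist (IGet ''C'' (INum 0)) (IGet ''C'' (IVar ''i''))))
        (Cond (RLess (RVar ''r'') (RVar ''v'')) (RSet ''r'' (RVar ''v'')) Skip)))
     (Seq (Cond (RLess rzero (RVar ''r'')) Skip (RSet ''r'' (RNat (INum 1))))
     (Seq (RSet ''rm'' (RVar ''r''))
     (For ''i'' (INum 0) ''nc'' (For ''j'' (INum 0) ''nc''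
        (Seq (RSet ''v'' (RDist (IGet ''C'' (IVar ''i'')) (IGet ''C'' (IVar ''j''))))
          (Cond (BAnd (RLess rzero (RVar ''v'')) (RLess (RVar ''v'') (RVar ''rm''))) (RSet ''rm'' (RVar ''v'')) Skip)))))))"

definition radii :: com where
  "radii = Seq (ISet ''L'' (INum 0)) (Seq (RPut ''R'' (INum 0) (RVar ''r''))
     (Seq (While (RLess (RVar ''rm'') (RMul (RNat (INum 44)) (RVar ''r'')))
        (Seq (RSet ''r'' (RDiv (RVar ''r'') (RNat (INum 3))))
          (Seq (ISet ''L'' (IAdd (IVar ''L'') (INum 1))) (RPut ''R'' (IVar ''L'') (RVar ''r'')))))
     (ISet ''L1'' (IAdd (IVar ''L'') (INum 1)))))"

text \<open>Arrays are one-dimensional, so the value table is stored in rows of length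
  \<open>L1\<close>, one row per candidate.\<close>

definition ball_values :: com where
  "ball_values = For ''i'' (INum 0) ''nc'' (For ''l'' (INum 0) ''L1'' (Seq (RSet ''v'' rzero)
     (Seq (For ''y'' (INum 0) ''nc''
       (Cond (RLess (RDist (IGet ''C'' (IVar ''i'')) (IGet ''C'' (IVar ''y''))) (RGet ''R'' (IVar ''l'')))
         (RSet ''v'' (RAdd (RVar ''v'') (RMul (RGet ''mu'' (IVar ''y''))
            (RSub (RMul (RGet ''R'' (IVar ''l'')) (RGet ''R'' (IVar ''l'')))
              (RMul (RDist (IGet ''C'' (IVar ''i'')) (IGet ''C'' (IVar ''y'')))
                (RDist (IGet ''C'' (IVar ''i'')) (IGet ''C'' (IVar ''y'')))))))) Skip))
       (RPut ''V'' (IAdd (IMul (IVar ''i'') (IVar ''L1'')) (IVar ''l'')) (RVar ''v'')))))"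

abbreviation (input) value_at :: "vname \<Rightarrow> iexp \<Rightarrow> rexp" where
  "value_at x e \<equiv> RGet ''V'' (IAdd (IMul (IVar x) (IVar ''L1'')) e)"

text \<open>The initial \<open>u = 0\<close> may be a point already chosen; the doubly negated test
  lets the first unchosen point replace it regardless of values.\<close>

definition start_pick :: com where
  "start_pick = Seq (ISet ''u'' (INum 0)) (For ''i'' (INum 0) ''nc''
     (Cond (BAnd (ILess (IGet ''J'' (IVar ''i'')) (IVar ''L1''))
              (BNot (BAnd (ILess (IGet ''J'' (IVar ''u'')) (IVar ''L1''))
                (BNot (RLess (value_at ''u'' (IGet ''J'' (IVar ''u''))) (value_at ''i'' (IGet ''J'' (IVar ''i''))))))))
        (ISet ''u'' (IVar ''i'')) Skip))"

definition descend :: com where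
  "descend = For ''l'' (IGet ''J'' (IVar ''u'')) ''L'' (Seq (ISet ''b'' (IVar ''u''))
     (Seq (For ''y'' (INum 0) ''nc''
       (Cond (BAnd (BNot (RLess (RMul (RNat (INum 6)) (RGet ''R'' (IVar ''l'')))
                     (RDist (IGet ''C'' (IVar ''u'')) (IGet ''C'' (IVar ''y'')))))
                (RLess (value_at ''b'' (IAdd (IVar ''l'') (INum 1))) (value_at ''y'' (IAdd (IVar ''l'') (INum 1)))))
         (ISet ''b'' (IVar ''y'')) Skip))
       (ISet ''u'' (IVar ''b''))))"

definition raise_levels :: com where
  "raise_levels = For ''i'' (INum 0) ''nc'' (For ''l'' (INum 0) ''L1''
     (Cond (BAnd (BAnd (BNot (ILess (IGet ''J'' (IVar ''i'')) (IVar ''l''))) (BNot (ILess (IVar ''l'') (IGet ''J'' (IVar ''i'')))))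
              (RLess (RDist (IGet ''C'' (IVar ''i'')) (IGet ''C'' (IVar ''u''))) (RMul (RNat (INum 44)) (RGet ''R'' (IVar ''l'')))))
        (IPut ''J'' (IVar ''i'') (IAdd (IVar ''l'') (INum 1))) Skip))"

definition final_stage :: com where
  "final_stage = Seq (ISet ''lo'' (INum 0)) (Seq (ISet ''hi'' (IVar ''n'')) (Seq gather (Seq weigh (Seq extent (Seq radii
     (Seq ball_values (Seq (For ''i'' (INum 0) ''nc'' (IPut ''J'' (IVar ''i'') (INum 0)))
     (Seq (Cond (ILess (IVar ''nc'') (IVar ''k'')) (ISet ''kk'' (IVar ''nc'')) (ISet ''kk'' (IVar ''k'')))
       (For ''m'' (INum 0) ''kk'' (Seq start_pick (Seq descend
          (Seq (IPut ''S'' (IVar ''m'') (IGet ''C'' (IVar ''u''))) raise_levels))))))))))))"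

lemma final_mods [simp]:
  "ivs weigh = {''i'', ''x'', ''b''}" "rvs weigh = {}" "ias weigh = {}" "ras weigh = {''mu''}"
  "ivs extent = {''i'', ''j''}" "rvs extent = {''r'', ''v'', ''rm''}" "ias extent = {}" "ras extent = {}"
  "ivs radii = {''L'', ''L1''}" "rvs radii = {''r''}" "ias radii = {}" "ras radii = {''R''}"
  "ivs ball_values = {''i'', ''l'', ''y''}" "rvs ball_values = {''v''}" "ias ball_values = {}" "ras ball_values = {''V''}"
  "ivs start_pick = {''u'', ''i''}" "rvs start_pick = {}" "ias start_pick = {}" "ras start_pick = {}"
  "ivs descend = {''u'', ''l'', ''b'', ''y''}" "rvs descend = {}" "ias descend = {}" "ras descend = {}"
  "ivs raise_levels = {''i'', ''l''}" "rvs raise_levels = {}" "ias raise_levels = {''J''}" "ras raise_levels = {}"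
  by (auto simp: weigh_def extent_def radii_def ball_values_def start_pick_def descend_def raise_levels_def)

section \<open>Weights, extent and radii of the remaining candidates\<close>

locale final_run = kmeans_run +
  fixes N :: nat and C :: "nat \<Rightarrow> nat"
  assumes N: "1 \<le> N" "N \<le> n" and C: "inj_on C {..<N}" "\<And>i. i < N \<Longrightarrow> C i < n"
begin

definition cd :: "nat \<Rightarrow> nat \<Rightarrow> real" where "cd i j = d (C i) (C j)"

lemma cd_range: "i < N \<Longrightarrow> j < N \<Longrightarrow> i \<noteq> j \<Longrightarrow> dl \<le> cd i j"
  unfolding cd_def using C by (intro dl) (auto simp: inj_on_def)

lemma cd_le: "i < N \<Longrightarrow> j < N \<Longrightarrow> cd i j \<le> 2 ^ Y * dl"
  using dY[of "C i" "C j"] C mult_right_mono[of 1 "real n" "d (C i) (C j)"] n1 unfolding cd_def by simp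

lemma cd_metric: "Metric_space {..<N} cd"
proof
  show "0 \<le> cd x y" "cd x y = cd y x" for x y by (auto simp: cd_def commute)
  show "cd x y = 0 \<longleftrightarrow> x = y" if "x \<in> {..<N}" "y \<in> {..<N}" for x y
    using that C by (auto simp: cd_def inj_on_def)
  show "cd x z \<le> cd x y + cd y z" if "x \<in> {..<N}" "y \<in> {..<N}" "z \<in> {..<N}" for x y z
    using that C(2) unfolding cd_def by (intro triangle) auto
qed

definition nearest :: "(nat \<Rightarrow> nat) \<Rightarrow> nat set \<Rightarrow> bool" where
  "nearest p X \<longleftrightarrow> (\<forall>x\<in>X. p x < N \<and> (\<forall>i<N. d x (C (p x)) \<le> d x (C i)))"

lemma weigh:
  assumes st: "ivar s ''nc'' = N" "ivar s ''n'' = n" "iarr s ''C'' = C" "\<And>x. x < n \<Longrightarrow> rarr s ''w'' x = w x"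
  shows "wp d M weigh (\<lambda>s' \<tau>. (\<exists>p. nearest p {..<n} \<and> (\<forall>i<N. rarr s' ''mu'' i = sum w {x\<in>{..<n}. p x = i}))
     \<and> \<tau> \<le> n * (50 * N + 100)) s"
  unfolding weigh_def
proof (rule wp_Seq, rule wp_For_const[where a = 0 and b = N and \<beta> = 20 and Inv = "\<lambda>j s'.
    \<forall>i<j. rarr s' ''mu'' i = 0"], goal_cases)
  case (9 j s')
  then show ?case by (intro wp_intros) (auto simp: less_Suc_eq)
next
  case (10 s1 \<tau>1)
  note fr1 = frameD[OF 10(1), simplified]
  note t1 = 10(4)
  show ?case
  proof (rule wp_For_const[where a = 0 and b = n and \<beta> = "50 * N + 50" and Inv = "\<lambda>j s'.
    \<exists>p. nearest p {..<j} \<and> (\<forall>i<N. rarr s' ''mu'' i = sum w {x\<in>{..<j}. p x = i})"], goal_cases)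
    case 8
    show ?case using 10(3) by (simp add: nearest_def)
  next
    case (9 j s2)
    note fr2 = frameD[OF 9(4), simplified]
    from 9(5) obtain p where p: "nearest p {..<j}" "\<And>i. i < N \<Longrightarrow> rarr s2 ''mu'' i = sum w {x\<in>{..<j}. p x = i}" by blast
    have st2: "ivar s2 ''nc'' = N" "iarr s2 ''C'' = C" "rarr s2 ''w'' j = w j"
      using st 9(2) by (simp_all add: fr1 fr2)
    show ?case
    proof (rule wp_Seq, rule wp_ISet, goal_cases)
      case 2
      show ?case
      proof (rule wp_Seq, rule wp_For_const[where a = 0 and b = N and \<beta> = 50 and Inv = "\<lambda>i s'.
        ivar s' ''b'' < N \<and> (\<forall>i'<i. d j (C (ivar s' ''b'')) \<le> d j (C i'))"], goal_cases)
        case (9 i s3)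
        note fr3 = frameD[OF 9(4), simplified]
        have "ivar s3 ''x'' = j" "iarr s3 ''C'' = C" using \<open>ivar s2 ''x'' = j\<close> st2 by (simp_all add: fr3)
        then show ?case
          by (intro wp_intros) (use 9(1-3,5) in \<open>auto simp: less_Suc_eq; fastforce\<close>)+
      next
        case (10 s3 \<tau>3)
        note fr3 = frameD[OF 10(1), simplified]
        define b where "b = ivar s3 ''b''"
        have b: "b < N" "\<And>i. i < N \<Longrightarrow> d j (C b) \<le> d j (C i)" using 10(3) by (auto simp: b_def)
        have n': "nearest (p(j := b)) {..<Suc j}" using p(1) b by (auto simp: nearest_def less_Suc_eq)
        have mu': "sum w {x\<in>{..<Suc j}. (p(j := b)) x = i} = sum w {x\<in>{..<j}. p x = i} + (if i = b then w j else 0)" for i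
        proof -
          have "{x\<in>{..<Suc j}. (p(j := b)) x = i} = (if i = b then insert j {x\<in>{..<j}. p x = i} else {x\<in>{..<j}. p x = i})"
            by (auto simp: less_Suc_eq)
          then show ?thesis by simp
        qed
        have wj: "rarr s3 ''w'' j = w j" "ivar s3 ''x'' = j" "rarr s3 ''mu'' = rarr s2 ''mu''"
          using st2 \<open>ivar s2 ''x'' = j\<close> by (simp_all add: fr3)
        show ?case
        proof (intro wp_RPut conjI exI[of _ "p(j := b)"], goal_cases)
          case 4
          then show ?case using b wj p(2) unfolding mu' by (auto simp: b_def)
        qed (use n' 10(4) in auto)
      qed (use st2 N in auto)
    qed simp
  next
    case (10 s' \<tau>)
    have "n * (50 * N + 50) + N * 20 + 30 \<le> n * (50 * N + 100)"
      using N n1 by (simp add: algebra_simps)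
    then show ?case using 10(3,4) t1 by simp
  qed (use st in \<open>auto simp: fr1\<close>)
qed (use st in auto)

lemma extent:
  assumes st: "ivar s ''nc'' = N" "iarr s ''C'' = C"
  shows "wp d M extent (\<lambda>s' \<tau>. 0 < rvar s' ''r'' \<and> 0 < rvar s' ''rm'' \<and> rvar s' ''r'' \<le> 2 ^ Y * rvar s' ''rm''
     \<and> (\<forall>i<N. \<forall>j<N. cd i j \<le> 2 * rvar s' ''r'') \<and> (\<forall>i<N. \<forall>j<N. i \<noteq> j \<longrightarrow> rvar s' ''rm'' \<le> cd i j)
     \<and> \<tau> \<le> n * (50 * N + 150)) s"
  unfolding extent_def
proof (rule wp_Seq, rule wp_RSet, simp, rule wp_Seq, rule wp_For_const[where a = 0 and b = N and \<beta> = 50 and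
     Inv = "\<lambda>j s'. (rvar s' ''r'' = 0 \<or> (\<exists>i<N. rvar s' ''r'' = cd 0 i)) \<and> (\<forall>i<j. cd 0 i \<le> rvar s' ''r'')"], goal_cases)
  case (9 j s1)
  note fr1 = frameD[OF 9(4), simplified]
  have st1: "iarr s1 ''C'' = C" "ivar s1 ''i'' = j" using st 9(3) by (simp_all add: fr1)
  show ?case
    by (intro wp_intros) (use 9(1,2,5) st1 in \<open>auto simp: less_Suc_eq cd_def; fastforce\<close>)+
next
  case (10 s1 \<tau>1)
  note fr1 = frameD[OF 10(1), simplified]
  note t1 = 10(4)
  have r1: "rvar s1 ''r'' = 0 \<or> (\<exists>i<N. rvar s1 ''r'' = cd 0 i)" "\<And>i. i < N \<Longrightarrow> cd 0 i \<le> rvar s1 ''r''"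
    using 10(3) by auto
  define r where "r = (if 0 < rvar s1 ''r'' then rvar s1 ''r'' else 1)"
  interpret cd: Metric_space "{..<N}" cd by (rule cd_metric)
  have r0: "0 < r" by (simp add: r_def)
  \<comment> \<open>Distinct candidates are at least \<open>dl\<close> apart, so a vanishing extent
    leaves only one of them; \<open>rle\<close> and the lower bound on \<open>rm\<close> treat this
    case apart.\<close>
  have one: "N = 1" if "\<not> 0 < rvar s1 ''r''"
  proof (rule ccontr)
    assume "N \<noteq> 1"
    then have "1 < N" using N by simp
    then have "dl \<le> cd 0 1" by (intro cd_range) auto
    then show False using r1(2)[of 1] \<open>1 < N\<close> dl0 that by simp
  qed
  have rle: "r \<le> 2 ^ Y * dl \<or> N = 1"
  proof (cases "0 < rvar s1 ''r''")
    case True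
    then obtain i where "i < N" "rvar s1 ''r'' = cd 0 i" using r1(1) by auto
    then show ?thesis using cd_le[of 0 i] True by (simp add: r_def)
  next
    case False
    then show ?thesis using one by simp
  qed
  have diam: "cd i j \<le> 2 * r" if "i < N" "j < N" for i j
  proof -
    have "cd 0 i \<le> r" "cd 0 j \<le> r" using r1(2)[OF that(1)] r1(2)[OF that(2)] by (auto simp: r_def)
    moreover have "cd i j \<le> cd i 0 + cd 0 j" using that N by (intro cd.triangle) auto
    ultimately show ?thesis using cd.commute[of i 0] by simp
  qed
  have main: "wp d M (Seq (RSet ''rm'' (RVar ''r''))
     (For ''i'' (INum 0) ''nc'' (For ''j'' (INum 0) ''nc''
        (Seq (RSet ''v'' (RDist (IGet ''C'' (IVar ''i'')) (IGet ''C'' (IVar ''j''))))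
          (Cond (BAnd (RLess rzero (RVar ''v'')) (RLess (RVar ''v'') (RVar ''rm''))) (RSet ''rm'' (RVar ''v'')) Skip)))))
     (\<lambda>s' \<tau>. 0 < rvar s' ''r'' \<and> 0 < rvar s' ''rm'' \<and> rvar s' ''r'' \<le> 2 ^ Y * rvar s' ''rm''
     \<and> (\<forall>i<N. \<forall>j<N. cd i j \<le> 2 * rvar s' ''r'') \<and> (\<forall>i<N. \<forall>j<N. i \<noteq> j \<longrightarrow> rvar s' ''rm'' \<le> cd i j)
     \<and> \<tau> \<le> N * (50 * N + 30) + 10) s2"
    if s2: "rvar s2 ''r'' = r" "ivar s2 ''nc'' = N" "iarr s2 ''C'' = C" for s2
  proof (rule wp_Seq, rule wp_RSet, goal_cases)
    case 2
    let ?I = "\<lambda>s'. rvar s' ''rm'' = r \<or> (\<exists>i<N. \<exists>j<N. i \<noteq> j \<and> rvar s' ''rm'' = cd i j)"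
    show ?case
    proof (rule wp_For_const[where a = 0 and b = N and \<beta> = "50 * N + 30" and Inv = "\<lambda>i s'. ?I s' \<and>
      (\<forall>i'<i. \<forall>j<N. i' \<noteq> j \<longrightarrow> rvar s' ''rm'' \<le> cd i' j)"], goal_cases)
      case (9 i s3)
      note fr3 = frameD[OF 9(4), simplified]
      have st3: "iarr s3 ''C'' = C" "ivar s3 ''i'' = i" "ivar s3 ''nc'' = N" using s2 9(3) by (simp_all add: fr3)
      show ?case
      proof (rule wp_For_const[where a = 0 and b = N and \<beta> = 50 and Inv = "\<lambda>j s'. ?I s' \<and>
        (\<forall>i'<i. \<forall>j<N. i' \<noteq> j \<longrightarrow> rvar s' ''rm'' \<le> cd i' j) \<and> (\<forall>j'<j. i \<noteq> j' \<longrightarrow> rvar s' ''rm'' \<le> cd i j')"], goal_cases)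
        case (9 j s4)
        note fr4 = frameD[OF 9(4), simplified]
        have st4: "iarr s4 ''C'' = C" "ivar s4 ''i'' = i" "ivar s4 ''j'' = j" using st3 9(3) by (simp_all add: fr4)
        have pos: "i \<noteq> j \<longleftrightarrow> 0 < cd i j" using cd.zero[of i j] cd.nonneg[of i j] \<open>i < N\<close> \<open>j < N\<close> by force
        show ?case
        proof (intro wp_Seq wp_RSet wp_Cond wp_Skip, goal_cases)
          case 4
          then have lt: "i \<noteq> j" "cd i j < rvar s4 ''rm''" unfolding pos by (simp_all add: st4 cd_def)
          have I: "\<exists>i'<N. \<exists>j'<N. i' \<noteq> j' \<and> cd i j = cd i' j'" using lt(1) \<open>i < N\<close> \<open>j < N\<close> by blast
          have old: "\<And>i' j'. i' < i \<Longrightarrow> j' < N \<Longrightarrow> i' \<noteq> j' \<Longrightarrow> cd i j \<le> cd i' j'"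
              "\<And>j'. j' < j \<Longrightarrow> i \<noteq> j' \<Longrightarrow> cd i j \<le> cd i j'"
            using 9(5) lt(2) by (meson less_imp_le order_trans)+
          have v: "d (C i) (C j) = cd i j" by (simp add: cd_def)
          show ?case using I old by (simp add: st4 v less_Suc_eq)
        next
          case 5
          then have "\<not> (i \<noteq> j \<and> cd i j < rvar s4 ''rm'')" unfolding pos by (simp add: st4 cd_def)
          then have "i \<noteq> j \<Longrightarrow> rvar s4 ''rm'' \<le> cd i j" by simp
          with 9(5) show ?case by (simp add: less_Suc_eq)
        qed auto
      next
        case (10 s4 \<tau>4)
        then show ?case by (simp add: less_Suc_eq)
      qed (use st3 9(5) in auto)
    next
      case (10 s3 \<tau>3)
      note fr3 = frameD[OF 10(1), simplified]
      have r3: "rvar s3 ''r'' = r" using s2 by (simp add: fr3)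
      have "0 < rvar s3 ''rm'' \<and> r \<le> 2 ^ Y * rvar s3 ''rm''"
      proof (cases "rvar s3 ''rm'' = r")
        case True
        then show ?thesis using r0 mult_right_mono[of 1 "2 ^ Y" r] by simp
      next
        case False
        then obtain i j where ij: "i < N" "j < N" "i \<noteq> j" "rvar s3 ''rm'' = cd i j" using 10(3) by auto
        then have dr: "dl \<le> rvar s3 ''rm''" using cd_range by simp
        have "r \<le> 2 ^ Y * dl" using rle ij by auto
        also have "\<dots> \<le> 2 ^ Y * rvar s3 ''rm''" using dr by simp
        finally show ?thesis using dr dl0 by simp
      qed
      then show ?case using r3 r0 diam 10(3,4) by simp
    qed (use s2 in auto)
  qed simp
  have t: "\<tau> + \<tau>1 + 40 \<le> n * (50 * N + 150)" if "\<tau> \<le> N * (50 * N + 30) + 10" for \<tau>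
  proof -
    have "N * (50 * N + 30) \<le> n * (50 * N + 30)" using N by (intro mult_le_mono1)
    moreover have "\<tau>1 \<le> 50 * n + 6" using t1 N by simp
    moreover have "n * (50 * N + 150) = n * (50 * N + 30) + 120 * n" by (simp add: algebra_simps)
    ultimately show ?thesis using that n1 by linarith
  qed
  have st1: "ivar s1 ''nc'' = N" "iarr s1 ''C'' = C" using st by (simp_all add: fr1)
  show ?case
  proof (rule wp_Seq, rule wp_Cond, goal_cases)
    case 2
    show ?case
    proof (rule wp_Skip, rule wp_use[OF main], goal_cases)
      case (4 s' \<tau>)
      then show ?case using t[of \<tau>] by simp
    qed (use 2 st1 in \<open>simp_all add: r_def\<close>)
  next
    case 3
    show ?case
    proof (rule wp_RSet, simp, rule wp_use[OF main], goal_cases)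
      case (4 s' \<tau>)
      then show ?case using t[of \<tau>] by simp
    qed (use 3 st1 in \<open>simp_all add: r_def\<close>)
  qed simp
qed (use st in auto)

end

context kmeans_run
begin

text \<open>As long as the loop runs, \<open>3 ^ L < 44 * 2 ^ Y\<close>, and
  \<open>44 <= 2 ^ 6\<close>; this limits \<open>L\<close> to \<open>Y + 6\<close>.\<close>

lemma radii:
  assumes st: "rvar s ''r'' = r0" "rvar s ''rm'' = rm" and r: "0 < r0" "0 < rm" "r0 \<le> 2 ^ Y * rm"
  shows "wp d M radii (\<lambda>s' \<tau>. \<exists>L. ivar s' ''L'' = L \<and> ivar s' ''L1'' = Suc L \<and> L \<le> Y + 6
     \<and> (\<forall>l\<le>L. rarr s' ''R'' l = r0 / 3 ^ l) \<and> 44 * (r0 / 3 ^ L) \<le> rm \<and> \<tau> \<le> 40 * Y + 300) s"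
proof -
  define Inv where "Inv s' \<tau> \<longleftrightarrow> (\<exists>L. ivar s' ''L'' = L \<and> rvar s' ''r'' = r0 / 3 ^ L \<and> L \<le> Y + 6
     \<and> (\<forall>l\<le>L. rarr s' ''R'' l = r0 / 3 ^ l) \<and> \<tau> \<le> 40 * L)" for s' :: state and \<tau>
  have M3: "1 \<le> M" "3 \<le> M" "44 \<le> M" using M_ge(3) by linarith+
  have YM: "Y + 8 \<le> M" using M_ge(2) Y1 by linarith
  show ?thesis
    unfolding radii_def
  proof (rule wp_Seq, rule wp_ISet, simp, rule wp_Seq, rule wp_RPut, goal_cases)
    case 3
    show ?case
    proof (rule wp_Seq, rule wp_While[where Inv = Inv and m = "\<lambda>s'. Y + 6 - ivar s' ''L''"], goal_cases)
      case 1
      show ?case using st by (simp add: Inv_def)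
    next
      case (2 s1 \<tau>1)
      note fr = frameD[OF 2(2), simplified]
      from 2(1) obtain L where L: "ivar s1 ''L'' = L" "rvar s1 ''r'' = r0 / 3 ^ L" "L \<le> Y + 6"
        "\<And>l. l \<le> L \<Longrightarrow> rarr s1 ''R'' l = r0 / 3 ^ l" "\<tau>1 \<le> 40 * L" unfolding Inv_def by blast
      have "rm < 44 * (r0 / 3 ^ L)" using 2(3) st L by (simp add: fr)
      then have "3 ^ L * rm < 44 * r0" by (simp add: field_simps)
      also have "\<dots> \<le> (44 * 2 ^ Y) * rm" using r by simp
      finally have "(3::real) ^ L < 44 * 2 ^ Y" using r(2) by simp
      moreover have "(2::real) ^ L \<le> 3 ^ L" by (rule power_mono) auto
      moreover have "(44::real) * 2 ^ Y \<le> 2 ^ (Y + 6)" by (simp add: power_add)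
      ultimately have "(2::real) ^ L < 2 ^ (Y + 6)" by linarith
      then have LY: "L < Y + 6" by (simp only: power_strict_increasing_iff[of 2])
      have LM: "Suc L \<le> M" using LY YM by linarith
      show ?case
      proof (rule wp_Seq, rule wp_RSet, use M3 in simp, rule wp_Seq, rule wp_ISet, goal_cases)
        case 1
        show ?case using L LM M3 by simp
      next
        case 2
        show ?case
        proof (rule wp_RPut, goal_cases)
          case 3
          show ?case unfolding Inv_def using L LY
            by (intro conjI exI[of _ "Suc L"]) (auto simp: le_Suc_eq)
        qed auto
      qed
    next
      case (3 s1 \<tau>1)
      show ?case using M3 by simp
    next
      case (4 s1 \<tau>1)
      note fr = frameD[OF 4(2), simplified]
      from 4(1) obtain L where L: "ivar s1 ''L'' = L" "rvar s1 ''r'' = r0 / 3 ^ L" "L \<le> Y + 6"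
        "\<And>l. l \<le> L \<Longrightarrow> rarr s1 ''R'' l = r0 / 3 ^ l" "\<tau>1 \<le> 40 * L" unfolding Inv_def by blast
      have "\<not> rm < 44 * (r0 / 3 ^ L)" using 4(3) st L by (simp add: fr)
      moreover have "L + 1 \<le> M" using L YM by linarith
      ultimately show ?case
        by (intro wp_ISet) (use L M3 in auto)
    qed
  qed auto
qed

end

section \<open>Ball values, chains and levels as computed by the program\<close>

locale ball_run = final_run +
  fixes \<mu> :: "nat \<Rightarrow> real" and r0 :: real and L :: nat
  assumes \<mu>0: "i < N \<Longrightarrow> 0 \<le> \<mu> i" and r0: "0 < r0" and LY: "L \<le> Y + 6"
    and r_first: "i < N \<Longrightarrow> j < N \<Longrightarrow> cd i j \<le> 2 * r0"
    and r_last: "i < N \<Longrightarrow> j < N \<Longrightarrow> i \<noteq> j \<Longrightarrow> 44 * (r0 / 3 ^ L) \<le> cd i j"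
begin

abbreviation Rad :: "nat \<Rightarrow> real" where "Rad j \<equiv> r0 / 3 ^ j"

sublocale G: ball_greedy N cd \<mu> Rad L
proof -
  interpret cd: Metric_space "{..<N}" cd by (rule cd_metric)
  show "ball_greedy N cd \<mu> Rad L"
  proof
    show "cd x y \<le> 132 * Rad 0" if "x < N" "y < N" for x y using r_first[OF that] r0 by simp
  qed (use \<mu>0 r0 r_last in auto)
qed

definition bst :: "state \<Rightarrow> bool" where
  "bst s \<longleftrightarrow> ivar s ''nc'' = N \<and> iarr s ''C'' = C \<and> ivar s ''L'' = L \<and> ivar s ''L1'' = Suc L
     \<and> (\<forall>l\<le>L. rarr s ''R'' l = Rad l)"

definition vst :: "state \<Rightarrow> bool" where
  "vst s \<longleftrightarrow> (\<forall>i<N. \<forall>l\<le>L. rarr s ''V'' (i * Suc L + l) = G.val i l)"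

lemma index_bound:
  assumes "i < N" "l \<le> Suc L"
  shows "i * Suc L + l \<le> M" "i * Suc L \<le> M" "i * L + (i + l) \<le> M" "i + i * L \<le> M"
proof -
  have "i * Suc L + l \<le> Suc i * Suc L" using assms by simp
  also have "\<dots> \<le> n * (8 * Y)"
  proof (rule mult_le_mono)
    show "Suc i \<le> n" using assms N by simp
    show "Suc L \<le> 8 * Y" using LY Y1 by linarith
  qed
  also have "\<dots> \<le> M" by (simp add: M)
  finally show *: "i * Suc L + l \<le> M" .
  then show "i * Suc L \<le> M" "i * L + (i + l) \<le> M" "i + i * L \<le> M" by simp_all
qed

lemma small: "Suc (Suc L) \<le> M" "6 \<le> M" "44 \<le> M" "L < M"
  using LY M_ge(2,3) Y1 by linarith+

lemma ball_values:
  assumes st: "bst s" "\<And>i. i < N \<Longrightarrow> rarr s ''mu'' i = \<mu> i"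
  shows "wp d M ball_values (\<lambda>s' \<tau>. vst s' \<and> \<tau> \<le> N * (Suc L * (60 * N + 60) + 60) + 10) s"
proof -
  have st0: "ivar s ''nc'' = N" "iarr s ''C'' = C" "ivar s ''L1'' = Suc L" "\<And>l. l \<le> L \<Longrightarrow> rarr s ''R'' l = Rad l"
    using st by (auto simp: bst_def)
  \<comment> \<open>The table is filled row by row, and quotient and remainder by
    \<open>Suc L\<close> decode a position; so the correctness of an initial part serves as
    invariant of both loops.\<close>
  define W where "W b s' \<longleftrightarrow> (\<forall>t<b. rarr s' ''V'' t = G.val (t div Suc L) (t mod Suc L))" for b and s' :: state
  show ?thesis
    unfolding ball_values_def
  proof (rule wp_For_const[where a = 0 and b = N and \<beta> = "Suc L * (60 * N + 60) + 60" and
        Inv = "\<lambda>i s'. W (i * Suc L) s'"], goal_cases)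
    case (9 i s1)
    note fr1 = frameD[OF 9(4), simplified]
    have st1: "ivar s1 ''nc'' = N" "iarr s1 ''C'' = C" "ivar s1 ''L1'' = Suc L" "\<And>l. l \<le> L \<Longrightarrow> rarr s1 ''R'' l = Rad l"
      "ivar s1 ''i'' = i" "\<And>i. i < N \<Longrightarrow> rarr s1 ''mu'' i = \<mu> i"
      using st0 st(2) 9(3) by (simp_all add: fr1)
    show ?case
    proof (rule wp_For_const[where a = 0 and b = "Suc L" and \<beta> = "60 * N + 60" and
        Inv = "\<lambda>l s'. W (i * Suc L + l) s'"], goal_cases)
      case 8
      then show ?case using 9(5) by (simp add: W_def)
    next
      case (9 l s2)
      note fr2 = frameD[OF 9(4), simplified]
      have st2: "ivar s2 ''nc'' = N" "iarr s2 ''C'' = C" "ivar s2 ''L1'' = Suc L" "rarr s2 ''R'' l = Rad l"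
        "ivar s2 ''i'' = i" "ivar s2 ''l'' = l" "\<And>i. i < N \<Longrightarrow> rarr s2 ''mu'' i = \<mu> i"
        using st1 9(2,3) by (simp_all add: fr2)
      show ?case
      proof (rule wp_Seq, rule wp_RSet, simp, rule wp_Seq,
          rule wp_For_const[where a = 0 and b = N and \<beta> = 60 and Inv = "\<lambda>y s'. rvar s' ''v'' =
            (\<Sum>y'<y. \<mu> y' * max 0 ((Rad l)\<^sup>2 - (cd i y')\<^sup>2))"], goal_cases)
        case (9 y s3)
        note fr3 = frameD[OF 9(4), simplified]
        have st3: "iarr s3 ''C'' = C" "rarr s3 ''R'' l = Rad l" "ivar s3 ''i'' = i" "ivar s3 ''l'' = l"
           "rarr s3 ''mu'' y = \<mu> y" using st2 9(2) by (simp_all add: fr3)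
        show ?case
          by (intro wp_intros) (use 9(3,5) st3 G.val_term[of l i y] in \<open>simp_all add: cd_def\<close>)
      next
        case (10 s3 \<tau>3)
        note fr3 = frameD[OF 10(1), simplified]
        have v: "rvar s3 ''v'' = G.val i l" using 10(3) by (simp add: G.val_def)
        have st3: "ivar s3 ''i'' = i" "ivar s3 ''l'' = l" "ivar s3 ''L1'' = Suc L" "rarr s3 ''V'' = rarr s2 ''V''"
          using st2 by (simp_all add: fr3)
        have dm: "(i * Suc L + l) div Suc L = i" "(i * Suc L + l) mod Suc L = l"
          using \<open>l < Suc L\<close> by (metis add.commute div_mult_self3 div_less add_0 nat.distinct(1), metis mod_mult_self3 mod_less)
        have ib: "i * Suc L + l \<le> M" "i * Suc L \<le> M" using index_bound[of i l] \<open>i < N\<close> \<open>l < Suc L\<close> by auto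
        have W': "W (i * Suc L + Suc l) s4"
          if "rarr s4 ''V'' = (rarr s2 ''V'')(i * Suc L + l := G.val i l)" for s4
          using \<open>W (i * Suc L + l) s2\<close> dm that by (simp add: W_def less_Suc_eq)
        show ?case
          by (intro wp_RPut) (use st3 v ib 10(4) in \<open>simp_all add: W'[simplified]\<close>)
      qed (use st2 in auto)
    next
      case (10 s2 \<tau>2)
      have "i * Suc L + Suc L = Suc i * Suc L" by simp
      with 10(3) have "W (Suc i * Suc L) s2" by metis
      then show ?case using 10(4) by (simp add: W_def)
    qed (use st1 in auto)
  next
    case (10 s1 \<tau>1)
    have "rarr s1 ''V'' (i * Suc L + l) = G.val i l" if "i < N" "l \<le> L" for i l
    proof -
      have "i * Suc L + l < Suc i * Suc L" using that by simp
      also have "\<dots> \<le> N * Suc L" using that by (intro mult_le_mono1) simp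
      finally have "i * Suc L + l < N * Suc L" .
      moreover have "(i * Suc L + l) div Suc L = i" "(i * Suc L + l) mod Suc L = l"
        using that by (metis add.commute div_mult_self3 div_less add_0 nat.distinct(1) less_Suc_eq_le, metis mod_mult_self3 mod_less less_Suc_eq_le)
      ultimately show ?thesis using 10(3) unfolding W_def by metis
    qed
    then show ?case using 10(4) by (simp add: vst_def)
  qed (use st0 in \<open>auto simp: W_def\<close>)
qed

lemma start_pick:
  assumes st: "bst s" "vst s" and J: "\<And>i. i < N \<Longrightarrow> iarr s ''J'' i \<le> Suc L" "\<exists>x<N. iarr s ''J'' x \<le> L"
  shows "wp d M start_pick (\<lambda>s' \<tau>. ivar s' ''u'' < N \<and> iarr s ''J'' (ivar s' ''u'') \<le> L
    \<and> (\<forall>i<N. iarr s ''J'' i \<le> L \<longrightarrow> G.val i (iarr s ''J'' i) \<le> G.val (ivar s' ''u'') (iarr s ''J'' (ivar s' ''u'')))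
    \<and> \<tau> \<le> N * 60 + 20) s"
  unfolding start_pick_def
proof (rule wp_Seq, rule wp_ISet, simp, rule wp_For_const[where a = 0 and b = N and \<beta> = 60 and Inv = "\<lambda>j s'.
   ivar s' ''u'' < N \<and> (\<forall>i<j. iarr s ''J'' i \<le> L \<longrightarrow> iarr s ''J'' (ivar s' ''u'') \<le> L \<and>
      G.val i (iarr s ''J'' i) \<le> G.val (ivar s' ''u'') (iarr s ''J'' (ivar s' ''u'')))"], goal_cases)
  case (9 j s1)
  note fr = frameD[OF 9(4), simplified]
  define u where "u = ivar s1 ''u''"
  have u: "u < N" "\<And>i. i < j \<Longrightarrow> iarr s ''J'' i \<le> L \<Longrightarrow> iarr s ''J'' u \<le> L \<and> G.val i (iarr s ''J'' i) \<le> G.val u (iarr s ''J'' u)"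
    using 9(5) by (auto simp: u_def)
  have st1: "ivar s1 ''L1'' = Suc L" "iarr s1 ''J'' = iarr s ''J''" "ivar s1 ''i'' = j" "ivar s1 ''u'' = u"
    and v1: "\<And>i l. i < N \<Longrightarrow> l \<le> L \<Longrightarrow> rarr s1 ''V'' (i + i * L + l) = G.val i l"
    using st 9(3) by (simp_all add: fr bst_def vst_def u_def)
  define b where "b \<longleftrightarrow> iarr s ''J'' j \<le> L \<and> \<not> (iarr s ''J'' u \<le> L \<and> \<not> G.val u (iarr s ''J'' u) < G.val j (iarr s ''J'' j))"
  have bv: "bval d s1 (BAnd (ILess (IGet ''J'' (IVar ''i'')) (IVar ''L1''))
              (BNot (BAnd (ILess (IGet ''J'' (IVar ''u'')) (IVar ''L1''))
                (BNot (RLess (value_at ''u'' (IGet ''J'' (IVar ''u''))) (value_at ''i'' (IGet ''J'' (IVar ''i'')))))))) \<longleftrightarrow> b"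
    using u(1) 9(2) v1 by (auto simp: st1 b_def less_Suc_eq_le)
  show ?case
  proof (rule wp_Cond, goal_cases)
    case 1
    show ?case using index_bound[OF \<open>j < N\<close> J(1)[OF \<open>j < N\<close>]] index_bound[OF u(1) J(1)[OF u(1)]]
      by (simp add: st1 add.assoc add.left_commute)
  next
    case 2
    then have b using bv by blast
    then have "\<And>i. i < j \<Longrightarrow> iarr s ''J'' i \<le> L \<Longrightarrow> G.val i (iarr s ''J'' i) \<le> G.val j (iarr s ''J'' j)" "iarr s ''J'' j \<le> L"
      using u(2) unfolding b_def by fastforce+
    then show ?case by (intro wp_ISet) (use 9(2) in \<open>simp_all add: st1 less_Suc_eq\<close>)
  next
    case 3
    then have "\<not> b" using bv by blast
    then have "iarr s ''J'' j \<le> L \<Longrightarrow> iarr s ''J'' u \<le> L \<and> G.val j (iarr s ''J'' j) \<le> G.val u (iarr s ''J'' u)"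
      unfolding b_def by fastforce
    then show ?case by (intro wp_Skip) (use u in \<open>simp add: st1 less_Suc_eq\<close>)
  qed
next
  case (10 s1 \<tau>1)
  then show ?case using J(2) by auto
qed (use st N in \<open>auto simp: bst_def\<close>)

lemma descend:
  assumes st: "bst s" "vst s" and u: "ivar s ''u'' = u" "u < N" and a: "iarr s ''J'' u = a" "a \<le> L"
  shows "wp d M descend (\<lambda>s' \<tau>. (\<exists>c. G.descent c a L \<and> c a = u \<and> ivar s' ''u'' = c L)
    \<and> \<tau> \<le> L * (60 * N + 60) + 10) s"
  unfolding descend_def
proof (rule wp_For_const[where a = a and b = L and \<beta> = "60 * N + 60" and Inv = "\<lambda>l s'.
   (\<exists>c. G.descent c a l \<and> c a = u \<and> ivar s' ''u'' = c l)"], goal_cases)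
  case 8
  show ?case using u by (intro exI[of _ "\<lambda>_. u"]) (simp add: G.descent_refl)
next
  case (9 l s1)
  note fr = frameD[OF 9(4), simplified]
  from 9(5) obtain c where c: "G.descent c a l" "c a = u" "ivar s1 ''u'' = c l" by blast
  have st1: "ivar s1 ''L1'' = Suc L" "iarr s1 ''C'' = C" "rarr s1 ''R'' l = Rad l" "ivar s1 ''l'' = l" "ivar s1 ''nc'' = N"
    and v1: "\<And>i l. i < N \<Longrightarrow> l \<le> L \<Longrightarrow> rarr s1 ''V'' (i + i * L + l) = G.val i l"
    using st 9(2,3) by (simp_all add: fr bst_def vst_def)
  have cl: "c l < N" using c(1) 9(1) by (simp add: G.descent_def)
  show ?case
  proof (rule wp_Seq, rule wp_ISet, simp, rule wp_Seq, rule wp_For_const[where a = 0 and b = N and \<beta> = 60 and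
        Inv = "\<lambda>y s'. ivar s' ''b'' < N \<and> cd (c l) (ivar s' ''b'') \<le> 6 * Rad l \<and>
          (\<forall>y'<y. cd (c l) y' \<le> 6 * Rad l \<longrightarrow> G.val y' (Suc l) \<le> G.val (ivar s' ''b'') (Suc l))"], goal_cases)
    case 8
    show ?case using c(3) cl r0 by (simp add: cd_def C(2))
  next
    case (9 y s2)
    note fr2 = frameD[OF 9(4), simplified]
    define b where "b = ivar s2 ''b''"
    have b: "b < N" "cd (c l) b \<le> 6 * Rad l" "\<And>y'. y' < y \<Longrightarrow> cd (c l) y' \<le> 6 * Rad l \<Longrightarrow> G.val y' (Suc l) \<le> G.val b (Suc l)"
      using 9(5) by (auto simp: b_def)
    have st2: "ivar s2 ''L1'' = Suc L" "iarr s2 ''C'' = C" "rarr s2 ''R'' l = Rad l" "ivar s2 ''l'' = l"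
        "ivar s2 ''y'' = y" "ivar s2 ''b'' = b" "ivar s2 ''u'' = c l"
      and v2: "\<And>i l. i < N \<Longrightarrow> l \<le> L \<Longrightarrow> rarr s2 ''V'' (i + i * L + l) = G.val i l"
      using st1 v1 c(3) 9(3) by (simp_all add: fr2 b_def)
    have vv: "rarr s2 ''V'' (b + b * L + Suc l) = G.val b (Suc l)" "rarr s2 ''V'' (y + y * L + Suc l) = G.val y (Suc l)"
      using v2[of b "Suc l"] v2[of y "Suc l"] b(1) 9(2) \<open>l < L\<close> by auto
    define g where "g \<longleftrightarrow> cd (c l) y \<le> 6 * Rad l \<and> G.val b (Suc l) < G.val y (Suc l)"
    have bv: "bval d s2 (BAnd (BNot (RLess (RMul (RNat (INum 6)) (RGet ''R'' (IVar ''l'')))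
                     (RDist (IGet ''C'' (IVar ''u'')) (IGet ''C'' (IVar ''y'')))))
                (RLess (value_at ''b'' (IAdd (IVar ''l'') (INum 1))) (value_at ''y'' (IAdd (IVar ''l'') (INum 1))))) \<longleftrightarrow> g"
      using vv by (simp add: st2 g_def cd_def not_less add.assoc)
    have lL: "Suc l \<le> Suc L" "Suc l \<le> M" using \<open>l < L\<close> small by auto
    show ?case
    proof (rule wp_Cond, goal_cases)
      case 1
      show ?case using index_bound[OF \<open>y < N\<close> lL(1)] index_bound[OF b(1) lL(1)] lL(2) small
        by (simp add: st2 add.assoc add.left_commute)
    next
      case 2
      then have g using bv by blast
      then have "cd (c l) y \<le> 6 * Rad l"
        "\<And>y'. y' < y \<Longrightarrow> cd (c l) y' \<le> 6 * Rad l \<Longrightarrow> G.val y' (Suc l) \<le> G.val y (Suc l)"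
        using b(3) unfolding g_def by fastforce+
      then show ?case by (intro wp_ISet) (use 9(2) in \<open>simp_all add: st2 less_Suc_eq\<close>)
    next
      case 3
      then have "\<not> g" using bv by blast
      then have "cd (c l) y \<le> 6 * Rad l \<Longrightarrow> G.val y (Suc l) \<le> G.val b (Suc l)" unfolding g_def by fastforce
      then show ?case by (intro wp_Skip) (use b in \<open>simp add: st2 less_Suc_eq\<close>)
    qed
  next
    case (10 s2 \<tau>2)
    define b where "b = ivar s2 ''b''"
    have b: "b < N" "cd (c l) b \<le> 6 * Rad l" "\<And>y. y < N \<Longrightarrow> cd (c l) y \<le> 6 * Rad l \<Longrightarrow> G.val y (Suc l) \<le> G.val b (Suc l)"
      using 10(3) by (auto simp: b_def)
    have "G.descent (c(Suc l := b)) a (Suc l)" by (rule G.descent_Suc[OF c(1) \<open>a \<le> l\<close> b])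
    moreover have "(c(Suc l := b)) a = u" using c(2) \<open>a \<le> l\<close> by simp
    ultimately have "\<exists>c'. G.descent c' a (Suc l) \<and> c' a = u \<and> b = c' (Suc l)"
      by (intro exI[of _ "c(Suc l := b)"]) simp
    then show ?case by (intro wp_ISet) (use 10(4) in \<open>simp_all add: b_def\<close>)
  qed (use st1 in auto)
next
  case (10 s1 \<tau>1)
  have "(L - a) * (60 * N + 60) \<le> L * (60 * N + 60)" by (intro mult_le_mono1) simp
  moreover have "isize (IGet ''J'' (IVar ''u'')) = 2" by simp
  ultimately have "\<tau>1 \<le> L * (60 * N + 60) + 10" using 10(4) by linarith
  then show ?case using 10(3) by blast
qed (use st u a in \<open>auto simp: bst_def\<close>)

lemma raise_levels:
  assumes st: "bst s" and J: "G.levels_ok z m (iarr s ''J'')" and u: "ivar s ''u'' = z m"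
  shows "wp d M raise_levels (\<lambda>s' \<tau>. G.levels_ok z (Suc m) (iarr s' ''J'') \<and> \<tau> \<le> N * (Suc L * 50 + 30) + 10) s"
  unfolding raise_levels_def
proof (rule wp_For_const[where a = 0 and b = N and \<beta> = "Suc L * 50 + 30" and Inv = "\<lambda>i s'.
   (\<forall>x<i. G.scanned z m x (Suc L) (iarr s' ''J'' x)) \<and> (\<forall>x\<ge>i. iarr s' ''J'' x = iarr s ''J'' x)"], goal_cases)
  case (9 i s1)
  note fr = frameD[OF 9(4), simplified]
  have st1: "ivar s1 ''L1'' = Suc L" "iarr s1 ''C'' = C" "\<And>l. l \<le> L \<Longrightarrow> rarr s1 ''R'' l = Rad l"
      "ivar s1 ''i'' = i" "ivar s1 ''u'' = z m"
    using st u 9(3) by (simp_all add: fr bst_def)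
  show ?case
  proof (rule wp_For_const[where a = 0 and b = "Suc L" and \<beta> = 50 and Inv = "\<lambda>l s'.
      (\<forall>x<i. G.scanned z m x (Suc L) (iarr s' ''J'' x)) \<and> (\<forall>x>i. iarr s' ''J'' x = iarr s ''J'' x)
      \<and> G.scanned z m i l (iarr s' ''J'' i)"], goal_cases)
    case 8
    show ?case using 9(5) G.scanned_0[OF J \<open>i < N\<close>] by simp
  next
    case (9 l s2)
    note fr2 = frameD[OF 9(4), simplified]
    have st2: "ivar s2 ''L1'' = Suc L" "iarr s2 ''C'' = C" "rarr s2 ''R'' l = Rad l"
      "ivar s2 ''i'' = i" "ivar s2 ''u'' = z m" "ivar s2 ''l'' = l"
      using st1 9(2,3) by (simp_all add: fr2)
    have lL: "l \<le> L" "Suc l \<le> M" using 9(2) small by auto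
    have sc: "G.scanned z m i l (iarr s2 ''J'' i)" using 9(5) by blast
    define g where "g \<longleftrightarrow> iarr s2 ''J'' i = l \<and> cd i (z m) < 44 * Rad l"
    have bv: "bval d s2 (BAnd (BAnd (BNot (ILess (IGet ''J'' (IVar ''i'')) (IVar ''l''))) (BNot (ILess (IVar ''l'') (IGet ''J'' (IVar ''i'')))))
              (RLess (RDist (IGet ''C'' (IVar ''i'')) (IGet ''C'' (IVar ''u''))) (RMul (RNat (INum 44)) (RGet ''R'' (IVar ''l''))))) \<longleftrightarrow> g"
      by (auto simp: st2 g_def cd_def)
    show ?case
    proof (rule wp_Cond, goal_cases)
      case 1
      show ?case using small by simp
    next
      case 2
      then have g using bv by blast
      then have "G.scanned z m i (Suc l) (Suc l)" using G.scanned_Suc(1)[OF sc lL(1)] unfolding g_def by blast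
      then show ?case by (intro wp_IPut) (use 9(5) lL in \<open>simp_all add: st2\<close>)
    next
      case 3
      then have "\<not> g" using bv by blast
      then have "G.scanned z m i (Suc l) (iarr s2 ''J'' i)" using G.scanned_Suc(2)[OF sc lL(1)] unfolding g_def by blast
      then show ?case by (intro wp_Skip) (use 9(5) in simp)
    qed
  next
    case (10 s2 \<tau>2)
    then show ?case by (simp add: less_Suc_eq)
  qed (use st1 in auto)
next
  case (10 s1 \<tau>1)
  have "G.levels_ok z (Suc m) (iarr s1 ''J'')" by (rule G.scanned_all) (use 10(3) in blast)
  then show ?case using 10(4) by simp
qed (use st in \<open>auto simp: bst_def\<close>)

end

section \<open>The sequence of picks and the cost of the resulting centres\<close>

context ball_run
begin

definition picks :: com where
  "picks = For ''m'' (INum 0) ''kk'' (Seq start_pick (Seq descend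
     (Seq (IPut ''S'' (IVar ''m'') (IGet ''C'' (IVar ''u''))) raise_levels)))"

text \<open>\<open>kk <= N\<close> guarantees that each round still finds an unchosen point;
  \<open>start_pick\<close>, \<open>descend\<close> and \<open>raise_levels\<close> then provide
  what \<open>greedy_run_Suc\<close> and \<open>levels_ok\<close> ask for.\<close>

lemma picks:
  assumes st: "bst s" "vst s" and J: "\<And>i. i < N \<Longrightarrow> iarr s ''J'' i = 0" and kk: "ivar s ''kk'' = kk" "kk \<le> N"
  shows "wp d M picks (\<lambda>s' \<tau>. ivar s' ''m'' = kk \<and>
     (\<exists>z a ch. G.greedy_run z kk a ch \<and> (\<forall>i<kk. iarr s' ''S'' i = C (z i)))
     \<and> \<tau> \<le> kk * (3000 * N * Y + 1000 * Y) + 10) s"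
  unfolding picks_def
proof (rule wp_For_const[where a = 0 and b = kk and \<beta> = "3000 * N * Y + 1000 * Y" and Inv = "\<lambda>m s'.
   \<exists>z a ch. G.greedy_run z m a ch \<and> (\<forall>i<m. iarr s' ''S'' i = C (z i)) \<and> G.levels_ok z m (iarr s' ''J'')"], goal_cases)
  case 8
  show ?case
    by (rule exI, rule exI, rule exI, intro conjI G.levels_ok_0) (use J in \<open>auto simp: G.greedy_run_def\<close>)
next
  case (9 m s1)
  note fr1 = frameD[OF 9(4), simplified]
  from 9(5) obtain z a ch where z: "G.greedy_run z m a ch" "\<And>i. i < m \<Longrightarrow> iarr s1 ''S'' i = C (z i)"
    and lv: "G.levels_ok z m (iarr s1 ''J'')" by blast
  have st1: "bst s1" "vst s1" using st by (simp_all add: bst_def vst_def fr1)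
  have zN: "z i < N" if "i < m" for i
    using z(1) that unfolding G.greedy_run_def by (metis order_refl)
  have J1: "iarr s1 ''J'' i \<le> Suc L" if "i < N" for i using lv that by (simp add: G.levels_ok_def)
  have un: "\<exists>x<N. iarr s1 ''J'' x \<le> L" using G.levels_ok_unpicked[OF lv _ zN] 9(2) kk by simp
  show ?case
  proof (rule wp_Seq, rule wp_use[OF start_pick[OF st1 J1 un]], goal_cases)
    case (2 s2 \<tau>2)
    note fr2 = frameD[OF 2(1), simplified]
    note t2 = 2(2)
    define u where "u = ivar s2 ''u''"
    define b where "b = iarr s1 ''J'' u"
    have u: "u < N" "b \<le> L" "\<And>i. i < N \<Longrightarrow> iarr s1 ''J'' i \<le> L \<Longrightarrow> G.val i (iarr s1 ''J'' i) \<le> G.val u b"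
      using 2(2) by (simp_all add: u_def b_def)
    have i2: "iarr s2 = iarr s1" by (rule ext) (simp add: fr2)
    have st2: "bst s2" "vst s2" "ivar s2 ''u'' = u" "iarr s2 ''J'' u = b"
      using st1 by (simp_all add: bst_def vst_def fr2 u_def b_def)
    show ?case
    proof (rule wp_Seq, rule wp_use[OF descend[OF st2(1,2,3) u(1) st2(4) u(2)]], goal_cases)
      case (1 s3 \<tau>3)
      note fr3 = frameD[OF 1(1), simplified]
      from 1(2) obtain c where c: "G.descent c b L" "c b = u" "ivar s3 ''u'' = c L" and t3: "\<tau>3 \<le> L * (60 * N + 60) + 10"
        by blast
      have "iarr s3 = iarr s2" by (rule ext) (simp add: fr3)
      then have st3: "bst s3" "iarr s3 = iarr s1" "ivar s3 ''m'' = m"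
        using st2(1) i2 \<open>ivar s1 ''m'' = m\<close> by (simp_all add: bst_def fr3 fr2)
      have C3: "iarr s3 ''C'' = C" using st3(1) by (simp add: bst_def)
      have isou: "G.iso z m u b" using lv u(1,2) unfolding G.levels_ok_def b_def by blast
      have best: "G.val x j \<le> G.val (c b) b" if "x < N" "j \<le> L" "G.iso z m x j" for x j
        unfolding c(2) by (rule G.levels_ok_best[OF lv _ that]) (rule u(3))
      have run': "G.greedy_run (z(m := c L)) (Suc m) (a(m := b)) (ch(m := c))"
        by (rule G.greedy_run_Suc[OF z(1) c(1) u(2)]) (use isou c(2) best in auto)
      define s4 where "s4 = s3\<lparr>iarr := (iarr s3)(''S'' := (iarr s3 ''S'')(m := C (c L)))\<rparr>"
      have st4: "bst s4" using st3(1) by (simp add: s4_def bst_def)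
      have lv4: "G.levels_ok (z(m := c L)) m (iarr s4 ''J'')"
        using lv G.iso_cong[of m "z(m := c L)" z] st3(2) by (simp add: s4_def G.levels_ok_def)
      have u4: "ivar s4 ''u'' = (z(m := c L)) m" using c(3) by (simp add: s4_def)
      show ?case
      proof (rule wp_Seq, rule wp_IPut, goal_cases)
        case 3
        have e: "s3\<lparr>iarr := (iarr s3)(''S'' := (iarr s3 ''S'')(ival s3 (IVar ''m'') := ival s3 (IGet ''C'' (IVar ''u''))))\<rparr> = s4"
          using st3(3) c(3) C3 by (simp add: s4_def)
        show ?case unfolding e
        proof (rule wp_use[OF raise_levels[OF st4 lv4 u4]], goal_cases)
          case (1 s5 \<tau>5)
          note fr5 = frameD[OF 1(1), simplified]
          have S5: "iarr s5 ''S'' i = C ((z(m := c L)) i)" if "i < Suc m" for i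
            using that z(2) st3(2) by (auto simp: fr5 s4_def less_Suc_eq)
          have time: "\<tau>2 + (\<tau>3 + (1 + isize (IVar ''m'') + isize (IGet ''C'' (IVar ''u'')) + \<tau>5)) + 8 \<le> 3000 * N * Y + 1000 * Y"
          proof -
            have Lb: "L \<le> 7 * Y" "Suc L \<le> 8 * Y" using LY Y1 by linarith+
            have "L * (60 * N + 60) \<le> 7 * Y * (60 * N + 60)" by (rule mult_le_mono1[OF Lb(1)])
            also have "\<dots> = 420 * (N * Y) + 420 * Y" by (simp add: algebra_simps)
            finally have 3: "\<tau>3 \<le> 420 * (N * Y) + 420 * Y + 10" using t3 by linarith
            have "N * (Suc L * 50 + 30) \<le> N * (8 * Y * 50 + 30)" using Lb(2) by (intro mult_le_mono2 add_le_mono1 mult_le_mono1)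
            also have "\<dots> = 400 * (N * Y) + 30 * N" by (simp add: algebra_simps)
            finally have 5: "\<tau>5 \<le> 400 * (N * Y) + 30 * N + 10" using 1(2) by linarith
            have "N \<le> N * Y" using Y1 by simp
            moreover have "\<tau>2 \<le> 60 * N + 20" using t2 by linarith
            moreover have "1 + isize (IVar ''m'') + isize (IGet ''C'' (IVar ''u'')) = 4" by simp
            ultimately have "\<tau>2 + (\<tau>3 + (1 + isize (IVar ''m'') + isize (IGet ''C'' (IVar ''u'')) + \<tau>5)) + 8
                \<le> 3000 * (N * Y) + 1000 * Y" using 3 5 Y1 by linarith
            then show ?thesis by simp
          qed
          show ?case
          proof (intro conjI exI)
            show "G.greedy_run (z(m := c L)) (Suc m) (a(m := b)) (ch(m := c))" by (rule run')
            show "\<forall>i<Suc m. iarr (s5\<lparr>ivar := (ivar s5)(''m'' := Suc m)\<rparr>) ''S'' i = C ((z(m := c L)) i)"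
              using S5 by simp
            have J5: "iarr (s5\<lparr>ivar := (ivar s5)(''m'' := Suc m)\<rparr>) ''J'' = iarr s5 ''J''" by simp
            show "G.levels_ok (z(m := c L)) (Suc m) (iarr (s5\<lparr>ivar := (ivar s5)(''m'' := Suc m)\<rparr>) ''J'')"
              unfolding J5 by (rule conjunct1[OF 1(2)])
          qed (rule time)
        qed
      qed auto
    qed
  qed
next
  case (10 s1 \<tau>1)
  then show ?case by auto
qed (use kk in auto)

text \<open>The weights on the representatives are those of the points assigned to them, so the cost
  guarantee of the greedy centres carries over to the original points up to the assignment cost.\<close>

lemma picks_cost:
  assumes p: "nearest p {..<n}" and mu: "\<And>i. i < N \<Longrightarrow> \<mu> i = sum w {x\<in>{..<n}. p x = i}"
    and run: "G.greedy_run z kk a ch" and kk: "kk = min k N"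
    and Q: "Q \<subseteq> {..<n}" "Q \<noteq> {}" "card Q \<le> k"
  defines "A \<equiv> C ` {..<N}" and "Ce \<equiv> C ` z ` {..<kk}"
  shows "sqrt (\<Sum>x<n. w x * (dist_to_set d x Ce)\<^sup>2)
    \<le> 1000 * (sqrt (\<Sum>x<n. w x * (dist_to_set d x A)\<^sup>2) + sqrt (\<Sum>x<n. w x * (dist_to_set d x Q)\<^sup>2))"
proof -
  have A: "A \<subseteq> {..<n}" "A \<noteq> {}" "finite A" using C N unfolding A_def by (auto simp: lessThan_empty_iff)
  have finQ: "finite Q" using Q(1) finite_subset by blast
  have kk1: "1 \<le> kk" using kk k1 N by simp
  \<comment> \<open>The reduced problem knows only candidates, so the competitor is first moved into
    \<open>A\<close>; \<open>X\<close> below lists its indices.\<close>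
  obtain P where P: "P \<subseteq> A" "P \<noteq> {}" "card P \<le> k"
    "\<And>x. x < n \<Longrightarrow> dist_to_set d x P \<le> 2 * dist_to_set d x Q + dist_to_set d x A"
    using restrict_centers[OF A(1,2) Q] by blast
  define X where "X = {i. i < N \<and> C i \<in> P}"
  have CX: "C ` X = P" using P(1) by (auto simp: X_def A_def)
  have injX: "inj_on C X" using C(1) by (rule inj_on_subset) (auto simp: X_def)
  have X: "X \<subseteq> {..<N}" "X \<noteq> {}" using CX P(2) by (auto simp: X_def)
  have "card X = card P" using card_image[OF injX] CX by simp
  moreover have "card X \<le> N" using card_mono[OF _ X(1)] by simp
  ultimately have cX: "card X \<le> kk" using kk P(3) by simp
  interpret gc: greedy_centers N cd \<mu> Rad L kk z a ch X
    using run kk1 X cX by unfold_locales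
  have pN: "p x < N" and pd: "d x (C (p x)) = dist_to_set d x A" if "x < n" for x
  proof -
    show pN: "p x < N" using p that by (simp add: nearest_def)
    show "d x (C (p x)) = dist_to_set d x A"
    proof (rule antisym)
      show "dist_to_set d x A \<le> d x (C (p x))" using pN A by (intro dist_to_set_le) (auto simp: A_def)
      show "d x (C (p x)) \<le> dist_to_set d x A" using p that A by (intro dist_to_set_ge) (auto simp: nearest_def A_def)
    qed
  qed
  \<comment> \<open>Grouping the points by their representative turns sums with the weights
    \<open>\<mu>\<close> into sums over the original points.\<close>
  have transfer: "(\<Sum>i<N. \<mu> i * f i) = (\<Sum>x<n. w x * f (p x))" for f :: "nat \<Rightarrow> real"
  proof -
    have "(\<Sum>i<N. \<mu> i * f i) = (\<Sum>i<N. \<Sum>x\<in>{x\<in>{..<n}. p x = i}. w x * f (p x))"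
      using mu by (intro sum.cong) (auto simp: sum_distrib_right)
    also have "\<dots> = (\<Sum>x<n. w x * f (p x))"
      using pN by (intro sum.group) auto
    finally show ?thesis .
  qed
  have cdS: "dist_to_set cd i S = dist_to_set d (C i) (C ` S)" for i S
    by (simp add: dist_to_set_def cd_def image_image)
  define cA where "cA = sqrt (\<Sum>x<n. w x * (dist_to_set d x A)\<^sup>2)"
  define cQ where "cQ = sqrt (\<Sum>x<n. w x * (dist_to_set d x Q)\<^sup>2)"
  have zN: "z ` {..<kk} \<subseteq> {..<N}" using gc.run_zN by auto
  have Ce: "Ce \<subseteq> {..<n}" "Ce \<noteq> {}" "finite Ce" using zN C kk1 unfolding Ce_def by (auto simp: lessThan_empty_iff)
  \<comment> \<open>A representative is itself a candidate, so its distance to \<open>A\<close>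
    vanishes and only twice its distance to \<open>Q\<close> remains.\<close>
  have toP: "dist_to_set d (C (p x)) P \<le> 2 * (dist_to_set d x A + dist_to_set d x Q)" if x: "x < n" for x
  proof -
    have cn: "C (p x) < n" using C(2) pN[OF x] by simp
    have cA: "C (p x) \<in> A" using pN[OF x] by (simp add: A_def)
    have "dist_to_set d (C (p x)) A \<le> d (C (p x)) (C (p x))" using A cA by (intro dist_to_set_le) auto
    then have zero: "dist_to_set d (C (p x)) A \<le> 0" using cn by simp
    obtain c where c: "c \<in> Q" "dist_to_set d x Q = d x c" using dist_to_set_attained[OF finQ Q(2)] by metis
    have "dist_to_set d (C (p x)) Q \<le> d (C (p x)) c" using finQ c by (intro dist_to_set_le) auto
    also have "\<dots> \<le> d (C (p x)) x + d x c" using cn x c Q by (intro triangle) auto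
    also have "\<dots> = dist_to_set d x A + dist_to_set d x Q" using pd[OF x] c commute[of "C (p x)" x] by simp
    finally show ?thesis using P(4)[OF cn] zero by simp
  qed
  have finP: "finite P" using P(1) A(3) finite_subset by blast
  have "sqrt (\<Sum>x<n. w x * (dist_to_set d (C (p x)) P)\<^sup>2)
      \<le> sqrt (\<Sum>x<n. w x * (2 * (dist_to_set d x A + dist_to_set d x Q))\<^sup>2)"
    using toP w0 finP P(2) by (intro real_sqrt_le_mono sum_mono mult_left_mono power_mono) (auto intro: dist_nonneg)
  also have "\<dots> = 2 * sqrt (\<Sum>x<n. w x * (dist_to_set d x A + dist_to_set d x Q)\<^sup>2)"
    by (rule cost_scale) auto
  also have "\<dots> \<le> 2 * (cA + cQ)" unfolding cA_def cQ_def by (intro mult_left_mono cost_triangle) auto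
  finally have sP: "sqrt (\<Sum>x<n. w x * (dist_to_set d (C (p x)) P)\<^sup>2) \<le> 2 * (cA + cQ)" .
  have "(\<Sum>x<n. w x * (dist_to_set d (C (p x)) Ce)\<^sup>2) \<le> 110000 * (\<Sum>x<n. w x * (dist_to_set d (C (p x)) P)\<^sup>2)"
    using gc.greedy_centers_cost unfolding transfer cdS CX Ce_def by (simp add: image_image)
  then have "sqrt (\<Sum>x<n. w x * (dist_to_set d (C (p x)) Ce)\<^sup>2)
      \<le> sqrt (110000 * (\<Sum>x<n. w x * (dist_to_set d (C (p x)) P)\<^sup>2))" by (rule real_sqrt_le_mono)
  also have "\<dots> = sqrt 110000 * sqrt (\<Sum>x<n. w x * (dist_to_set d (C (p x)) P)\<^sup>2)" by (rule real_sqrt_mult)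
  \<comment> \<open>The root of 110000 is below 400. The resulting 800, plus once the assignment
    cost \<open>cA\<close>, fits into the final 1000.\<close>
  also have "\<dots> \<le> 400 * (2 * (cA + cQ))"
  proof (rule mult_mono[OF _ sP])
    show "sqrt 110000 \<le> (400::real)" by (rule real_le_lsqrt) auto
  qed (auto intro!: sum_nonneg mult_nonneg_nonneg w0)
  finally have sO: "sqrt (\<Sum>x<n. w x * (dist_to_set d (C (p x)) Ce)\<^sup>2) \<le> 800 * (cA + cQ)" by simp
  have near: "dist_to_set d x Ce \<le> dist_to_set d x A + dist_to_set d (C (p x)) Ce" if x: "x < n" for x
  proof -
    obtain y where y: "y \<in> Ce" "dist_to_set d (C (p x)) Ce = d (C (p x)) y" using dist_to_set_attained[OF Ce(3,2)] by metis
    have "dist_to_set d x Ce \<le> d x y" using Ce y by (intro dist_to_set_le) auto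
    also have "\<dots> \<le> d x (C (p x)) + d (C (p x)) y" using x y Ce C(2) pN[OF x] by (intro triangle) auto
    finally show ?thesis using y pd[OF x] by simp
  qed
  have "sqrt (\<Sum>x<n. w x * (dist_to_set d x Ce)\<^sup>2)
      \<le> sqrt (\<Sum>x<n. w x * (dist_to_set d x A + dist_to_set d (C (p x)) Ce)\<^sup>2)"
    using near w0 Ce by (intro real_sqrt_le_mono sum_mono mult_left_mono power_mono) (auto intro: dist_nonneg)
  also have "\<dots> \<le> cA + sqrt (\<Sum>x<n. w x * (dist_to_set d (C (p x)) Ce)\<^sup>2)"
    unfolding cA_def by (rule cost_triangle) auto
  also have "\<dots> \<le> cA + 800 * (cA + cQ)" using sO by simp
  also have "\<dots> \<le> 1000 * (cA + cQ)"
  proof -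
    have "0 \<le> cA" "0 \<le> cQ" unfolding cA_def cQ_def
      by (auto intro!: real_sqrt_ge_zero sum_nonneg mult_nonneg_nonneg w0)
    then show ?thesis by simp
  qed
  finally show ?thesis by (simp add: cA_def cQ_def)
qed

end

context kmeans_run
begin

text \<open>Candidates, weights, radii and levels are known only from intermediate states, so the
  locales are interpreted after the passes that produce their parameters. The time uses that only
  \<open>6 * k * Y\<close> candidates are left: a product of \<open>n\<close> and their number is
  still affordable.\<close>

lemma final_stage:
  assumes inp: "inp s" and ne: "alv s \<noteq> {}" and cd: "card (alv s) \<le> 6 * k * Y"
    and Q: "Q \<subseteq> {..<n}" "Q \<noteq> {}" "card Q \<le> k"
  shows "wp d M final_stage (\<lambda>s' \<tau>. output_set s' \<subseteq> {..<n} \<and> output_set s' \<noteq> {} \<and> card (output_set s') \<le> k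
    \<and> sqrt (\<Sum>x<n. w x * (dist_to_set d x (output_set s'))\<^sup>2)
      \<le> 1000 * (sqrt (\<Sum>x<n. w x * (dist_to_set d x (alv s))\<^sup>2) + sqrt (\<Sum>x<n. w x * (dist_to_set d x Q)\<^sup>2))
    \<and> \<tau> \<le> 20000 * n * k * Y\<^sup>2) s"
proof -
  define s1 where "s1 = s\<lparr>ivar := (ivar s)(''lo'' := 0, ''hi'' := n)\<rparr>"
  have st1: "inp s1" "ivar s1 ''lo'' = 0" "ivar s1 ''hi'' = n" using inp by (simp_all add: s1_def inp_def)
  show ?thesis
    unfolding final_stage_def
  proof (rule wp_Seq, rule wp_ISet, simp, rule wp_Seq, rule wp_ISet, simp, rule wp_Seq, goal_cases)
    case 1
    have e1: "s\<lparr>ivar := (ivar s)(''lo'' := ival s (INum 0)),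
        ivar := (ivar (s\<lparr>ivar := (ivar s)(''lo'' := ival s (INum 0))\<rparr>))
          (''hi'' := ival (s\<lparr>ivar := (ivar s)(''lo'' := ival s (INum 0))\<rparr>) (IVar ''n''))\<rparr> = s1"
      using inp by (simp add: s1_def inp_def)
    show ?case unfolding e1
    proof (rule wp_use[OF gather[OF st1(2,3)]], goal_cases)
      case (3 s2 \<tau>2)
      note fr2 = frameD[OF 3(1), simplified]
      define N where "N = ivar s2 ''nc''"
      define C where "C = iarr s2 ''C''"
      have im: "C ` {..<N} = alv s" and injC: "inj_on C {..<N}" and NB: "N \<le> n" and t2: "\<tau>2 \<le> 40 * n + 20"
        using 3(2) by (auto simp: N_def C_def alv_def s1_def)
      have Nc: "N = card (alv s)" using card_image[OF injC] im by simp
      have finA: "finite (alv s)" by (simp add: alv_def)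
      have N1: "1 \<le> N" using Nc ne finA by (metis One_nat_def Suc_leI card_gt_0_iff)
      have CN: "C i < n" if "i < N" for i using im that by (auto simp: alv_def)
      interpret F: final_run n d w k Y M dl N C
        using N1 NB injC CN by unfold_locales
      have st2: "ivar s2 ''nc'' = N" "ivar s2 ''n'' = n" "iarr s2 ''C'' = C" "\<And>x. x < n \<Longrightarrow> rarr s2 ''w'' x = w x" "ivar s2 ''k'' = k"
        using st1(1) by (simp_all add: inp_def fr2 N_def C_def)
      show ?case
      proof (rule wp_Seq, rule wp_use[OF F.weigh[OF st2(1-4)]], goal_cases)
        case (2 s3 \<tau>3)
        note fr3 = frameD[OF 2(1), simplified]
        from 2(2) obtain p where p: "F.nearest p {..<n}" "\<And>i. i < N \<Longrightarrow> rarr s3 ''mu'' i = sum w {x\<in>{..<n}. p x = i}"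
          and t3: "\<tau>3 \<le> n * (50 * N + 100)" by blast
        define \<mu> where "\<mu> i = sum w {x\<in>{..<n}. p x = i}" for i
        have st3: "ivar s3 ''nc'' = N" "iarr s3 ''C'' = C" "ivar s3 ''k'' = k" using st2 by (simp_all add: fr3)
        show ?case
        proof (rule wp_Seq, rule wp_use[OF F.extent[OF st3(1,2)]], goal_cases)
          case (1 s4 \<tau>4)
          note fr4 = frameD[OF 1(1), simplified]
          define r0 where "r0 = rvar s4 ''r''"
          define rm where "rm = rvar s4 ''rm''"
          have r: "0 < r0" "0 < rm" "r0 \<le> 2 ^ Y * rm" "\<And>i j. i < N \<Longrightarrow> j < N \<Longrightarrow> F.cd i j \<le> 2 * r0"
            "\<And>i j. i < N \<Longrightarrow> j < N \<Longrightarrow> i \<noteq> j \<Longrightarrow> rm \<le> F.cd i j" and t4: "\<tau>4 \<le> n * (50 * N + 150)"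
            using 1(2) unfolding r0_def rm_def by blast+
          have st4: "ivar s4 ''nc'' = N" "iarr s4 ''C'' = C" "ivar s4 ''k'' = k" "rarr s4 ''mu'' = rarr s3 ''mu''"
            using st3 by (simp_all add: fr4)
          show ?case
          proof (rule wp_Seq, rule wp_use[OF radii[OF r0_def[symmetric] rm_def[symmetric] r(1-3)]], goal_cases)
            case (1 s5 \<tau>5)
            note fr5 = frameD[OF 1(1), simplified]
            from 1(2) obtain L where L: "ivar s5 ''L'' = L" "ivar s5 ''L1'' = Suc L" "L \<le> Y + 6"
              "\<And>l. l \<le> L \<Longrightarrow> rarr s5 ''R'' l = r0 / 3 ^ l" "44 * (r0 / 3 ^ L) \<le> rm" and t5: "\<tau>5 \<le> 40 * Y + 300" by blast
            interpret B: ball_run n d w k Y M dl N C \<mu> r0 L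
            proof
              show "0 \<le> \<mu> i" if "i < N" for i unfolding \<mu>_def by (rule sum_nonneg) (simp add: w0)
              show "44 * (r0 / 3 ^ L) \<le> F.cd i j" if "i < N" "j < N" "i \<noteq> j" for i j
                using r(5)[OF that] L(5) by linarith
            qed (use r L in auto)
            have st5: "B.bst s5" "\<And>i. i < N \<Longrightarrow> rarr s5 ''mu'' i = \<mu> i" "ivar s5 ''k'' = k"
              using st4 L p(2) by (simp_all add: B.bst_def fr5 \<mu>_def)
            show ?case
            proof (rule wp_Seq, rule wp_use[OF B.ball_values[OF st5(1,2)]], simp, goal_cases)
              case (1 s6 \<tau>6)
              note fr6 = frameD[OF 1(1), simplified]
              have v6: "B.vst s6" and t6: "\<tau>6 \<le> N * (Suc L * (60 * N + 60) + 60) + 10" using 1(2) by auto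
              have st6: "B.bst s6" "ivar s6 ''k'' = k" using st5(1,3) by (simp_all add: B.bst_def fr6)
              have nc6: "ivar s6 ''nc'' = N" using st6(1) by (simp add: B.bst_def)
              show ?case
              proof (rule wp_Seq, rule wp_For_const[where a = 0 and b = N and \<beta> = 20 and Inv = "\<lambda>j s'.
                   \<forall>i<j. iarr s' ''J'' i = 0"], goal_cases)
                case (9 j s')
                then show ?case by (intro wp_intros) (auto simp: less_Suc_eq)
              next
                case (10 s7 \<tau>7)
                note fr7 = frameD[OF 10(1), simplified]
                note t7 = 10(4)
                have st7: "B.bst s7" "B.vst s7" "\<And>i. i < N \<Longrightarrow> iarr s7 ''J'' i = 0" "ivar s7 ''k'' = k" "ivar s7 ''nc'' = N"
                  using st6 v6 nc6 10(3) by (simp_all add: B.bst_def B.vst_def fr7)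
                define kk where "kk = min k N"
                define s8 where "s8 = s7\<lparr>ivar := (ivar s7)(''kk'' := kk)\<rparr>"
                have st8: "B.bst s8" "B.vst s8" "\<And>i. i < N \<Longrightarrow> iarr s8 ''J'' i = 0" "ivar s8 ''kk'' = kk" "kk \<le> N"
                  using st7 by (simp_all add: s8_def B.bst_def B.vst_def kk_def)
                have time: "30 + \<tau>2 + \<tau>3 + \<tau>4 + \<tau>5 + \<tau>6 + \<tau>7 + \<tau>9 \<le> 20000 * n * k * Y\<^sup>2"
                  if t9: "\<tau>9 \<le> kk * (3000 * N * Y + 1000 * Y) + 10" for \<tau>9
                proof -
                  define u where "u = n * k * Y\<^sup>2"
                  have kY: "k \<le> k * Y\<^sup>2" "Y \<le> Y\<^sup>2" "k * Y \<le> k * Y\<^sup>2" using Y1 by (simp_all add: power2_eq_square)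
                  have nN: "n * N \<le> 6 * (n * k * Y)" "n * k * Y \<le> u" "n \<le> u" "Y \<le> u" "1 \<le> u"
                  proof -
                    show "n * N \<le> 6 * (n * k * Y)" using mult_le_mono2[OF cd, of n] by (simp add: Nc mult_ac)
                    show "n * k * Y \<le> u" using mult_le_mono2[OF kY(3), of n] by (simp add: u_def mult_ac)
                    have "1 \<le> k * Y\<^sup>2" using k1 Y1 by simp
                    from mult_le_mono2[OF this, of n] show n: "n \<le> u" by (simp add: u_def mult_ac)
                    then show "1 \<le> u" using n1 by linarith
                    have "1 \<le> n * k" using n1 k1 by simp
                    from mult_le_mono1[OF this, of "Y\<^sup>2"] have "Y\<^sup>2 \<le> u" by (simp only: u_def mult_1)
                    with kY(2) show "Y \<le> u" by (rule le_trans)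
                  qed
                  have e3: "n * (50 * N + 100) = 50 * (n * N) + 100 * n" "n * (50 * N + 150) = 50 * (n * N) + 150 * n"
                    by (simp_all add: algebra_simps)
                  have "\<tau>6 \<le> 480 * (n * N * Y) + 480 * (n * Y) + 60 * n + 10"
                  proof -
                    have "Suc L \<le> 8 * Y" using L(3) Y1 by linarith
                    then have "N * (Suc L * (60 * N + 60) + 60) \<le> n * (8 * Y * (60 * N + 60) + 60)"
                      using NB by (intro mult_le_mono add_le_mono1 mult_le_mono1)
                    also have "\<dots> = 480 * (n * N * Y) + 480 * (n * Y) + 60 * n" by (simp add: algebra_simps)
                    finally show ?thesis using t6 by linarith
                  qed
                  moreover have "n * N * Y \<le> 6 * u" using mult_le_mono1[OF nN(1), of Y] by (simp add: u_def power2_eq_square mult_ac)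
                  moreover have "n * Y \<le> u" using nN(2) k1 by (metis (no_types) le_trans mult.commute mult.left_commute mult_le_mono2 nat_mult_1_right)
                  moreover have "\<tau>9 \<le> 3000 * (n * k * Y) + 1000 * (n * k * Y) + 10"
                  proof -
                    have "kk * (3000 * N * Y + 1000 * Y) = 3000 * (kk * N * Y) + 1000 * (kk * Y)" by (simp add: algebra_simps)
                    moreover have "kk * N * Y \<le> k * n * Y" unfolding kk_def using NB by (intro mult_le_mono1 mult_le_mono) auto
                    moreover have "kk * Y \<le> n * k * Y"
                      using n1 by (intro mult_le_mono1) (auto simp: kk_def intro: min.coboundedI1 le_trans[of k "1 * k"] mult_le_mono1)
                    moreover have "k * n * Y = n * k * Y" by simp
                    ultimately show ?thesis using t9 by linarith
                  qed
                  moreover have "\<tau>7 \<le> 20 * n + 10" using t7 NB by simp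
                  ultimately have "30 + \<tau>2 + \<tau>3 + \<tau>4 + \<tau>5 + \<tau>6 + \<tau>7 + \<tau>9 \<le> 20000 * u"
                    using t2 t3 t4 t5 nN unfolding e3 by linarith
                  then show ?thesis by (simp add: u_def mult.assoc)
                qed
                have fin: "wp d M B.picks (\<lambda>s' \<tau>9. (output_set s' \<subseteq> {..<n} \<and> output_set s' \<noteq> {} \<and> card (output_set s') \<le> k
    \<and> sqrt (\<Sum>x<n. w x * (dist_to_set d x (output_set s'))\<^sup>2)
      \<le> 1000 * (sqrt (\<Sum>x<n. w x * (dist_to_set d x (alv s))\<^sup>2) + sqrt (\<Sum>x<n. w x * (dist_to_set d x Q)\<^sup>2)))
                   \<and> 30 + \<tau>2 + \<tau>3 + \<tau>4 + \<tau>5 + \<tau>6 + \<tau>7 + \<tau>9 \<le> 20000 * n * k * Y\<^sup>2) s8"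
                proof (rule wp_use[OF B.picks[OF st8]], simp, goal_cases)
                  case (1 s9 \<tau>9)
                  from 1(2) obtain z a ch where z: "ivar s9 ''m'' = kk" "B.G.greedy_run z kk a ch"
                    "\<And>i. i < kk \<Longrightarrow> iarr s9 ''S'' i = C (z i)" and t9: "\<tau>9 \<le> kk * (3000 * N * Y + 1000 * Y) + 10" by blast
                  have out: "output_set s9 = C ` z ` {..<kk}" using z(1,3) by (auto simp: output_set_def)
                  have zN: "z i < N" if "i < kk" for i
                    using z(2) that unfolding B.G.greedy_run_def by (metis order_refl)
                  have "card (output_set s9) \<le> card {..<kk}" unfolding out image_image by (rule card_image_le) simp
                  moreover have "output_set s9 \<subseteq> {..<n}" unfolding out using zN CN by auto
                  moreover have "output_set s9 \<noteq> {}" unfolding out using k1 N1 by (auto simp: kk_def lessThan_empty_iff)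
                  moreover note B.picks_cost[OF p(1) \<mu>_def z(2) kk_def Q, folded out, unfolded im] time[OF t9]
                  ultimately show ?case by (simp add: kk_def)
                qed
                show ?case
                proof (rule wp_Seq, rule wp_Cond, goal_cases)
                  case 2
                  then have e: "s7\<lparr>ivar := (ivar s7)(''kk'' := ival s7 (IVar ''nc''))\<rparr> = s8"
                    using st7(4,5) by (simp add: s8_def kk_def)
                  show ?case
                  proof (rule wp_ISet, simp, unfold e B.picks_def[symmetric], rule wp_use[OF fin], goal_cases)
                    case (1 s9 \<tau>9)
                    then show ?case by simp
                  qed
                next
                  case 3
                  then have e: "s7\<lparr>ivar := (ivar s7)(''kk'' := ival s7 (IVar ''k''))\<rparr> = s8"
                    using st7(4,5) by (simp add: s8_def kk_def)
                  show ?case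
                  proof (rule wp_ISet, simp, unfold e B.picks_def[symmetric], rule wp_use[OF fin], goal_cases)
                    case (1 s9 \<tau>9)
                    then show ?case by simp
                  qed
                qed auto
              qed (use nc6 in auto)
            qed
          qed
        qed
      qed auto
    qed auto
  qed
qed

end

section \<open>The whole program\<close>

definition kmeans_prog :: com where
  "kmeans_prog = Seq merge_tree final_stage"

lemma half_le_ln_2: "1 / 2 \<le> ln (2::real)"
  using ln_le_minus_one[of "1 / 2"] by (simp add: ln_div)

context kmeans_run
begin

text \<open>\<open>50 * n * Y\<close> is below \<open>2 ^ (2 * Y + 6)\<close>, so a single step
  costs at most \<open>2 * Y + 7\<close>.\<close>

lemma word_cost_M: "word_cost M \<le> 9 * Y"
proof -
  have "Y < 2 ^ Y" by (rule less_exp)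
  then have "n * Y \<le> 2 ^ Y * 2 ^ Y" using nY by (intro mult_le_mono) auto
  then have "50 * n * Y \<le> 50 * (2 ^ Y * 2 ^ Y)" by simp
  also have "\<dots> < 2 ^ Y * 2 ^ Y * 2 ^ 6" by simp
  also have "\<dots> = 2 ^ (Y + Y + 6)" by (simp only: power_add)
  finally have "M < 2 ^ (Y + Y + 6)" by (simp only: M)
  then have "floorlog 2 M \<le> Y + Y + 6" by (intro floorlog_leI) simp_all
  then show ?thesis using Y1 by simp
qed

lemma bounded_input: "bounded M (input_state n w k)"
proof -
  have "n \<le> M" "k \<le> M" using M_ge(1) kn by linarith+
  then show ?thesis by (auto simp: bounded_def input_state_def)
qed

lemma kmeans_prog:
  assumes Q: "Q \<subseteq> {..<n}" "Q \<noteq> {}" "card Q \<le> k"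
  shows "\<exists>t s. exec d kmeans_prog (input_state n w k) t s \<and> output_set s \<subseteq> {..<n} \<and> output_set s \<noteq> {}
    \<and> card (output_set s) \<le> k \<and> t \<le> 540000 * (n * k * Y ^ 5)
    \<and> sqrt (\<Sum>x<n. w x * (dist_to_set d x (output_set s))\<^sup>2)
       \<le> 55000 * max 1 (ln (real n / real k)) * sqrt (\<Sum>x<n. w x * (dist_to_set d x Q)\<^sup>2)"
proof -
  define opt where "opt = sqrt (\<Sum>x<n. w x * (dist_to_set d x Q)\<^sup>2)"
  define \<kappa> where "\<kappa> = max 1 (ln (real n / real k))"
  have opt0: "0 \<le> opt" unfolding opt_def by (intro real_sqrt_ge_zero sum_nonneg mult_nonneg_nonneg) (auto simp: w0)
  have inp: "inp (input_state n w k)" by (simp add: inp_def input_state_def)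
  have "wp d M kmeans_prog (\<lambda>s \<tau>. output_set s \<subseteq> {..<n} \<and> output_set s \<noteq> {}
    \<and> card (output_set s) \<le> k \<and> \<tau> \<le> 60000 * (n * k * Y ^ 4)
    \<and> sqrt (\<Sum>x<n. w x * (dist_to_set d x (output_set s))\<^sup>2) \<le> 55000 * \<kappa> * opt) (input_state n w k)"
    unfolding kmeans_prog_def
  proof (rule wp_Seq, rule wp_use[OF merge_tree[OF inp Q]], goal_cases)
    case (1 s1 \<tau>1)
    note fr1 = frameD[OF 1(1), simplified]
    from 1(2) obtain j where s1: "alv s1 \<noteq> {}" "card (alv s1) \<le> 6 * k * Y" "\<tau>1 \<le> 40000 * n * k * Y ^ 4"
      and j: "sqrt (\<Sum>x<n. w x * (dist_to_set d x (alv s1))\<^sup>2) \<le> 2 * exp 2 * real j * opt" "j = 0 \<or> k * 2 ^ j \<le> 2 * n"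
      unfolding opt_def by blast
    have inp1: "inp s1" using inp by (simp add: inp_def fr1)
    \<comment> \<open>\<open>k * 2 ^ j <= 2 * n\<close> gives
      \<open>(j - 1) * ln 2 <= \<kappa>\<close>; with \<open>ln 2 >= 1 / 2\<close> this is
      \<open>j <= 2 * \<kappa> + 1\<close>, and \<open>\<kappa> >= 1\<close> absorbs the
      rest.\<close>
    have jk: "real j \<le> 3 * \<kappa>"
    proof (cases "j = 0")
      case False
      then have "real (k * 2 ^ j) \<le> real (2 * n)" using j(2) by (intro of_nat_mono) blast
      then have "2 ^ j \<le> 2 * (real n / real k)" using k1 by (simp add: field_simps)
      then have "ln (2 ^ j) \<le> ln (2 * (real n / real k))" using k1 n1 by (subst ln_le_cancel_iff) auto
      moreover have "ln (2 * (real n / real k)) = ln 2 + ln (real n / real k)" using k1 n1 by (subst ln_mult) auto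
      ultimately have "real j * ln 2 \<le> ln 2 + ln (real n / real k)" by (simp only: ln_realpow)
      also have "\<dots> \<le> ln 2 + \<kappa>" by (simp add: \<kappa>_def)
      finally have "(real j - 1) * ln 2 \<le> \<kappa>" by (simp add: algebra_simps)
      moreover have "(real j - 1) * (1 / 2) \<le> (real j - 1) * ln 2"
        using False half_le_ln_2 by (intro mult_left_mono) auto
      moreover have "1 \<le> \<kappa>" by (simp add: \<kappa>_def)
      ultimately show ?thesis by simp
    qed (simp add: \<kappa>_def)
    show ?case
    proof (rule wp_use[OF final_stage[OF inp1 s1(1,2) Q]], goal_cases)
      case (1 s2 \<tau>2)
      have "sqrt (\<Sum>x<n. w x * (dist_to_set d x (output_set s2))\<^sup>2)
         \<le> 1000 * (sqrt (\<Sum>x<n. w x * (dist_to_set d x (alv s1))\<^sup>2) + opt)" using 1(2) unfolding opt_def by blast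
      also have "\<dots> \<le> 1000 * (2 * exp 2 * real j * opt + opt)" using j(1) by (intro mult_left_mono add_right_mono) simp_all
      \<comment> \<open>\<open>exp 2\<close> is at most 9 and \<open>j\<close> at most
        \<open>3 * \<kappa>\<close>; the sum is \<open>1000 * (54 + 1)\<close>.\<close>
      also have "\<dots> \<le> 1000 * (2 * 9 * (3 * \<kappa>) * opt + \<kappa> * opt)"
      proof (intro mult_left_mono add_mono mult_right_mono[OF _ opt0] mult_mono jk)
        have "exp (1::real) ^ 2 \<le> 3 ^ 2" by (intro power_mono exp_le) auto
        then show "exp (2::real) \<le> 9" by (simp add: exp_double[symmetric])
        show "opt \<le> \<kappa> * opt" using mult_right_mono[of 1 \<kappa> opt] opt0 by (simp add: \<kappa>_def)
      qed auto
      also have "\<dots> = 55000 * \<kappa> * opt" by simp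
      finally have cost: "sqrt (\<Sum>x<n. w x * (dist_to_set d x (output_set s2))\<^sup>2) \<le> 55000 * \<kappa> * opt" .
      have "\<tau>2 \<le> 20000 * (n * k * Y\<^sup>2)" using 1(2) by (simp add: mult.assoc)
      moreover have "n * k * Y\<^sup>2 \<le> n * k * Y ^ 4" using Y1 by (intro mult_le_mono2 power_increasing) auto
      moreover have "\<tau>1 \<le> 40000 * (n * k * Y ^ 4)" using s1(3) by (simp add: mult.assoc)
      ultimately have time: "\<tau>1 + \<tau>2 \<le> 60000 * (n * k * Y ^ 4)" by linarith
      show ?case using 1(2) cost time by blast
    qed
  qed
  then obtain s t \<tau> where s: "exec d kmeans_prog (input_state n w k) t s" "t \<le> word_cost M * \<tau>"
    "output_set s \<subseteq> {..<n}" "output_set s \<noteq> {}" "card (output_set s) \<le> k" "\<tau> \<le> 60000 * (n * k * Y ^ 4)"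
    "sqrt (\<Sum>x<n. w x * (dist_to_set d x (output_set s))\<^sup>2) \<le> 55000 * \<kappa> * opt"
    unfolding wp_def using bounded_input by blast
  have "t \<le> (9 * Y) * (60000 * (n * k * Y ^ 4))"
    using s(2) mult_le_mono[OF word_cost_M s(6)] by linarith
  also have "\<dots> = 540000 * (n * k * (Y * Y ^ 4))" by simp
  also have "Y * Y ^ 4 = Y ^ 5" by (simp add: numeral_eq_Suc)
  finally show ?thesis using s unfolding \<kappa>_def opt_def by blast
qed

end

section \<open>Choosing the parameters from the aspect ratio\<close>

lemma min_distance:
  fixes n :: nat
  assumes "Metric_space {..<n} d" "1 \<le> n"
  obtains dl where "0 < dl" "1 \<le> aspect_ratio {..<n} d"
    "\<And>x y. x < n \<Longrightarrow> y < n \<Longrightarrow> x \<noteq> y \<Longrightarrow> dl \<le> d x y"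
    "\<And>x y. x < n \<Longrightarrow> y < n \<Longrightarrow> d x y \<le> aspect_ratio {..<n} d * dl"
proof -
  interpret Metric_space "{..<n}" d by fact
  define D where "D = {d x y | x y. x \<in> {..<n} \<and> y \<in> {..<n} \<and> d x y \<noteq> 0}"
  have fin: "finite D"
  proof -
    have "D \<subseteq> (\<lambda>(x, y). d x y) ` ({..<n} \<times> {..<n})" by (auto simp: D_def)
    then show ?thesis by (rule finite_subset) auto
  qed
  have pos: "0 < r" if "r \<in> D" for r
    using that nonneg by (auto simp: D_def less_le)
  have inD: "d x y \<in> D" if "x < n" "y < n" "x \<noteq> y" for x y
  proof -
    have "d x y \<noteq> 0" using that by simp
    then show ?thesis unfolding D_def using that by blast
  qed
  have ar: "aspect_ratio {..<n} d = (if D = {} then 1 else Max D / Min D)"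
    unfolding aspect_ratio_def D_def Let_def ..
  show ?thesis
  proof (cases "D = {}")
    case True
    \<comment> \<open>Without non-zero distances there are no two distinct points, and any positive
      \<open>dl\<close> will do.\<close>
    show ?thesis
    proof (rule that[of 1])
      show "d x y \<le> aspect_ratio {..<n} d * 1" if "x < n" "y < n" for x y
        using that inD[of x y] True ar by (cases "x = y") auto
    qed (use True ar inD in auto)
  next
    case False
    then have m: "Min D \<in> D" "Max D \<in> D" using fin by auto
    have a: "aspect_ratio {..<n} d * Min D = Max D" using ar False pos[OF m(1)] by simp
    show ?thesis
    proof (rule that[of "Min D"])
      show "0 < Min D" using pos m by blast
      have "Min D \<le> Max D" using m fin by simp
      then show "1 \<le> aspect_ratio {..<n} d" using ar False pos[OF m(1)] by simp
      show "Min D \<le> d x y" if "x < n" "y < n" "x \<noteq> y" for x y using inD[OF that] fin by simp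
      show "d x y \<le> aspect_ratio {..<n} d * Min D" if "x < n" "y < n" for x y
        unfolding a using that inD[of x y] fin pos[OF m(2)] by (cases "x = y") auto
    qed
  qed
qed

text \<open>\<open>Y\<close> and \<open>dl\<close> occur only in the analysis: the program neither
  receives nor computes the aspect ratio. The fifth power collects \<open>Y ^ 4\<close> steps and
  one factor for the cost of a step; 32 is the fifth power of the 2 in
  \<open>Y <= 2 * \<xi>\<close>.\<close>

lemma kmeans_prog_correct:
  assumes ws: "weighted_metric_space {..<n} w d" and k: "1 \<le> k" "k \<le> n"
  shows "\<exists>t s. exec d kmeans_prog (input_state n w k) t s
        \<and> output_set s \<subseteq> {..<n} \<and> card (output_set s) \<le> k
        \<and> kmeans_approx (55000\<^sup>2 * (max 1 (ln (real n / real k)))\<^sup>2) {..<n} w d k (output_set s)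
        \<and> real t \<le> (540000 * 32) * (real n * real k) * (1 + ln (real n) + ln (aspect_ratio {..<n} d)) ^ 5"
proof -
  interpret W: weighted_metric_space "{..<n}" w d by fact
  have n1: "1 \<le> n" using k by simp
  have ms: "Metric_space {..<n} d" by unfold_locales
  obtain dl where dl: "0 < dl" "1 \<le> aspect_ratio {..<n} d"
    "\<And>x y. x < n \<Longrightarrow> y < n \<Longrightarrow> x \<noteq> y \<Longrightarrow> dl \<le> d x y"
    "\<And>x y. x < n \<Longrightarrow> y < n \<Longrightarrow> d x y \<le> aspect_ratio {..<n} d * dl"
    using min_distance[OF ms n1] by blast
  define \<Delta> where "\<Delta> = aspect_ratio {..<n} d"
  define \<xi> where "\<xi> = 1 + ln (real n) + ln \<Delta>"
  have \<Delta>1: "1 \<le> \<Delta>" using dl(2) by (simp add: \<Delta>_def)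
  \<comment> \<open>The added 1 keeps \<open>Y\<close> positive when
    \<open>real n * \<Delta>\<close> is 1.\<close>
  define Y where "Y = nat \<lceil>log 2 (real n * \<Delta>)\<rceil> + 1"
  have n\<Delta>: "1 \<le> real n * \<Delta>" using mult_mono[of 1 "real n" 1 \<Delta>] n1 \<Delta>1 by simp
  have "real n * \<Delta> = 2 powr log 2 (real n * \<Delta>)" using n\<Delta> by simp
  also have "\<dots> \<le> 2 powr real Y" unfolding Y_def by (intro powr_mono) linarith+
  finally have nY: "real n * \<Delta> \<le> 2 ^ Y" by (simp add: powr_realpow)
  have Yb: "real Y \<le> 2 * \<xi>"
  proof -
    have "0 \<le> log 2 (real n * \<Delta>)" using n\<Delta> by simp
    then have "real Y \<le> log 2 (real n * \<Delta>) + 2" unfolding Y_def by linarith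
    also have "log 2 (real n * \<Delta>) = (ln (real n) + ln \<Delta>) / ln 2"
      using n1 \<Delta>1 by (simp add: log_def ln_mult)
    also have "\<dots> \<le> (ln (real n) + ln \<Delta>) / (1 / 2)"
      using n1 \<Delta>1 half_le_ln_2 by (intro divide_left_mono) auto
    finally show ?thesis by (simp add: \<xi>_def)
  qed
  interpret kmeans_run n d w k Y "50 * n * Y" dl
  proof
    have "real n \<le> real n * \<Delta>" using mult_left_mono[OF \<Delta>1, of "real n"] by simp
    then have "real n \<le> 2 ^ Y" using nY by linarith
    then show "n \<le> 2 ^ Y" by (simp flip: of_nat_le_iff)
    show "real n * d x y \<le> 2 ^ Y * dl" if "x < n" "y < n" for x y
    proof -
      have "real n * d x y \<le> real n * (\<Delta> * dl)" unfolding \<Delta>_def by (intro mult_left_mono dl(4) that) auto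
      also have "\<dots> = (real n * \<Delta>) * dl" by simp
      also have "\<dots> \<le> 2 ^ Y * dl" using nY dl(1) by (intro mult_right_mono) auto
      finally show ?thesis .
    qed
  qed (use W.weight_nonneg k dl in \<open>auto simp: Y_def\<close>)
  have fin: "finite {S. kmeans_feasible {..<n} k S}"
    by (rule finite_subset[of _ "Pow {..<n}"]) (auto simp: kmeans_feasible_def)
  have "kmeans_feasible {..<n} k {0}" using k by (simp add: kmeans_feasible_def)
  then have ne: "{S. kmeans_feasible {..<n} k S} \<noteq> {}" by blast
  have "kmeans_opt {..<n} w d k \<in> kmeans_cost {..<n} w d ` {S. kmeans_feasible {..<n} k S}"
    unfolding kmeans_opt_def using fin ne by (intro Min_in) auto
  then obtain Q where Q: "Q \<subseteq> {..<n}" "Q \<noteq> {}" "card Q \<le> k" "kmeans_opt {..<n} w d k = kmeans_cost {..<n} w d Q"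
    by (auto simp: kmeans_feasible_def)
  obtain t s where s: "exec d kmeans_prog (input_state n w k) t s" "output_set s \<subseteq> {..<n}" "output_set s \<noteq> {}"
    "card (output_set s) \<le> k" "t \<le> 540000 * (n * k * Y ^ 5)"
    "sqrt (\<Sum>x<n. w x * (dist_to_set d x (output_set s))\<^sup>2)
       \<le> 55000 * max 1 (ln (real n / real k)) * sqrt (\<Sum>x<n. w x * (dist_to_set d x Q)\<^sup>2)"
    using kmeans_prog[OF Q(1-3)] by blast
  have c0: "0 \<le> kmeans_cost {..<n} w d S" for S
    unfolding kmeans_cost_def by (intro sum_nonneg mult_nonneg_nonneg) (auto simp: w0)
  have "kmeans_cost {..<n} w d (output_set s) = (sqrt (kmeans_cost {..<n} w d (output_set s)))\<^sup>2"
    using c0 by simp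
  also have "\<dots> \<le> (55000 * max 1 (ln (real n / real k)) * sqrt (kmeans_cost {..<n} w d Q))\<^sup>2"
    using s(6) c0 unfolding kmeans_cost_def[symmetric] by (intro power_mono) auto
  also have "\<dots> = 55000\<^sup>2 * (max 1 (ln (real n / real k)))\<^sup>2 * kmeans_opt {..<n} w d k"
    using c0[of Q] Q(4) by (simp add: power_mult_distrib)
  finally have approx: "kmeans_approx (55000\<^sup>2 * (max 1 (ln (real n / real k)))\<^sup>2) {..<n} w d k (output_set s)"
    using s by (simp add: kmeans_approx_def kmeans_feasible_def)
  have "real t \<le> real (540000 * (n * k * Y ^ 5))" using s(5) by (rule of_nat_mono)
  also have "\<dots> = 540000 * (real n * real k) * real Y ^ 5" by simp
  also have "\<dots> \<le> 540000 * (real n * real k) * (2 * \<xi>) ^ 5"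
    using Yb by (intro mult_left_mono power_mono) auto
  also have "\<dots> = (540000 * 32) * (real n * real k) * \<xi> ^ 5" by (simp add: power_mult_distrib)
  finally show ?thesis using s(1,2,4) approx unfolding \<xi>_def \<Delta>_def by blast
qed

text \<open>The maximum with 1 is needed when \<open>k\<close> is close to \<open>n\<close>: there
  the logarithm tends to 0, while the analysis still loses a constant factor.\<close>

theorem theorem1p3:
  shows "\<exists>(prog :: com) (A :: real) (C :: real) (c :: nat).
    \<forall>(n :: nat) (w :: nat \<Rightarrow> real) (d :: nat \<Rightarrow> nat \<Rightarrow> real) (k :: nat).
      weighted_metric_space {..<n} w d \<longrightarrow> 1 \<le> k \<longrightarrow> k \<le> n \<longrightarrow>
      (\<exists>t s. exec d prog (input_state n w k) t s
        \<and> output_set s \<subseteq> {..<n}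
        \<and> card (output_set s) \<le> k
        \<and> kmeans_approx (A * (max 1 (ln (real n / real k)))\<^sup>2) {..<n} w d k (output_set s)
        \<and> real t \<le> C * (real n * real k) * (1 + ln (real n) + ln (aspect_ratio {..<n} d)) ^ c)"
  using kmeans_prog_correct by blast

end
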